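(* Let $d\ge 1$, let $(t_n)_{n\in\mathbb{Z}^d}\subset\mathbb{R}^d$, and define $f_n(x)=\frac{1}{(2\pi)^{d/2}}e^{i\langle x,t_n\rangle}$ for $n\in\mathbb{Z}^d$. Suppose $(f_n)_{n\in\mathbb{Z}^d}$ is a uniformly invertible Riesz basis for $L_2([-\pi,\pi]^d)$. Then for every $f\in PW_{[-\pi,\pi]^d}$ there exists a unique sequence of polynomials $(\Psi_\ell)_{\ell\in\mathbb{N}}$, $\Psi_\ell:\mathbb{R}^d\to\mathbb{C}$, such that (a) $\Psi_\ell$ has coordinate degree at most $2\ell$; (b) $\Psi_\ell(t_n)=f(t_n)$ for all $n\in C_{\ell,d}$; (c) $f(t)=\lim_{\ell\to\infty}\Psi_\ell(t)\,\frac{\mathrm{SINC}(\pi t)}{Q_{d,\ell}(t)}$, where the limit holds both in $L_2(\mathbb{R}^d)$ and uniformly on $\mathbb{R}^d$.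
   Context: $\mathbb{N}=\{1,2,\dots\}$. Points of $\mathbb{R}^d$ are written $t=(t(1),\dots,t(d))$. $C_{\ell,d}=\{-\ell,\dots,\ell\}^d$. A polynomial in $t(1),\dots,t(d)$ (complex coefficients) has coordinate degree at most $2\ell$ if its degree in each single variable $t(i)$ is at most $2\ell$. $PW_{[-\pi,\pi]^d}$ is the space of $f\in L_2(\mathbb{R}^d)$ (complex-valued) whose (inverse) Fourier transform is supported in $[-\pi,\pi]^d$, with the $L_2(\mathbb{R}^d)$ norm; its elements are identified with their continuous (entire) representatives. $\mathrm{sinc}(x)=\sin(x)/x$ (value $1$ at $0$), $\mathrm{SINC}(x)=\prod_{i=1}^d\mathrm{sinc}(x(i))$, so $\mathrm{SINC}(\pi t)=\prod_i \mathrm{sinc}(\pi t(i))$. $Q_{d,\ell}(t)=\prod_{i=1}^d\prod_{k=1}^\ell\big(1-\frac{t(i)^2}{k^2}\big)$. The quotient $\mathrm{SINC}(\pi t)/Q_{d,\ell}(t)$ has only removable singularities and denotes its continuous extension $\prod_{i=1}^d\prod_{k=\ell+1}^\infty\big(1-\frac{t(i)^2}{k^2}\big)$. Let $e_n(x)=\frac{1}{(2\pi)^{d/2}}e^{i\langle x,n\rangle}$, an orthonormal basis of $L_2([-\pi,\pi]^d)$, and let $P_\ell$ be the orthogonal projection onto $\mathrm{span}\{e_n: n\in C_{\ell,d}\}$. A Riesz basis is the image of an orthonormal basis under a bounded linear bijection with bounded inverse. $(f_n)_{n\in\mathbb{Z}^d}$ is a uniformly invertible Riesz basis if the linear map $L$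 with $Le_n=f_n$ is a bounded bijection of $L_2([-\pi,\pi]^d)$ with bounded inverse, for every $\ell\in\mathbb{N}$ the compression $P_\ell L P_\ell$ is invertible as an operator on the finite-dimensional space $\mathrm{ran}\,P_\ell$, and $\sup_{\ell\in\mathbb{N}}\|(P_\ell L P_\ell)^{-1}\|<\infty$ (operator norm on $\mathrm{ran}\,P_\ell$). *)

theory Defs
  imports "HOL-Probability.Sinc_Integral"
begin

section \<open>Square integrable functions\<close>

text \<open>Elements of L2 are represented by functions; equality in L2 is equality almost everywhere,
  which is why the notions below that concern L2 as a space are stated with \<open>AE\<close>.\<close>

definition L2 :: "'a measure \<Rightarrow> ('a \<Rightarrow> complex) set" where
  "L2 M = {f \<in> borel_measurable M. integrable M (\<lambda>x. (norm (f x))\<^sup>2)}"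

definition L2_norm :: "'a measure \<Rightarrow> ('a \<Rightarrow> complex) \<Rightarrow> real" where
  "L2_norm M f = sqrt (\<integral>x. (norm (f x))\<^sup>2 \<partial>M)"

definition L2_inner :: "'a measure \<Rightarrow> ('a \<Rightarrow> complex) \<Rightarrow> ('a \<Rightarrow> complex) \<Rightarrow> complex" where
  "L2_inner M f g = (\<integral>x. f x * cnj (g x) \<partial>M)"

text \<open>The membership requirements matter: \<^const>\<open>L2_norm\<close> is meaningless outside \<^const>\<open>L2\<close>,
  since the Bochner integral of a non-integrable function is 0.\<close>

definition L2_tendsto ::
    "'a measure \<Rightarrow> ('i \<Rightarrow> 'a \<Rightarrow> complex) \<Rightarrow> ('a \<Rightarrow> complex) \<Rightarrow> 'i filter \<Rightarrow> bool" where
  "L2_tendsto M F f A \<longleftrightarrow>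
     f \<in> L2 M \<and> (\<forall>\<^sub>F i in A. F i \<in> L2 M) \<and>
     ((\<lambda>i. L2_norm M (\<lambda>x. F i x - f x)) \<longlongrightarrow> 0) A"

definition L2_opnorm ::
    "'a measure \<Rightarrow> ('a \<Rightarrow> complex) set \<Rightarrow> (('a \<Rightarrow> complex) \<Rightarrow> 'a \<Rightarrow> complex) \<Rightarrow> ennreal" where
  "L2_opnorm M V T = (SUP f\<in>{f \<in> V. L2_norm M f \<le> 1}. ennreal (L2_norm M (T f)))"

definition L2_bounded_linear ::
    "'a measure \<Rightarrow> (('a \<Rightarrow> complex) \<Rightarrow> 'a \<Rightarrow> complex) \<Rightarrow> bool" where
  "L2_bounded_linear M T \<longleftrightarrow>
     (\<forall>f\<in>L2 M. T f \<in> L2 M) \<and>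
     (\<forall>f\<in>L2 M. \<forall>g\<in>L2 M. (AE x in M. f x = g x) \<longrightarrow> (AE x in M. T f x = T g x)) \<and>
     (\<forall>f\<in>L2 M. \<forall>g\<in>L2 M. AE x in M. T (\<lambda>y. f y + g y) x = T f x + T g x) \<and>
     (\<forall>c. \<forall>f\<in>L2 M. AE x in M. T (\<lambda>y. c * f y) x = c * T f x) \<and>
     L2_opnorm M (L2 M) T < \<infinity>"

definition L2_isomorphism ::
    "'a measure \<Rightarrow> (('a \<Rightarrow> complex) \<Rightarrow> 'a \<Rightarrow> complex) \<Rightarrow> bool" where
  "L2_isomorphism M T \<longleftrightarrow>
     L2_bounded_linear M T \<and>
     (\<exists>S. L2_bounded_linear M S \<and>
       (\<forall>f\<in>L2 M. (AE x in M. S (T f) x = f x) \<and> (AE x in M. T (S f) x = f x)))"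

text \<open>Orthogonal projection onto a subspace \<open>V\<close>. The projection is determined up to equality
  almost everywhere; it is used below only for a space \<open>V\<close> of trigonometric polynomials,
  where elements that are equal almost everywhere are equal, so that nothing is left to choose.\<close>

definition L2_proj ::
    "'a measure \<Rightarrow> ('a \<Rightarrow> complex) set \<Rightarrow> ('a \<Rightarrow> complex) \<Rightarrow> 'a \<Rightarrow> complex" where
  "L2_proj M V f = (SOME g. g \<in> V \<and> (\<forall>v\<in>V. L2_inner M (\<lambda>x. f x - g x) v = 0))"


section \<open>Exponentials and uniformly invertible Riesz bases\<close>

definition cube :: "(real^'d) set" where
  "cube = {x. \<forall>i. x $ i \<in> {-pi..pi}}"

abbreviation cube_measure :: "(real^'d) measure" where
  "cube_measure \<equiv> restrict_space lborel cube"

definition expo :: "real^'d \<Rightarrow> real^'d \<Rightarrow> complex" where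
  "expo s x = exp (\<i> * of_real (x \<bullet> s)) / of_real ((2 * pi) powr (real CARD('d) / 2))"

definition basis_expo :: "int^'d \<Rightarrow> real^'d \<Rightarrow> complex" where
  "basis_expo n = expo (\<chi> i. of_int (n $ i))"

definition index_cube :: "nat \<Rightarrow> (int^'d) set" where
  "index_cube l = {n. \<forall>i. n $ i \<in> {- int l..int l}}"

lemma finite_index_cube: "finite (index_cube l)"
proof (rule finite_imageD)
  show "finite (vec_nth ` index_cube l)"
    by (rule finite_subset[of _ "UNIV \<rightarrow>\<^sub>E {- int l..int l}"])
      (auto simp: index_cube_def intro!: finite_PiE)
qed (auto simp: inj_on_def vec_eq_iff)

definition trig_space :: "nat \<Rightarrow> (real^'d \<Rightarrow> complex) set" where
  "trig_space l = {\<lambda>x. \<Sum>n\<in>index_cube l. c n * basis_expo n x | c. True}"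

definition compression ::
    "nat \<Rightarrow> ((real^'d \<Rightarrow> complex) \<Rightarrow> real^'d \<Rightarrow> complex) \<Rightarrow> (real^'d \<Rightarrow> complex) \<Rightarrow> real^'d \<Rightarrow> complex"
  where
  "compression l L g =
     L2_proj cube_measure (trig_space l) (L (L2_proj cube_measure (trig_space l) g))"

definition uniformly_invertible_Riesz_basis :: "(int^'d \<Rightarrow> real^'d \<Rightarrow> complex) \<Rightarrow> bool" where
  "uniformly_invertible_Riesz_basis f \<longleftrightarrow>
     (\<exists>L. L2_isomorphism cube_measure L \<and>
          (\<forall>n. f n \<in> L2 cube_measure \<and> (AE x in cube_measure. L (basis_expo n) x = f n x)) \<and>
          (\<forall>l\<ge>1. bij_betw (compression l L) (trig_space l) (trig_space l)) \<and>
          (SUP l\<in>{1..}. L2_opnorm cube_measure (trig_space l)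
                          (the_inv_into (trig_space l) (compression l L))) < \<infinity>)"


section \<open>The Paley-Wiener space\<close>

text \<open>The inverse Fourier transform of \<open>f \<in> L2\<close> is the limit in L2 of the inverse Fourier integrals
  of \<open>f\<close> truncated to balls. Note that \<open>expo t x\<close> is the kernel
  \<open>(2 pi) powr (- d / 2) * exp (i <x, t>)\<close>, including the normalisation.\<close>

definition is_inverse_Fourier_L2 :: "(real^'d \<Rightarrow> complex) \<Rightarrow> (real^'d \<Rightarrow> complex) \<Rightarrow> bool" where
  "is_inverse_Fourier_L2 f g \<longleftrightarrow>
     L2_tendsto lborel (\<lambda>R x. LINT t:cball 0 R|lborel. f t * expo t x) g at_top"

text \<open>The continuity condition selects the continuous representative.\<close>

definition PW :: "(real^'d \<Rightarrow> complex) set" where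
  "PW = {f. continuous_on UNIV f \<and> f \<in> L2 lborel \<and>
            (\<exists>g. is_inverse_Fourier_L2 f g \<and> (AE x in lborel. x \<notin> cube \<longrightarrow> g x = 0))}"


section \<open>Polynomials and the interpolation kernel\<close>

definition poly_coord_degree_le :: "nat \<Rightarrow> (real^'d \<Rightarrow> complex) \<Rightarrow> bool" where
  "poly_coord_degree_le m p \<longleftrightarrow>
     (\<exists>c :: nat^'d \<Rightarrow> complex.
        finite {k. c k \<noteq> 0} \<and> (\<forall>k. c k \<noteq> 0 \<longrightarrow> (\<forall>i. k $ i \<le> m)) \<and>
        p = (\<lambda>t. \<Sum>k | c k \<noteq> 0. c k * (\<Prod>i\<in>UNIV. of_real (t $ i) ^ (k $ i))))"

definition SINC :: "real^'d \<Rightarrow> real" where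
  "SINC x = (\<Prod>i\<in>UNIV. sinc (x $ i))"

definition Q :: "nat \<Rightarrow> real^'d \<Rightarrow> real" where
  "Q l t = (\<Prod>i\<in>UNIV. \<Prod>k=1..l. 1 - (t $ i)\<^sup>2 / (real k)\<^sup>2)"

definition tail_prod :: "nat \<Rightarrow> real \<Rightarrow> real" where
  "tail_prod l x = (\<Prod>k. 1 - x\<^sup>2 / (real (k + l + 1))\<^sup>2)"

text \<open>The quotient of \<open>SINC (pi t)\<close> by \<open>Q l t\<close>, extended continuously to the zeros of
  the denominator. The lemmas below show that the infinite product is
  the correct value everywhere and that the extension is continuous.\<close>

definition SINC_over_Q :: "nat \<Rightarrow> real^'d \<Rightarrow> real" where
  "SINC_over_Q l t =
     (if Q l t \<noteq> 0 then SINC (pi *\<^sub>R t) / Q l t else (\<Prod>i\<in>UNIV. tail_prod l (t $ i)))"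

lemma summable_tail: "summable (\<lambda>k. x\<^sup>2 / (real (k + l + 1))\<^sup>2)"
proof -
  have "summable (\<lambda>k. inverse ((real k)\<^sup>2))"
    by (rule inverse_power_summable) simp
  from summable_ignore_initial_segment[OF this, of "l + 1"]
  have "summable (\<lambda>k. x\<^sup>2 * inverse ((real (k + (l + 1)))\<^sup>2))"
    by (rule summable_mult)
  then show ?thesis by (simp add: divide_inverse add.assoc)
qed

lemma convergent_prod_tail: "convergent_prod (\<lambda>k. 1 - x\<^sup>2 / (real (k + l + 1))\<^sup>2)"
proof -
  have "summable (\<lambda>k. norm ((1 - x\<^sup>2 / (real (k + l + 1))\<^sup>2) - 1))"
    using summable_tail[of x l] by simp
  then show ?thesis
    by (intro abs_convergent_prod_imp_convergent_prod summable_imp_abs_convergent_prod)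
qed

lemma tail_prod_LIMSEQ: "(\<lambda>n. \<Prod>k<n. 1 - x\<^sup>2 / (real (k + l + 1))\<^sup>2) \<longlonglongrightarrow> tail_prod l x"
  using convergent_prod_LIMSEQ[OF convergent_prod_tail[of x l]]
  unfolding tail_prod_def LIMSEQ_lessThan_iff_atMost[symmetric] .

lemma sinc_eq_tail_prod:
  "sinc (pi * x) = (\<Prod>k=1..l. 1 - x\<^sup>2 / (real k)\<^sup>2) * tail_prod l x"
proof -
  let ?f = "\<lambda>k. 1 - x\<^sup>2 / (real k)\<^sup>2"
  have "(\<lambda>n. \<Prod>k=1..n. ?f k) \<longlonglongrightarrow> sinc (pi * x)"
    using sin_product_formula_real'[of x] by (cases "x = 0") auto
  then have A: "(\<lambda>n. \<Prod>k=1..n + l. ?f k) \<longlonglongrightarrow> sinc (pi * x)"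
    by (rule LIMSEQ_ignore_initial_segment)
  have "(\<Prod>k=1..n + l. ?f k) = (\<Prod>k=1..l. ?f k) * (\<Prod>k<n. ?f (k + l + 1))" for n
    by (induction n) (simp_all add: mult.assoc)
  moreover have "(\<lambda>n. (\<Prod>k=1..l. ?f k) * (\<Prod>k<n. ?f (k + l + 1)))
      \<longlonglongrightarrow> (\<Prod>k=1..l. ?f k) * tail_prod l x"
    by (intro tendsto_mult tendsto_const tail_prod_LIMSEQ)
  ultimately have "(\<lambda>n. \<Prod>k=1..n + l. ?f k) \<longlonglongrightarrow> (\<Prod>k=1..l. ?f k) * tail_prod l x"
    by simp
  with A show ?thesis
    by (rule LIMSEQ_unique)
qed

lemma SINC_eq_Q_tail_prod: "SINC (pi *\<^sub>R t) = Q l t * (\<Prod>i\<in>UNIV. tail_prod l (t $ i))"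
  unfolding SINC_def Q_def prod.distrib[symmetric]
  by (rule prod.cong[OF refl]) (simp only: vector_scaleR_component real_scaleR_def sinc_eq_tail_prod[of _ l])

lemma SINC_over_Q_eq: "SINC_over_Q l t = (\<Prod>i\<in>UNIV. tail_prod l (t $ i))"
  by (simp add: SINC_over_Q_def SINC_eq_Q_tail_prod[of _ l])

lemma continuous_on_tail_prod: "continuous_on UNIV (tail_prod l)"
proof -
  have *: "continuous_on {-r..r} (tail_prod l)" for r :: real
  proof -
    let ?g = "\<lambda>k x. - (x\<^sup>2 / (real (k + l + 1))\<^sup>2)"
    have cont: "continuous_on {-r..r} (?g k)" for k
      by (intro continuous_intros) auto
    have "uniformly_convergent_on {-r..r} (\<lambda>N x. \<Sum>k<N. norm (?g k x))"
    proof (rule Weierstrass_m_test'[OF _ summable_tail[of r l]])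
      fix k and x :: real assume "x \<in> {-r..r}"
      then have "\<bar>x\<bar> \<le> \<bar>r\<bar>" by auto
      then have "x\<^sup>2 \<le> r\<^sup>2" by (simp add: abs_le_square_iff)
      then show "norm (norm (?g k x)) \<le> r\<^sup>2 / (real (k + l + 1))\<^sup>2"
        by (simp add: divide_right_mono)
    qed
    then have "uniformly_convergent_on {-r..r} (\<lambda>N x. \<Prod>k<N. 1 + ?g k x)"
      by (intro Infinite_Products.uniformly_convergent_on_prod cont) auto
    then obtain h where h: "uniform_limit {-r..r} (\<lambda>N x. \<Prod>k<N. 1 + ?g k x) h sequentially"
      by (auto simp: uniformly_convergent_on_def)
    have "continuous_on {-r..r} h"
      by (rule uniform_limit_theorem[OF _ h])
        (auto intro!: always_eventually continuous_intros cont)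
    moreover have "h x = tail_prod l x" if "x \<in> {-r..r}" for x
      using LIMSEQ_unique[OF tendsto_uniform_limitI[OF h that]] tail_prod_LIMSEQ[of x l] by simp
    ultimately show ?thesis
      using continuous_on_cong by blast
  qed
  have "isCont (tail_prod l) x" for x
    by (rule continuous_on_interior[OF *[of "\<bar>x\<bar> + 1"]]) (auto simp: interior_atLeastAtMost_real)
  then show ?thesis
    by (simp add: continuous_at_imp_continuous_on)
qed

lemma continuous_on_SINC_over_Q: "continuous_on UNIV (SINC_over_Q l)"
proof -
  have "continuous_on UNIV (\<lambda>t :: real^'a. \<Prod>i\<in>UNIV. tail_prod l (t $ i))"
    by (intro continuous_intros continuous_on_compose2[OF continuous_on_tail_prod]) auto
  then show ?thesis
    by (simp add: SINC_over_Q_eq[abs_def])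
qed

end

theory Submission
  imports Defs "HOL-Probability.Characteristic_Functions"
begin

text \<open>
  Every \<open>f\<close> in the Paley-Wiener space is \<open>FT g\<close> for some \<open>g\<close> in L2 of the cube, where \<open>FT g s\<close> is the inner product of
  \<open>g\<close> with the exponential of frequency \<open>s\<close> (\<open>PW_representation\<close>). The theorem becomes a statement on \<open>g\<close>.

  Polynomials of coordinate degree at most \<open>2 l\<close>, multiplied by the kernel \<open>SINC_over_Q l\<close>, are exactly the transforms of
  trigonometric polynomials with frequencies in \<open>index_cube l\<close> (\<open>FT_trig_space\<close>, \<open>polynomial_kernel_eq_FT\<close>). Indeed the
  transform of \<open>basis_expo n\<close> is a translate of \<open>SINC\<close>, and the product formula for the sine shows that it is a Lagrange basis
  polynomial for the integer points of the cube times the kernel. Hence finding \<open>\<Psi> l\<close> means finding \<open>h\<close> in \<open>trig_space l\<close> such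
  that \<open>FT h\<close> takes the values \<open>f (t n) * SINC_over_Q l (t n)\<close> at the points \<open>t n\<close>.

  The operator \<open>L\<close> of the Riesz basis maps \<open>basis_expo n\<close> to the exponential of frequency \<open>t n\<close>, so \<open>FT h (t n)\<close> is the inner
  product of \<open>h\<close> with \<open>L (basis_expo n)\<close>. The interpolation problem on \<open>trig_space l\<close> is therefore governed by the adjoint of the
  compression of \<open>L\<close>. Its invertibility gives existence (\<open>trig_interpolation_exists\<close>), and the uniform bound on the inverses
  gives uniqueness and an estimate with constants independent of \<open>l\<close> (\<open>compression_stability\<close>).

  For convergence let \<open>q\<close> be a trigonometric polynomial close to \<open>g\<close> (\<open>trig_polys_dense\<close>) and let \<open>h\<close> be the solution for a
  large \<open>l\<close>. The samples of \<open>FT (h - q)\<close> are those of \<open>FT (g - q)\<close>, up to the error \<open>f (t n) * (SINC_over_Q l (t n) - 1)\<close>. This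
  error tends to 0 in the square mean: the values \<open>f (t n)\<close> are square summable (\<open>Bessel_bound\<close>), and the kernel is bounded by 1 and
  tends to 1 (\<open>abs_SINC_over_Q_le_1\<close>, \<open>SINC_over_Q_tendsto_1\<close>). By stability the solutions converge to \<open>g\<close> in L2 of the cube. Since \<open>FT\<close>
  is a contraction both into the bounded functions (\<open>norm_FT_le\<close>) and into L2 of the whole space (\<open>Plancherel_inequality\<close>),
  the two asserted limits follow.
\<close>

section \<open>The geometry of L2\<close>

lemma borel_measurable_cnj [measurable (raw)]:
  "f \<in> borel_measurable M \<Longrightarrow> (\<lambda>x. cnj (f x)) \<in> borel_measurable M"
  by (rule borel_measurable_continuous_on[of cnj]) (auto intro: continuous_intros)

lemma L2_measurable [measurable_dest]: "f \<in> L2 M \<Longrightarrow> f \<in> borel_measurable M"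
  by (simp add: L2_def)

lemma L2_integrable_square: "f \<in> L2 M \<Longrightarrow> integrable M (\<lambda>x. (norm (f x))\<^sup>2)"
  by (simp add: L2_def)

lemma L2_integrable_norm_mult:
  assumes "f \<in> L2 M" "g \<in> L2 M"
  shows "integrable M (\<lambda>x. norm (f x) * norm (g x))"
proof (rule Bochner_Integration.integrable_bound)
  show "integrable M (\<lambda>x. (norm (f x))\<^sup>2 + (norm (g x))\<^sup>2)"
    using assms by (intro Bochner_Integration.integrable_add L2_integrable_square)
  show "(\<lambda>x. norm (f x) * norm (g x)) \<in> borel_measurable M"
    using assms by measurable
  have "norm (norm a * norm b) \<le> norm ((norm a)\<^sup>2 + (norm b)\<^sup>2)" for a b :: complex
    using sum_squares_bound[of "norm a" "norm b"] mult_nonneg_nonneg[OF norm_ge_zero[of a] norm_ge_zero[of b]]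
    unfolding real_norm_def by linarith
  then show "AE x in M. norm (norm (f x) * norm (g x)) \<le> norm ((norm (f x))\<^sup>2 + (norm (g x))\<^sup>2)"
    by simp
qed

lemma L2_integrable_mult_cnj:
  assumes "f \<in> L2 M" "g \<in> L2 M"
  shows "integrable M (\<lambda>x. f x * cnj (g x))"
proof (rule Bochner_Integration.integrable_bound[OF L2_integrable_norm_mult[OF assms]])
  show "(\<lambda>x. f x * cnj (g x)) \<in> borel_measurable M"
    using assms by measurable
qed (simp add: norm_mult)

lemma L2_zero [simp]: "(\<lambda>x. 0) \<in> L2 M"
  by (simp add: L2_def)

lemma L2_add:
  assumes "f \<in> L2 M" "g \<in> L2 M"
  shows "(\<lambda>x. f x + g x) \<in> L2 M"
proof -
  have m: "(\<lambda>x. f x + g x) \<in> borel_measurable M"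
    using assms by measurable
  have "integrable M (\<lambda>x. (norm (f x + g x))\<^sup>2)"
  proof (rule Bochner_Integration.integrable_bound)
    show "integrable M (\<lambda>x. (norm (f x))\<^sup>2 + 2 * (norm (f x) * norm (g x)) + (norm (g x))\<^sup>2)"
      using assms by (intro Bochner_Integration.integrable_add L2_integrable_square
        integrable_mult_right L2_integrable_norm_mult)
    show "(\<lambda>x. (norm (f x + g x))\<^sup>2) \<in> borel_measurable M"
      using m by measurable
    have "(norm (a + b))\<^sup>2 \<le> (norm a)\<^sup>2 + 2 * (norm a * norm b) + (norm b)\<^sup>2" for a b :: complex
      using power_mono[OF norm_triangle_ineq[of a b], of 2] by (simp add: power2_sum algebra_simps)
    then show "AE x in M. norm ((norm (f x + g x))\<^sup>2)
        \<le> norm ((norm (f x))\<^sup>2 + 2 * (norm (f x) * norm (g x)) + (norm (g x))\<^sup>2)"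
      by (simp add: order.trans[OF _ abs_ge_self])
  qed
  with m show ?thesis by (simp add: L2_def)
qed

lemma L2_cmult: "f \<in> L2 M \<Longrightarrow> (\<lambda>x. c * f x) \<in> L2 M"
  by (auto simp: L2_def norm_mult power_mult_distrib)

lemma L2_diff: "f \<in> L2 M \<Longrightarrow> g \<in> L2 M \<Longrightarrow> (\<lambda>x. f x - g x) \<in> L2 M"
  using L2_add[of f M "\<lambda>x. - 1 * g x"] L2_cmult[of g M "- 1"] by simp

lemma L2_sum: "(\<And>i. i \<in> I \<Longrightarrow> f i \<in> L2 M) \<Longrightarrow> (\<lambda>x. \<Sum>i\<in>I. f i x) \<in> L2 M"
  by (induction I rule: infinite_finite_induct) (auto intro: L2_add)

lemma L2_norm_nonneg [simp]: "0 \<le> L2_norm M f"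
  by (simp add: L2_norm_def)

lemma L2_norm_power2: "(L2_norm M f)\<^sup>2 = (\<integral>x. (norm (f x))\<^sup>2 \<partial>M)"
  by (simp add: L2_norm_def)

lemma L2_norm_cong_AE:
  assumes "f \<in> borel_measurable M" "g \<in> borel_measurable M" "AE x in M. f x = g x"
  shows "L2_norm M f = L2_norm M g"
  unfolding L2_norm_def using assms
  by (intro arg_cong[where f = sqrt] integral_cong_AE) auto

lemma L2_norm_cmult: "L2_norm M (\<lambda>x. c * f x) = norm c * L2_norm M f"
  by (simp add: L2_norm_def norm_mult power_mult_distrib real_sqrt_mult)

lemma L2_norm_commute: "L2_norm M (\<lambda>x. f x - g x) = L2_norm M (\<lambda>x. g x - f x)"
  by (simp add: L2_norm_def norm_minus_commute)

lemma L2_inner_self: "L2_inner M f f = of_real ((L2_norm M f)\<^sup>2)"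
proof -
  have "L2_inner M f f = (\<integral>x. of_real ((norm (f x))\<^sup>2) \<partial>M)"
    unfolding L2_inner_def by (intro Bochner_Integration.integral_cong refl) (simp only: complex_norm_square)
  also have "\<dots> = of_real (\<integral>x. (norm (f x))\<^sup>2 \<partial>M)"
    by (rule integral_complex_of_real)
  finally show ?thesis
    by (simp only: L2_norm_power2)
qed

text \<open>The integral of \<open>(|f| - s |g|)\<^sup>2\<close> is a nonnegative quadratic polynomial in \<open>s\<close>, so its
  discriminant is not positive.\<close>

lemma L2_norm_mult_bound:
  assumes "f \<in> L2 M" "g \<in> L2 M"
  shows "(\<integral>x. norm (f x) * norm (g x) \<partial>M) \<le> L2_norm M f * L2_norm M g"
proof -
  define A where "A = (\<integral>x. (norm (f x))\<^sup>2 \<partial>M)"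
  define B where "B = (\<integral>x. (norm (g x))\<^sup>2 \<partial>M)"
  define C where "C = (\<integral>x. norm (f x) * norm (g x) \<partial>M)"
  have nn: "A \<ge> 0" "B \<ge> 0" by (auto simp: A_def B_def)
  have quad: "0 \<le> A - 2 * s * C + s\<^sup>2 * B" for s
  proof -
    have "0 \<le> (\<integral>x. (norm (f x) - s * norm (g x))\<^sup>2 \<partial>M)"
      by (rule Bochner_Integration.integral_nonneg) simp
    also have "\<dots> = (\<integral>x. (norm (f x))\<^sup>2 - 2 * s * (norm (f x) * norm (g x)) + s\<^sup>2 * (norm (g x))\<^sup>2 \<partial>M)"
      by (intro Bochner_Integration.integral_cong refl) (simp add: power2_eq_square algebra_simps)
    also have "\<dots> = A - 2 * s * C + s\<^sup>2 * B"
      using L2_integrable_square[OF assms(1)] L2_integrable_square[OF assms(2)]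
        L2_integrable_norm_mult[OF assms]
      by (simp add: A_def B_def C_def)
    finally show ?thesis .
  qed
  have "C\<^sup>2 \<le> A * B"
  proof (cases "B = 0")
    case True
    have "C = 0"
    proof (rule ccontr)
      assume "C \<noteq> 0"
      then show False
        using quad[of "(A + 1) / (2 * C)"] True by simp
    qed
    then show ?thesis using True by simp
  next
    case False
    then show ?thesis
      using quad[of "C / B"] nn by (simp add: field_simps power2_eq_square)
  qed
  then have "C \<le> sqrt (A * B)"
    by (rule real_le_rsqrt)
  then show ?thesis
    by (simp add: L2_norm_def A_def B_def C_def real_sqrt_mult)
qed

lemma L2_Cauchy_Schwarz:
  assumes "f \<in> L2 M" "g \<in> L2 M"
  shows "norm (L2_inner M f g) \<le> L2_norm M f * L2_norm M g"
proof -
  have "norm (L2_inner M f g) \<le> (\<integral>x. norm (f x * cnj (g x)) \<partial>M)"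
    unfolding L2_inner_def by (rule integral_norm_bound)
  also have "\<dots> \<le> L2_norm M f * L2_norm M g"
    using L2_norm_mult_bound[OF assms] by (simp add: norm_mult)
  finally show ?thesis .
qed

lemma L2_norm_triangle:
  assumes "f \<in> L2 M" "g \<in> L2 M"
  shows "L2_norm M (\<lambda>x. f x + g x) \<le> L2_norm M f + L2_norm M g"
proof -
  have "(L2_norm M (\<lambda>x. f x + g x))\<^sup>2 \<le>
      (\<integral>x. (norm (f x))\<^sup>2 + 2 * (norm (f x) * norm (g x)) + (norm (g x))\<^sup>2 \<partial>M)"
    unfolding L2_norm_power2
  proof (rule integral_mono)
    show "integrable M (\<lambda>x. (norm (f x))\<^sup>2 + 2 * (norm (f x) * norm (g x)) + (norm (g x))\<^sup>2)"
      using assms by (intro Bochner_Integration.integrable_add L2_integrable_square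
        integrable_mult_right L2_integrable_norm_mult)
    show "(norm (f x + g x))\<^sup>2 \<le> (norm (f x))\<^sup>2 + 2 * (norm (f x) * norm (g x)) + (norm (g x))\<^sup>2" for x
      using power_mono[OF norm_triangle_ineq[of "f x" "g x"], of 2]
      by (simp add: power2_sum algebra_simps)
  qed (rule L2_integrable_square[OF L2_add[OF assms]])
  also have "\<dots> = (L2_norm M f)\<^sup>2 + 2 * (\<integral>x. norm (f x) * norm (g x) \<partial>M) + (L2_norm M g)\<^sup>2"
    using L2_integrable_square[OF assms(1)] L2_integrable_square[OF assms(2)]
        L2_integrable_norm_mult[OF assms]
    by (simp add: L2_norm_power2)
  also have "\<dots> \<le> (L2_norm M f + L2_norm M g)\<^sup>2"
    using L2_norm_mult_bound[OF assms] by (simp add: power2_sum)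
  finally show ?thesis
    by (rule power2_le_imp_le) simp
qed

lemma L2_norm_diff_triangle:
  assumes "f \<in> L2 M" "g \<in> L2 M" "h \<in> L2 M"
  shows "L2_norm M (\<lambda>x. f x - h x) \<le> L2_norm M (\<lambda>x. f x - g x) + L2_norm M (\<lambda>x. g x - h x)"
  using L2_norm_triangle[OF L2_diff[OF assms(1,2)] L2_diff[OF assms(2,3)]] by simp

lemma L2_inner_commute: "L2_inner M g f = cnj (L2_inner M f g)"
  unfolding L2_inner_def Bochner_Integration.integral_cnj[symmetric] by (simp add: mult.commute)

lemma L2_inner_diff_left:
  "f \<in> L2 M \<Longrightarrow> g \<in> L2 M \<Longrightarrow> h \<in> L2 M \<Longrightarrow>
    L2_inner M (\<lambda>x. f x - g x) h = L2_inner M f h - L2_inner M g h"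
  unfolding L2_inner_def
  by (subst Bochner_Integration.integral_diff[symmetric]) (auto intro: L2_integrable_mult_cnj simp: algebra_simps)

lemma L2_inner_cmult_left: "L2_inner M (\<lambda>x. c * f x) h = c * L2_inner M f h"
  unfolding L2_inner_def by (simp add: mult.assoc)

lemma L2_inner_sum_left:
  assumes "\<And>i. i \<in> I \<Longrightarrow> f i \<in> L2 M" "h \<in> L2 M"
  shows "L2_inner M (\<lambda>x. \<Sum>i\<in>I. c i * f i x) h = (\<Sum>i\<in>I. c i * L2_inner M (f i) h)"
proof -
  have "L2_inner M (\<lambda>x. \<Sum>i\<in>I. c i * f i x) h = (\<integral>x. (\<Sum>i\<in>I. c i * (f i x * cnj (h x))) \<partial>M)"
    unfolding L2_inner_def by (simp add: sum_distrib_right mult.assoc)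
  also have "\<dots> = (\<Sum>i\<in>I. c i * L2_inner M (f i) h)"
    unfolding L2_inner_def using assms
    by (subst Bochner_Integration.integral_sum) (auto intro!: L2_integrable_mult_cnj integrable_mult_right)
  finally show ?thesis .
qed

lemma L2_inner_sum_right:
  assumes "\<And>i. i \<in> I \<Longrightarrow> f i \<in> L2 M" "h \<in> L2 M"
  shows "L2_inner M h (\<lambda>x. \<Sum>i\<in>I. c i * f i x) = (\<Sum>i\<in>I. cnj (c i) * L2_inner M h (f i))"
  by (subst L2_inner_commute, subst L2_inner_sum_left[OF assms], assumption)
     (simp add: L2_inner_commute[of M h])

lemma L2_inner_cong_AE:
  assumes "f \<in> borel_measurable M" "f' \<in> borel_measurable M" "g \<in> borel_measurable M" "g' \<in> borel_measurable M"
    "AE x in M. f x = f' x" "AE x in M. g x = g' x"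
  shows "L2_inner M f g = L2_inner M f' g'"
  unfolding L2_inner_def
proof (rule integral_cong_AE)
  show "AE x in M. f x * cnj (g x) = f' x * cnj (g' x)"
    using assms(5,6) by eventually_elim simp
qed (use assms in measurable)

section \<open>Integrals of product functions\<close>

text \<open>Lebesgue measure on \<open>real^'d\<close> is the image of a product measure indexed by the standard basis;
  the formula is the one for product measures, with basis vectors renamed to coordinates.\<close>

lemma lborel_prod_vec:
  fixes F :: "'d::finite \<Rightarrow> real \<Rightarrow> complex"
  assumes int: "\<And>i. integrable lborel (F i)"
  shows integrable_lborel_prod_vec: "integrable lborel (\<lambda>x::real^'d. \<Prod>i\<in>UNIV. F i (x $ i))"
    and integral_lborel_prod_vec:
      "(\<integral>x. (\<Prod>i\<in>UNIV. F i ((x::real^'d) $ i)) \<partial>lborel) = (\<Prod>i\<in>UNIV. \<integral>y. F i y \<partial>lborel)"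
proof -
  let ?B = "Basis :: (real^'d) set"
  define ax :: "'d \<Rightarrow> real^'d" where "ax i = axis i 1" for i
  define ix where "ix = inv ax"
  have inj: "inj ax" by (auto simp: inj_on_def ax_def axis_eq_axis)
  have range: "range ax = ?B" by (auto simp: ax_def Basis_vec_def)
  have ix [simp]: "ix (ax i) = i" for i by (simp add: ix_def inj)
  have reindex: "(\<Prod>b\<in>?B. h b) = (\<Prod>i\<in>UNIV. h (ax i))" for h :: "real^'d \<Rightarrow> complex"
    unfolding range[symmetric] by (simp add: prod.reindex[OF inj])
  interpret product_sigma_finite "\<lambda>_::real^'d. lborel :: real measure" ..
  let ?\<phi> = "\<lambda>f::real^'d \<Rightarrow> real. \<Sum>b\<in>?B. f b *\<^sub>R b"
  have coord: "?\<phi> f $ i = f (ax i)" for f i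
  proof -
    have "?\<phi> f $ i = ?\<phi> f \<bullet> ax i" by (simp add: ax_def cart_eq_inner_axis)
    also have "\<dots> = f (ax i)"
      using range by (subst inner_sum_left_Basis) auto
    finally show ?thesis .
  qed
  have \<phi>: "?\<phi> \<in> measurable (\<Pi>\<^sub>M b\<in>?B. lborel) borel" by measurable
  have meas: "(\<lambda>x::real^'d. \<Prod>i\<in>UNIV. F i (x $ i)) \<in> borel_measurable borel"
  proof -
    have [measurable]: "F i \<in> borel_measurable borel" for i
      using borel_measurable_integrable[OF int[of i]] by simp
    show ?thesis by measurable
  qed
  have comp: "(\<Prod>i\<in>UNIV. F i (?\<phi> f $ i)) = (\<Prod>b\<in>?B. F (ix b) (f b))" for f
    by (simp only: coord reindex ix)
  show "integrable lborel (\<lambda>x::real^'d. \<Prod>i\<in>UNIV. F i (x $ i))"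
    by (subst lborel_eq, subst integrable_distr_eq[OF \<phi> meas], unfold comp)
       (intro product_integrable_prod int finite_Basis)
  show "(\<integral>x. (\<Prod>i\<in>UNIV. F i ((x::real^'d) $ i)) \<partial>lborel) = (\<Prod>i\<in>UNIV. \<integral>y. F i y \<partial>lborel)"
    by (subst lborel_eq, subst integral_distr[OF \<phi> meas], unfold comp,
        subst product_integral_prod[OF finite_Basis int]) (simp only: reindex ix)
qed

section \<open>Exponentials on the cube\<close>

lemma borel_measurable_expo [measurable]: "(\<lambda>z. expo (f z) (g z)) \<in> borel_measurable M"
  if "f \<in> borel_measurable M" "g \<in> borel_measurable M"
  using that unfolding expo_def by measurable

lemma norm_expo: "norm (expo s (x::real^'d)) = 1 / (2 * pi) powr (real CARD('d) / 2)"
  by (simp add: expo_def norm_divide)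

lemma exp_inner_vec: "exp (\<i> * of_real ((x::real^'d) \<bullet> v)) = (\<Prod>i\<in>UNIV. exp (\<i> * of_real (x $ i * v $ i)))"
  by (simp add: inner_vec_def exp_sum[symmetric] sum_distrib_left)

lemma expo_mult_cnj:
  "expo a x * cnj (expo b (x::real^'d)) = exp (\<i> * of_real (x \<bullet> (a - b))) / of_real ((2 * pi) ^ CARD('d))"
proof -
  have "(2 * pi) powr (real CARD('d) / 2) * (2 * pi) powr (real CARD('d) / 2) = (2 * pi) ^ CARD('d)"
    by (simp add: powr_add[symmetric] powr_realpow)
  then have eq: "complex_of_real ((2 * pi) powr (real CARD('d) / 2)) *
      complex_of_real ((2 * pi) powr (real CARD('d) / 2)) = of_real ((2 * pi) ^ CARD('d))"
    by (metis of_real_mult)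
  have "cnj (expo b x) = exp (- (\<i> * of_real (x \<bullet> b))) / of_real ((2 * pi) powr (real CARD('d) / 2))"
    by (simp add: expo_def exp_cnj)
  then have "expo a x * cnj (expo b x) = exp (\<i> * of_real (x \<bullet> a)) * exp (- (\<i> * of_real (x \<bullet> b))) /
      of_real ((2 * pi) ^ CARD('d))"
    unfolding expo_def by (simp only: times_divide_times_eq eq)
  also have "exp (\<i> * of_real (x \<bullet> a)) * exp (- (\<i> * of_real (x \<bullet> b))) = exp (\<i> * of_real (x \<bullet> (a - b)))"
    by (simp add: exp_add[symmetric] inner_diff_right algebra_simps)
  finally show ?thesis .
qed

lemma cube_eq_cbox: "cube = cbox (\<chi> i. - pi) (\<chi> i. pi)"
  by (auto simp: cube_def mem_box_cart)

lemma cube_sets [measurable, simp]: "cube \<in> sets borel"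
  by (simp add: cube_eq_cbox)

lemma space_cube_measure [simp]: "space cube_measure = cube"
  by (simp add: space_restrict_space)

lemma borel_measurable_cube_measure [measurable (raw)]:
  "f \<in> borel_measurable borel \<Longrightarrow> f \<in> borel_measurable cube_measure"
  by (rule measurable_restrict_space1) simp

lemma emeasure_cube_finite: "emeasure lborel (cube :: (real^'d) set) < \<infinity>"
  using emeasure_lborel_cbox_finite by (simp add: cube_eq_cbox)

lemma finite_measure_cube: "finite_measure (cube_measure :: (real^'d) measure)"
proof (rule finite_measureI)
  show "emeasure cube_measure (space (cube_measure :: (real^'d) measure)) \<noteq> \<infinity>"
    using emeasure_cube_finite[where ?'d = 'd]
    by (subst emeasure_restrict_space) (auto simp: space_restrict_space)
qed

lemma integral_cube_measure: "(\<integral>x. f x \<partial>cube_measure) = (\<integral>x. indicator cube x *\<^sub>R f x \<partial>lborel)"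
  for f :: "real^'d \<Rightarrow> 'b::{banach, second_countable_topology}"
  by (rule integral_restrict_space) simp

lemma integrable_cube_measure: "integrable cube_measure f \<longleftrightarrow> integrable lborel (\<lambda>x. indicator cube x *\<^sub>R f x)"
  for f :: "real^'d \<Rightarrow> 'b::{banach, second_countable_topology}"
  by (rule integrable_restrict_space) simp

lemma L2_bounded_finite:
  assumes "finite_measure M" "f \<in> borel_measurable M" "\<And>x. x \<in> space M \<Longrightarrow> norm (f x) \<le> B"
  shows "f \<in> L2 M"
proof -
  have "integrable M (\<lambda>x. (norm (f x))\<^sup>2)"
  proof (rule finite_measure.integrable_const_bound[OF assms(1), of _ "B\<^sup>2"])
    show "AE x in M. norm ((norm (f x))\<^sup>2) \<le> B\<^sup>2"
      using assms(3) by (auto intro!: AE_I2 power_mono)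
    show "(\<lambda>x. (norm (f x))\<^sup>2) \<in> borel_measurable M"
      using assms(2) by measurable
  qed
  with assms show ?thesis by (simp add: L2_def)
qed

lemma expo_L2: "expo s \<in> L2 cube_measure"
proof (rule L2_bounded_finite[OF finite_measure_cube])
  show "expo s \<in> borel_measurable cube_measure" by measurable
qed (rule eq_refl[OF norm_expo])

lemma integral_exp_interval:
  "(\<integral>x. indicator {-pi..pi} x *\<^sub>R exp (\<i> * of_real (x * v)) \<partial>lborel) = of_real (2 * pi * sinc (pi * v))"
proof (cases "v = 0")
  case False
  have "(\<integral>x. indicator {-pi..pi} x *\<^sub>R exp (\<i> * of_real (x * v)) \<partial>lborel) =
      exp (\<i> * of_real (pi * v)) / (\<i> * of_real v) - exp (\<i> * of_real (- pi * v)) / (\<i> * of_real v)"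
  proof (rule integral_FTC_atLeastAtMost)
    fix x
    show "((\<lambda>x. exp (\<i> * of_real (x * v)) / (\<i> * of_real v)) has_vector_derivative exp (\<i> * of_real (x * v)))
        (at x within {-pi..pi})"
      using False by (auto intro!: derivative_eq_intros has_vector_derivative_real_field simp: mult_ac)
  qed (auto intro!: continuous_intros)
  also have "\<dots> = of_real (2 * pi * sinc (pi * v))"
    using False by (simp add: complex_eq_iff Re_divide Im_divide Re_exp Im_exp field_simps power2_eq_square)
  finally show ?thesis .
next
  case True
  then show ?thesis by (simp add: scaleR_conv_of_real)
qed

text \<open>The Fourier transform of an exponential on the cube factors over the coordinates into integrals
  over \<open>{-pi..pi}\<close>. At integer frequencies this yields orthonormality, and in general it shows that the
  transform of \<open>basis_expo n\<close> is a translate of \<open>SINC\<close>.\<close>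

lemma expo_inner: "L2_inner cube_measure (expo a) (expo b) = of_real (SINC (pi *\<^sub>R (a - b)))"
  for a b :: "real^'d"
proof -
  let ?F = "\<lambda>i y. indicator {-pi..pi} y *\<^sub>R exp (\<i> * of_real (y * (a - b) $ i)) :: complex"
  have int: "integrable lborel (?F i)" for i
    by (rule borel_integrable_compact) (auto intro!: continuous_intros)
  have ind: "indicator cube x *\<^sub>R exp (\<i> * of_real (x \<bullet> (a - b))) = (\<Prod>i\<in>UNIV. ?F i (x $ i))" for x :: "real^'d"
  proof (cases "x \<in> cube")
    case True
    then show ?thesis by (auto simp: exp_inner_vec cube_def intro!: prod.cong)
  next
    case False
    then obtain i where "x $ i \<notin> {-pi..pi}" by (auto simp: cube_def)
    then have "(\<Prod>i\<in>UNIV. ?F i (x $ i)) = 0"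
      by (intro prod_zero bexI[of _ i]) (simp_all add: indicator_def)
    with False show ?thesis by simp
  qed
  have "L2_inner cube_measure (expo a) (expo b) =
      (\<integral>x. indicator cube x *\<^sub>R exp (\<i> * of_real (x \<bullet> (a - b))) / of_real ((2 * pi) ^ CARD('d)) \<partial>lborel)"
    unfolding L2_inner_def integral_cube_measure expo_mult_cnj
    by (intro Bochner_Integration.integral_cong refl) (simp add: scaleR_conv_of_real)
  also have "\<dots> = (\<Prod>i\<in>UNIV. \<integral>y. ?F i y \<partial>lborel) / of_real ((2 * pi) ^ CARD('d))"
    by (simp only: ind integral_lborel_prod_vec[OF int] integral_divide_zero)
  also have "\<dots> = of_real ((\<Prod>i\<in>UNIV. 2 * pi * sinc (pi * (a - b) $ i)) / (2 * pi) ^ CARD('d))"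
    by (simp only: integral_exp_interval of_real_prod of_real_divide)
  also have "(\<Prod>i\<in>UNIV. 2 * pi * sinc (pi * (a - b) $ i)) / (2 * pi) ^ CARD('d) = SINC (pi *\<^sub>R (a - b))"
    by (simp only: prod.distrib prod_constant SINC_def vector_scaleR_component real_scaleR_def) simp
  finally show ?thesis .
qed

lemma basis_expo_orthonormal:
  "L2_inner cube_measure (basis_expo n) (basis_expo m) = (if n = m then 1 else 0)"
proof (cases "n = m")
  case True
  then show ?thesis by (simp add: basis_expo_def expo_inner SINC_def)
next
  case False
  then obtain i where i: "n $ i \<noteq> m $ i" by (auto simp: vec_eq_iff)
  have "sin (pi * real_of_int (n $ i - m $ i)) = 0"
    using sin_zero_iff_int2 by (metis mult.commute)
  with i have "SINC (pi *\<^sub>R ((\<chi> i. real_of_int (n $ i)) - (\<chi> i. real_of_int (m $ i)))) = 0"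
    unfolding SINC_def by (intro prod_zero) (auto intro!: bexI[of _ i])
  with False show ?thesis by (simp add: basis_expo_def expo_inner)
qed

lemma basis_expo_L2: "basis_expo n \<in> L2 cube_measure"
  by (simp add: basis_expo_def expo_L2)

lemma L2_norm_expo: "L2_norm cube_measure (expo s) = 1"
proof -
  have "complex_of_real ((L2_norm cube_measure (expo s))\<^sup>2) = 1"
    unfolding L2_inner_self[symmetric] expo_inner by (simp add: SINC_def)
  then have "(L2_norm cube_measure (expo s))\<^sup>2 = 1" by (simp only: of_real_eq_1_iff)
  then show ?thesis using L2_norm_nonneg[of cube_measure "expo s"]
    unfolding power2_eq_1_iff by linarith
qed

section \<open>Gaussians and their Fourier transforms\<close>

text \<open>The characteristic function of the standard normal distribution, rescaled.\<close>

lemma gauss_integral_1D: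
  assumes e: "e > 0"
  shows integrable_gauss_1D:
    "integrable lborel (\<lambda>x. exp (\<i> * of_real (x * u)) * of_real (exp (- e * x\<^sup>2 / 2)) :: complex)"
  and integral_gauss_1D:
    "(\<integral>x. exp (\<i> * of_real (x * u)) * of_real (exp (- e * x\<^sup>2 / 2)) \<partial>lborel) =
      complex_of_real (sqrt (2 * pi / e) * exp (- u\<^sup>2 / (2 * e)))"
proof -
  define w where "w = u / sqrt e"
  define f where "f x = std_normal_density x *\<^sub>R iexp (w * x)" for x
  have e': "sqrt e \<noteq> 0" "(sqrt e)\<^sup>2 = e" using e by auto
  have "integrable lborel (\<lambda>x. std_normal_density x *\<^sub>R iexp (w * x))"
    by (rule Bochner_Integration.integrable_bound[OF integrable_normal_density[of 1 0]])
       (auto simp: abs_mult)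
  then have int: "integrable lborel f" by (simp add: f_def[abs_def])
  have val: "(\<integral>x. f x \<partial>lborel) = exp (- (w\<^sup>2) / 2)"
    using fun_cong[OF char_std_normal_distribution, of w]
    unfolding char_def f_def by (subst (asm) integral_density) (auto simp: mult.commute)
  have scale: "f (0 + sqrt e * x) = of_real (1 / sqrt (2 * pi)) * (exp (\<i> * of_real (x * u)) * of_real (exp (- e * x\<^sup>2 / 2)))" for x
    using e by (simp add: f_def w_def std_normal_density_def power_mult_distrib scaleR_conv_of_real mult_ac)
  have unscale: "exp (\<i> * of_real (x * u)) * of_real (exp (- e * x\<^sup>2 / 2)) = of_real (sqrt (2 * pi)) * f (0 + sqrt e * x)" for x
    unfolding scale mult.assoc[symmetric] of_real_mult[symmetric] by simp
  show "integrable lborel (\<lambda>x. exp (\<i> * of_real (x * u)) * of_real (exp (- e * x\<^sup>2 / 2)) :: complex)"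
    unfolding unscale by (intro integrable_mult_right lborel_integrable_real_affine[OF int e'(1)])
  have "w\<^sup>2 = u\<^sup>2 / e" using e by (simp add: w_def power_divide)
  then have "complex_of_real (exp (- u\<^sup>2 / (2 * e))) = sqrt e *\<^sub>R (\<integral>x. f (0 + sqrt e * x) \<partial>lborel)"
    using val e lborel_integral_real_affine[OF e'(1), of f 0] by (simp add: field_simps)
  also have "\<dots> = of_real (sqrt e / sqrt (2 * pi)) * (\<integral>x. exp (\<i> * of_real (x * u)) * of_real (exp (- e * x\<^sup>2 / 2)) \<partial>lborel)"
    unfolding scale by (subst integral_mult_right_zero) (simp add: scaleR_conv_of_real)
  finally have eq: "complex_of_real (exp (- u\<^sup>2 / (2 * e))) = of_real (sqrt e / sqrt (2 * pi)) * (\<integral>x. exp (\<i> * of_real (x * u)) * of_real (exp (- e * x\<^sup>2 / 2)) \<partial>lborel)" .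
  have "complex_of_real (sqrt (2 * pi / e) * exp (- u\<^sup>2 / (2 * e))) =
      of_real (sqrt (2 * pi / e)) * (of_real (sqrt e / sqrt (2 * pi)) * (\<integral>x. exp (\<i> * of_real (x * u)) * of_real (exp (- e * x\<^sup>2 / 2)) \<partial>lborel))"
    unfolding eq[symmetric] by simp
  also have "\<dots> = of_real (sqrt (2 * pi / e) * (sqrt e / sqrt (2 * pi))) * (\<integral>x. exp (\<i> * of_real (x * u)) * of_real (exp (- e * x\<^sup>2 / 2)) \<partial>lborel)"
    by (simp only: of_real_mult mult.assoc)
  also have "sqrt (2 * pi / e) * (sqrt e / sqrt (2 * pi)) = 1"
    using e by (simp add: real_sqrt_divide)
  finally show "(\<integral>x. exp (\<i> * of_real (x * u)) * of_real (exp (- e * x\<^sup>2 / 2)) \<partial>lborel) =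
      complex_of_real (sqrt (2 * pi / e) * exp (- u\<^sup>2 / (2 * e)))" by simp
qed

definition gauss :: "real \<Rightarrow> real^'d \<Rightarrow> real" where
  "gauss e x = exp (- e * (norm x)\<^sup>2 / 2)"

text \<open>The density of the centred normal distribution with variance \<open>e\<close> in every coordinate, that is, the
  heat kernel at time \<open>e / 2\<close>.\<close>

definition heat :: "real \<Rightarrow> real^'d \<Rightarrow> real" where
  "heat e u = gauss (1 / e) u / sqrt (2 * pi * e) ^ CARD('d)"

lemma gauss_borel [measurable]: "gauss e \<in> borel_measurable borel"
  unfolding gauss_def by measurable

lemma heat_borel [measurable]: "heat e \<in> borel_measurable borel"
  unfolding heat_def by measurable

lemma gauss_pos: "gauss e x > 0" and gauss_le_1: "e \<ge> 0 \<Longrightarrow> gauss e x \<le> 1"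
  by (auto simp: gauss_def mult_nonneg_nonneg)

lemma heat_nonneg: "e > 0 \<Longrightarrow> heat e u \<ge> 0"
  using gauss_pos[of "1 / e" u] by (simp add: heat_def)

lemma gauss_prod: "gauss e x = (\<Prod>i\<in>UNIV. exp (- e * (x $ i)\<^sup>2 / 2))"
proof -
  have "- e * (norm x)\<^sup>2 / 2 = (\<Sum>i\<in>UNIV. - e * (x $ i)\<^sup>2 / 2)"
    by (simp only: power2_norm_eq_inner inner_vec_def sum_distrib_left sum_divide_distrib)
       (simp add: power2_eq_square)
  then show ?thesis by (simp only: gauss_def exp_sum[OF finite])
qed

lemma exp_gauss_integral:
  fixes u :: "real^'d"
  assumes e: "e > 0"
  shows integrable_exp_gauss: "integrable lborel (\<lambda>x. exp (\<i> * of_real (x \<bullet> u)) * of_real (gauss e x) :: complex)"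
    and integral_exp_gauss: "(\<integral>x. exp (\<i> * of_real (x \<bullet> u)) * of_real (gauss e x) \<partial>lborel) =
      complex_of_real (sqrt (2 * pi / e) ^ CARD('d) * gauss (1 / e) u)"
proof -
  let ?F = "\<lambda>i y. exp (\<i> * of_real (y * u $ i)) * of_real (exp (- e * y\<^sup>2 / 2)) :: complex"
  have int: "integrable lborel (?F i)" for i
    by (rule integrable_gauss_1D[OF e])
  have eq: "exp (\<i> * of_real (x \<bullet> u)) * of_real (gauss e x) = (\<Prod>i\<in>UNIV. ?F i (x $ i))" for x :: "real^'d"
    by (simp only: exp_inner_vec gauss_prod of_real_prod prod.distrib)
  show "integrable lborel (\<lambda>x. exp (\<i> * of_real (x \<bullet> u)) * of_real (gauss e x) :: complex)"
    unfolding eq by (rule integrable_lborel_prod_vec[OF int])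
  have "(\<Prod>i\<in>UNIV. sqrt (2 * pi / e) * exp (- (u $ i)\<^sup>2 / (2 * e))) = sqrt (2 * pi / e) ^ CARD('d) * gauss (1 / e) u"
    by (simp add: prod.distrib gauss_prod field_simps)
  then show "(\<integral>x. exp (\<i> * of_real (x \<bullet> u)) * of_real (gauss e x) \<partial>lborel) =
      complex_of_real (sqrt (2 * pi / e) ^ CARD('d) * gauss (1 / e) u)"
    by (simp only: eq integral_lborel_prod_vec[OF int] integral_gauss_1D[OF e] of_real_prod[symmetric])
qed

lemma integrable_gauss: "e > 0 \<Longrightarrow> integrable lborel (gauss e :: real^'d \<Rightarrow> real)"
  using integrable_exp_gauss[of e "0 :: real^'d", THEN integrable_Re] by simp

lemma integral_gauss: "e > 0 \<Longrightarrow> (\<integral>x. gauss e (x :: real^'d) \<partial>lborel) = sqrt (2 * pi / e) ^ CARD('d)"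
  using integral_exp_gauss[of e "0 :: real^'d"]
  by (simp add: gauss_def[of _ 0] del: of_real_power of_real_divide of_real_mult)

lemma integrable_heat: "e > 0 \<Longrightarrow> integrable lborel (heat e :: real^'d \<Rightarrow> real)"
  unfolding heat_def by (intro integrable_divide_zero integrable_gauss) auto

lemma integral_heat: "e > 0 \<Longrightarrow> (\<integral>x. heat e (x :: real^'d) \<partial>lborel) = 1"
  unfolding heat_def by (simp add: integral_gauss)

text \<open>A Gaussian weight in one variable turns a pair of exponentials into an approximate identity in
  the difference of their frequencies. This replaces the divergent integral behind Plancherel's identity and
  the inversion formula.\<close>

lemma integral_expo_gauss:
  fixes a b :: "real^'d"
  assumes e: "e > 0"
  shows "(\<integral>x. expo a x * cnj (expo b x) * of_real (gauss e x) \<partial>lborel) = of_real (heat e (a - b))"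
proof -
  have "(\<integral>x. expo a x * cnj (expo b x) * of_real (gauss e x) \<partial>lborel) =
      (\<integral>x. exp (\<i> * of_real (x \<bullet> (a - b))) * of_real (gauss e x) / of_real ((2 * pi) ^ CARD('d)) \<partial>lborel)"
    by (simp add: expo_mult_cnj)
  also have "\<dots> = complex_of_real (sqrt (2 * pi / e) ^ CARD('d) * gauss (1 / e) (a - b) / (2 * pi) ^ CARD('d))"
    by (simp only: integral_divide_zero integral_exp_gauss[OF e] of_real_divide)
  also have "sqrt (2 * pi / e) ^ CARD('d) * gauss (1 / e) (a - b) / (2 * pi) ^ CARD('d) = heat e (a - b)"
  proof -
    have "sqrt (2 * pi / e) / (2 * pi) = 1 / sqrt (2 * pi * e)"
      using e by (simp add: real_sqrt_divide real_sqrt_mult field_simps)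
    then have "sqrt (2 * pi / e) ^ CARD('d) / (2 * pi) ^ CARD('d) = 1 / sqrt (2 * pi * e) ^ CARD('d)"
      unfolding power_divide[symmetric] by (simp only: power_divide power_one)
    then show ?thesis by (simp add: heat_def field_simps)
  qed
  finally show ?thesis .
qed

section \<open>The Plancherel inequality and Fourier inversion\<close>

lemma lborel_shift:
  fixes F :: "'a::euclidean_space \<Rightarrow> 'b::{banach, second_countable_topology}"
  shows integrable_lborel_shift: "integrable lborel F \<Longrightarrow> integrable lborel (\<lambda>x. F (x - s))"
    and integral_lborel_shift: "F \<in> borel_measurable borel \<Longrightarrow> (\<integral>x. F (x - s) \<partial>lborel) = (\<integral>x. F x \<partial>lborel)"
proof -
  have "(\<lambda>x. x - s) = (+) (- s)" by auto
  then have d: "distr lborel borel (\<lambda>x. x - s) = lborel"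
    by (simp only: lborel_distr_plus)
  have m: "(\<lambda>x. x - s) \<in> measurable lborel borel" by measurable
  show "integrable lborel (\<lambda>x. F (x - s))" if "integrable lborel F"
    using that integrable_distr[OF m, of F] by (simp add: d)
  show "(\<integral>x. F (x - s) \<partial>lborel) = (\<integral>x. F x \<partial>lborel)" if "F \<in> borel_measurable borel"
    using integral_distr[OF m that] by (simp add: d)
qed

text \<open>For a function that is not integrable the left-hand side is 0.\<close>

lemma norm_integral_le_nn_integral:
  fixes f :: "'a \<Rightarrow> 'b::{banach, second_countable_topology}"
  shows "ennreal (norm (integral\<^sup>L M f)) \<le> (\<integral>\<^sup>+x. ennreal (norm (f x)) \<partial>M)"
  by (cases "integrable M f") (auto simp: not_integrable_integral_eq intro: integral_norm_bound_ennreal)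

lemma nn_integral_heat:
  assumes "e > 0"
  shows "(\<integral>\<^sup>+y. ennreal (heat e (y - x)) \<partial>lborel) = 1"
    and "(\<integral>\<^sup>+x. ennreal (heat e (y - x)) \<partial>lborel) = 1"
proof -
  have 1: "(\<integral>\<^sup>+y. ennreal (heat e (y - x)) \<partial>lborel) = 1" for x
    using integrable_lborel_shift[OF integrable_heat[OF assms], of x]
      integral_lborel_shift[of "heat e" x] integral_heat[OF assms]
    by (subst nn_integral_eq_integral) (auto intro: heat_nonneg[OF assms])
  then show "(\<integral>\<^sup>+y. ennreal (heat e (y - x)) \<partial>lborel) = 1" .
  have "heat e (y - x) = heat e (x - y)" for x
    by (simp add: heat_def gauss_def norm_minus_commute)
  with 1[of y] show "(\<integral>\<^sup>+x. ennreal (heat e (y - x)) \<partial>lborel) = 1" by simp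
qed

text \<open>Absolute integrability is immediate for the product of a function of each variable, and a bounded
  kernel does not destroy it. The kernel will be an exponential.\<close>

lemma Fubini_bounded_kernel:
  fixes \<phi> \<psi> :: "real^'d \<Rightarrow> complex" and b :: "real^'d \<Rightarrow> real^'d \<Rightarrow> complex"
  assumes \<phi>: "integrable lborel \<phi>" and \<psi>: "integrable lborel \<psi>"
    and b [measurable]: "case_prod b \<in> borel_measurable (borel \<Otimes>\<^sub>M borel)" and bd: "\<And>x y. norm (b x y) \<le> B"
  shows "(\<integral>y. (\<integral>x. \<phi> x * \<psi> y * b x y \<partial>lborel) \<partial>lborel) = (\<integral>x. (\<integral>y. \<phi> x * \<psi> y * b x y \<partial>lborel) \<partial>lborel)"
proof (rule lborel_pair.Fubini_integral)
  have [measurable]: "\<phi> \<in> borel_measurable borel" "\<psi> \<in> borel_measurable borel"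
    using borel_measurable_integrable[OF \<phi>] borel_measurable_integrable[OF \<psi>] by simp_all
  have prod: "integrable (lborel \<Otimes>\<^sub>M lborel) (\<lambda>(x, y). \<phi> x * \<psi> y)"
  proof (rule lborel_pair.Fubini_integrable)
    show "integrable lborel (\<lambda>x. \<integral>y. norm (case (x, y) of (x, y) \<Rightarrow> \<phi> x * \<psi> y) \<partial>lborel)"
      using \<phi> by (simp add: norm_mult)
    show "AE x in lborel. integrable lborel (\<lambda>y. case (x, y) of (x, y) \<Rightarrow> \<phi> x * \<psi> y)"
      using \<psi> by simp
  qed measurable
  show "integrable (lborel \<Otimes>\<^sub>M lborel) (\<lambda>(x, y). \<phi> x * \<psi> y * b x y)"
  proof (rule Bochner_Integration.integrable_bound)
    show "integrable (lborel \<Otimes>\<^sub>M lborel) (\<lambda>z. B * norm ((\<lambda>(x, y). \<phi> x * \<psi> y) z))"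
      by (intro integrable_mult_right integrable_norm prod)
    show "AE z in lborel \<Otimes>\<^sub>M lborel. norm (case z of (x, y) \<Rightarrow> \<phi> x * \<psi> y * b x y)
        \<le> norm (B * norm ((\<lambda>(x, y). \<phi> x * \<psi> y) z))"
    proof (intro AE_I2, clarify)
      fix x y
      have "norm (\<phi> x * \<psi> y) * norm (b x y) \<le> norm (\<phi> x * \<psi> y) * B"
        by (intro mult_left_mono bd) simp
      also have "\<dots> \<le> norm (B * norm (\<phi> x * \<psi> y))"
        by (simp add: mult.commute)
      finally show "norm (\<phi> x * \<psi> y * b x y) \<le> norm (B * norm (\<phi> x * \<psi> y))"
        by (simp add: norm_mult)
    qed
  qed measurable
qed

lemma expo_commute: "expo s x = expo x s"
  by (simp add: expo_def inner_commute)

lemma integrable_mult_bounded: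
  fixes f g :: "'a \<Rightarrow> complex"
  assumes "integrable M f" "g \<in> borel_measurable M" "\<And>x. norm (g x) \<le> B"
  shows "integrable M (\<lambda>x. f x * g x)"
proof (rule Bochner_Integration.integrable_bound)
  show "integrable M (\<lambda>x. B * norm (f x))" using assms(1) by simp
  show "(\<lambda>x. f x * g x) \<in> borel_measurable M" using assms by measurable
  have "norm (f x) * norm (g x) \<le> norm (B * norm (f x))" for x
    using mult_left_mono[OF assms(3) norm_ge_zero[of "f x"], of x]
      mult_right_mono[OF abs_ge_self[of B] norm_ge_zero[of "f x"]] by (simp add: mult.commute abs_mult)
  then show "AE x in M. norm (f x * g x) \<le> norm (B * norm (f x))"
    by (simp add: norm_mult)
qed

text \<open>Expanding \<open>|h|\<^sup>2\<close> and integrating over the frequency first turns the left-hand side into the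
  quadratic form of \<open>heat e\<close> at \<open>G\<close>. Since \<open>heat e\<close> is nonnegative with integral 1, that form is at most
  \<open>\<integral>|G|\<^sup>2\<close> by \<open>|G x| |G y| \<le> (|G x|\<^sup>2 + |G y|\<^sup>2) / 2\<close> (Schur's test).\<close>

lemma Plancherel_regularized:
  fixes G :: "real^'d \<Rightarrow> complex"
  assumes G: "integrable lborel G" and G2: "G \<in> L2 lborel" and e: "e > 0"
  defines "h \<equiv> \<lambda>s. \<integral>x. G x * cnj (expo s x) \<partial>lborel"
  shows "(\<integral>\<^sup>+s. ennreal ((norm (h s))\<^sup>2 * gauss e s) \<partial>lborel) \<le> ennreal ((L2_norm lborel G)\<^sup>2)"
proof -
  define \<kappa> where "\<kappa> = 1 / (2 * pi) powr (real CARD('d) / 2)"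
  have \<kappa>: "norm (expo s x) \<le> \<kappa>" for s x :: "real^'d" by (simp add: norm_expo \<kappa>_def)
  have [measurable]: "G \<in> borel_measurable borel" using G2 by (simp add: L2_def)
  have h_m [measurable]: "h \<in> borel_measurable borel"
    unfolding h_def by measurable
  have h_bd: "norm (h s) \<le> \<kappa> * (\<integral>x. norm (G x) \<partial>lborel)" for s
  proof -
    have "norm (h s) \<le> (\<integral>x. norm (G x * cnj (expo s x)) \<partial>lborel)"
      unfolding h_def by (rule integral_norm_bound)
    also have "\<dots> = \<kappa> * (\<integral>x. norm (G x) \<partial>lborel)"
      by (simp add: norm_mult norm_expo \<kappa>_def)
    finally show ?thesis .
  qed
  have gauss_c: "integrable lborel (\<lambda>s::real^'d. complex_of_real (gauss e s))"
    by (rule integrable_of_real[OF integrable_gauss[OF e]])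
  have Gc: "integrable lborel (\<lambda>y. cnj (G y))" using G by simp
  have \<psi>: "integrable lborel (\<lambda>s. of_real (gauss e s) * cnj (h s))"
    by (rule integrable_mult_bounded[OF gauss_c, where B = "\<kappa> * (\<integral>x. norm (G x) \<partial>lborel)"]) (auto intro: h_bd)
  have K: "(\<integral>s. of_real (gauss e s) * cnj (h s) * cnj (expo s x) \<partial>lborel) =
      (\<integral>y. cnj (G y) * of_real (heat e (y - x)) \<partial>lborel)" for x
  proof -
    have "(\<integral>s. of_real (gauss e s) * cnj (h s) * cnj (expo s x) \<partial>lborel) =
        (\<integral>s. (\<integral>y. cnj (G y) * (of_real (gauss e s) * cnj (expo s x)) * expo s y \<partial>lborel) \<partial>lborel)"
    proof (rule Bochner_Integration.integral_cong[OF refl])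
      fix s
      have "cnj (h s) = (\<integral>y. cnj (G y) * expo s y \<partial>lborel)"
        unfolding h_def by (subst Bochner_Integration.integral_cnj[symmetric]) simp
      then show "of_real (gauss e s) * cnj (h s) * cnj (expo s x) =
          (\<integral>y. cnj (G y) * (of_real (gauss e s) * cnj (expo s x)) * expo s y \<partial>lborel)"
        by (simp add: mult_ac flip: integral_mult_right_zero)
    qed
    also have "\<dots> = (\<integral>y. (\<integral>s. cnj (G y) * (of_real (gauss e s) * cnj (expo s x)) * expo s y \<partial>lborel) \<partial>lborel)"
      by (rule Fubini_bounded_kernel[OF Gc, where B = \<kappa>])
         (auto intro!: integrable_mult_bounded[OF gauss_c, where B = \<kappa>] \<kappa> simp: case_prod_beta')
    also have "\<dots> = (\<integral>y. cnj (G y) * of_real (heat e (y - x)) \<partial>lborel)"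
    proof (rule Bochner_Integration.integral_cong[OF refl])
      fix y
      have "(\<integral>s. cnj (G y) * (of_real (gauss e s) * cnj (expo s x)) * expo s y \<partial>lborel) =
          (\<integral>s. cnj (G y) * (expo y s * cnj (expo x s) * of_real (gauss e s)) \<partial>lborel)"
        by (simp add: mult_ac expo_commute[of _ x] expo_commute[of _ y])
      then show "(\<integral>s. cnj (G y) * (of_real (gauss e s) * cnj (expo s x)) * expo s y \<partial>lborel) =
          cnj (G y) * of_real (heat e (y - x))"
        by (simp only: integral_mult_right_zero integral_expo_gauss[OF e])
    qed
    finally show ?thesis .
  qed
  have "(\<integral>s. of_real ((norm (h s))\<^sup>2 * gauss e s) \<partial>lborel) =
      (\<integral>s. (\<integral>x. G x * (of_real (gauss e s) * cnj (h s)) * cnj (expo s x) \<partial>lborel) \<partial>lborel)"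
  proof (rule Bochner_Integration.integral_cong[OF refl])
    fix s
    have "complex_of_real ((norm (h s))\<^sup>2 * gauss e s) = h s * (of_real (gauss e s) * cnj (h s))"
      by (simp only: of_real_mult complex_norm_square) (simp add: mult_ac)
    also have "\<dots> = (\<integral>x. (G x * cnj (expo s x)) * (of_real (gauss e s) * cnj (h s)) \<partial>lborel)"
      unfolding h_def by (rule integral_mult_left_zero[symmetric])
    finally show "complex_of_real ((norm (h s))\<^sup>2 * gauss e s) =
        (\<integral>x. G x * (of_real (gauss e s) * cnj (h s)) * cnj (expo s x) \<partial>lborel)"
      by (simp only: mult_ac)
  qed
  also have "\<dots> = (\<integral>x. (\<integral>s. G x * (of_real (gauss e s) * cnj (h s)) * cnj (expo s x) \<partial>lborel) \<partial>lborel)"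
    by (rule Fubini_bounded_kernel[OF G \<psi>, where B = \<kappa>]) (auto intro!: \<kappa> simp: case_prod_beta')
  also have "\<dots> = (\<integral>x. G x * (\<integral>y. cnj (G y) * of_real (heat e (y - x)) \<partial>lborel) \<partial>lborel)"
    by (simp only: K[symmetric] integral_mult_right_zero[symmetric] mult.assoc)
  finally have eq: "complex_of_real (\<integral>s. (norm (h s))\<^sup>2 * gauss e s \<partial>lborel) =
      (\<integral>x. G x * (\<integral>y. cnj (G y) * of_real (heat e (y - x)) \<partial>lborel) \<partial>lborel)"
    by (simp only: integral_complex_of_real)
  have sq: "(\<integral>\<^sup>+x. ennreal ((norm (G x))\<^sup>2) \<partial>lborel) = ennreal ((L2_norm lborel G)\<^sup>2)"
    unfolding L2_norm_power2 by (rule nn_integral_eq_integral[OF L2_integrable_square[OF G2]]) simp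
  have int: "integrable lborel (\<lambda>s. (norm (h s))\<^sup>2 * gauss e s)"
  proof (rule Bochner_Integration.integrable_bound)
    show "integrable lborel (\<lambda>s::real^'d. (\<kappa> * (\<integral>x. norm (G x) \<partial>lborel))\<^sup>2 * gauss e s)"
      by (intro integrable_mult_right integrable_gauss e)
    show "AE s in lborel. norm ((norm (h s))\<^sup>2 * gauss e s) \<le> norm ((\<kappa> * (\<integral>x. norm (G x) \<partial>lborel))\<^sup>2 * gauss e s)"
      using gauss_pos[of e] h_bd by (intro AE_I2) (auto simp: abs_mult intro!: mult_right_mono power_mono)
  qed measurable
  have "(\<integral>\<^sup>+s. ennreal ((norm (h s))\<^sup>2 * gauss e s) \<partial>lborel) = ennreal (\<integral>s. (norm (h s))\<^sup>2 * gauss e s \<partial>lborel)"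
    by (intro nn_integral_eq_integral int AE_I2 mult_nonneg_nonneg less_imp_le[OF gauss_pos]) simp
  also have "\<dots> \<le> ennreal (norm (\<integral>x. G x * (\<integral>y. cnj (G y) * of_real (heat e (y - x)) \<partial>lborel) \<partial>lborel))"
    unfolding eq[symmetric] by (intro ennreal_leI) simp
  also have "\<dots> \<le> (\<integral>\<^sup>+x. ennreal (norm (G x * (\<integral>y. cnj (G y) * of_real (heat e (y - x)) \<partial>lborel))) \<partial>lborel)"
    by (rule norm_integral_le_nn_integral)
  also have "\<dots> \<le> (\<integral>\<^sup>+x. (\<integral>\<^sup>+y. ennreal (norm (G x) * norm (G y) * heat e (y - x)) \<partial>lborel) \<partial>lborel)"
  proof (rule nn_integral_mono)
    fix x
    have "ennreal (norm (G x * (\<integral>y. cnj (G y) * of_real (heat e (y - x)) \<partial>lborel))) =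
        ennreal (norm (G x)) * ennreal (norm (\<integral>y. cnj (G y) * of_real (heat e (y - x)) \<partial>lborel))"
      by (simp add: norm_mult ennreal_mult)
    also have "\<dots> \<le> ennreal (norm (G x)) * (\<integral>\<^sup>+y. ennreal (norm (cnj (G y) * of_real (heat e (y - x)))) \<partial>lborel)"
      by (intro mult_left_mono norm_integral_le_nn_integral) simp
    also have "\<dots> = (\<integral>\<^sup>+y. ennreal (norm (G x)) * ennreal (norm (cnj (G y) * of_real (heat e (y - x)))) \<partial>lborel)"
      by (rule nn_integral_cmult[symmetric]) measurable
    also have "\<dots> = (\<integral>\<^sup>+y. ennreal (norm (G x) * norm (G y) * heat e (y - x)) \<partial>lborel)"
      by (simp add: norm_mult ennreal_mult mult.assoc abs_of_nonneg[OF heat_nonneg[OF e]] heat_nonneg[OF e])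
    finally show "ennreal (norm (G x * (\<integral>y. cnj (G y) * of_real (heat e (y - x)) \<partial>lborel))) \<le>
        (\<integral>\<^sup>+y. ennreal (norm (G x) * norm (G y) * heat e (y - x)) \<partial>lborel)" .
  qed
  also have "\<dots> \<le> (\<integral>\<^sup>+x. (\<integral>\<^sup>+y. ennreal (1/2) * (ennreal ((norm (G x))\<^sup>2) * ennreal (heat e (y - x)) +
      ennreal ((norm (G y))\<^sup>2) * ennreal (heat e (y - x))) \<partial>lborel) \<partial>lborel)"
  proof (intro nn_integral_mono)
    fix x y
    have "norm (G x) * norm (G y) \<le> 1/2 * ((norm (G x))\<^sup>2 + (norm (G y))\<^sup>2)"
      using sum_squares_bound[of "norm (G x)" "norm (G y)"] by simp
    then have "norm (G x) * norm (G y) * heat e (y - x) \<le>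
        1/2 * ((norm (G x))\<^sup>2 + (norm (G y))\<^sup>2) * heat e (y - x)"
      by (rule mult_right_mono) (rule heat_nonneg[OF e])
    then have "ennreal (norm (G x) * norm (G y) * heat e (y - x)) \<le>
        ennreal (1/2 * ((norm (G x))\<^sup>2 * heat e (y - x) + (norm (G y))\<^sup>2 * heat e (y - x)))"
      by (intro ennreal_leI) (simp add: algebra_simps)
    also have "\<dots> = ennreal (1/2) *
        (ennreal ((norm (G x))\<^sup>2) * ennreal (heat e (y - x)) + ennreal ((norm (G y))\<^sup>2) * ennreal (heat e (y - x)))"
      by (subst ennreal_mult) (auto simp: heat_nonneg[OF e] ennreal_mult)
    finally show "ennreal (norm (G x) * norm (G y) * heat e (y - x)) \<le> ennreal (1/2) *
        (ennreal ((norm (G x))\<^sup>2) * ennreal (heat e (y - x)) + ennreal ((norm (G y))\<^sup>2) * ennreal (heat e (y - x)))" .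
  qed
  also have "\<dots> = ennreal (1/2) * ((\<integral>\<^sup>+x. (\<integral>\<^sup>+y. ennreal ((norm (G x))\<^sup>2) * ennreal (heat e (y - x)) \<partial>lborel) \<partial>lborel) +
      (\<integral>\<^sup>+x. (\<integral>\<^sup>+y. ennreal ((norm (G y))\<^sup>2) * ennreal (heat e (y - x)) \<partial>lborel) \<partial>lborel))"
    by (simp add: nn_integral_cmult nn_integral_add)
  also have "(\<integral>\<^sup>+x. (\<integral>\<^sup>+y. ennreal ((norm (G x))\<^sup>2) * ennreal (heat e (y - x)) \<partial>lborel) \<partial>lborel) = ennreal ((L2_norm lborel G)\<^sup>2)"
    by (simp add: nn_integral_cmult nn_integral_heat[OF e] sq)
  also have "(\<integral>\<^sup>+x. (\<integral>\<^sup>+y. ennreal ((norm (G y))\<^sup>2) * ennreal (heat e (y - x)) \<partial>lborel) \<partial>lborel) = ennreal ((L2_norm lborel G)\<^sup>2)"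
    by (subst lborel_pair.Fubini') (simp_all add: nn_integral_cmult nn_integral_heat[OF e] sq)
  also have "ennreal (1/2) * (ennreal ((L2_norm lborel G)\<^sup>2) + ennreal ((L2_norm lborel G)\<^sup>2)) =
      ennreal (1/2 * ((L2_norm lborel G)\<^sup>2 + (L2_norm lborel G)\<^sup>2))"
    unfolding ennreal_plus[OF zero_le_power2 zero_le_power2, symmetric] by (rule ennreal_mult[symmetric]) auto
  also have "1/2 * ((L2_norm lborel G)\<^sup>2 + (L2_norm lborel G)\<^sup>2) = (L2_norm lborel G)\<^sup>2"
    by simp
  finally show ?thesis .
qed

text \<open>The Fourier transform of \<open>g\<close> extended by 0 outside the cube, in the normalisation of \<open>expo\<close>.\<close>

definition FT :: "(real^'d \<Rightarrow> complex) \<Rightarrow> real^'d \<Rightarrow> complex" where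
  "FT g s = L2_inner cube_measure g (expo s)"

lemma gauss_LIMSEQ: "(\<lambda>n. gauss (1 / real (Suc n)) s) \<longlonglongrightarrow> 1"
proof -
  have "(\<lambda>n. exp (- (1 / real (Suc n)) * (norm s)\<^sup>2 / 2)) \<longlonglongrightarrow> exp (- 0 * (norm s)\<^sup>2 / 2)"
    by (intro tendsto_intros LIMSEQ_Suc lim_1_over_n) auto
  then show ?thesis by (simp add: gauss_def)
qed

lemma L2_integrable_finite:
  assumes "finite_measure M" "f \<in> L2 M"
  shows "integrable M f"
  using L2_integrable_mult_cnj[OF assms(2) L2_bounded_finite[OF assms(1), of "\<lambda>_. 1" 1]] by simp

text \<open>Let the Gaussian weight of \<open>Plancherel_regularized\<close> tend to 1 and use Fatou's lemma.\<close>

lemma Plancherel_inequality: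
  fixes g :: "real^'d \<Rightarrow> complex"
  assumes g: "g \<in> L2 cube_measure"
  shows FT_L2: "FT g \<in> L2 lborel"
    and L2_norm_FT: "L2_norm lborel (FT g) \<le> L2_norm cube_measure g"
proof -
  define G where "G x = indicator cube x *\<^sub>R g x" for x
  have G_m [measurable]: "G \<in> borel_measurable borel"
    using g borel_measurable_restrict_space_iff[of cube lborel g] by (simp add: L2_def G_def[abs_def])
  have G2: "G \<in> L2 lborel"
  proof -
    have "integrable lborel (\<lambda>x. indicator cube x *\<^sub>R (norm (g x))\<^sup>2)"
      using L2_integrable_square[OF g] unfolding integrable_cube_measure .
    also have "(\<lambda>x. indicator cube x *\<^sub>R (norm (g x))\<^sup>2) = (\<lambda>x. (norm (G x))\<^sup>2)"
      by (auto simp: G_def indicator_def)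
    finally show ?thesis by (simp add: L2_def)
  qed
  have G1: "integrable lborel G"
    using L2_integrable_finite[OF finite_measure_cube g] unfolding integrable_cube_measure G_def[abs_def] .
  have FT: "FT g s = (\<integral>x. G x * cnj (expo s x) \<partial>lborel)" for s
    by (simp add: FT_def L2_inner_def integral_cube_measure G_def)
  have norm: "L2_norm lborel G = L2_norm cube_measure g"
    unfolding L2_norm_def integral_cube_measure
    by (intro arg_cong[where f = sqrt] Bochner_Integration.integral_cong) (auto simp: G_def indicator_def)
  have FT_m: "FT g \<in> borel_measurable borel"
    unfolding FT[abs_def] by measurable
  note [measurable] = FT_m
  have "(\<integral>\<^sup>+s. ennreal ((norm (FT g s))\<^sup>2) \<partial>lborel) =
      (\<integral>\<^sup>+s. liminf (\<lambda>n. ennreal ((norm (FT g s))\<^sup>2 * gauss (1 / real (Suc n)) s)) \<partial>lborel)"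
  proof (rule nn_integral_cong)
    fix s
    have "(\<lambda>n. ennreal ((norm (FT g s))\<^sup>2 * gauss (1 / real (Suc n)) s)) \<longlonglongrightarrow> ennreal ((norm (FT g s))\<^sup>2 * 1)"
      by (intro tendsto_ennrealI tendsto_mult tendsto_const gauss_LIMSEQ)
    from lim_imp_Liminf[OF _ this]
    show "ennreal ((norm (FT g s))\<^sup>2) = liminf (\<lambda>n. ennreal ((norm (FT g s))\<^sup>2 * gauss (1 / real (Suc n)) s))"
      by simp
  qed
  also have "\<dots> \<le> liminf (\<lambda>n. \<integral>\<^sup>+s. ennreal ((norm (FT g s))\<^sup>2 * gauss (1 / real (Suc n)) s) \<partial>lborel)"
    by (rule nn_integral_liminf) measurable
  also have "\<dots> \<le> liminf (\<lambda>n. ennreal ((L2_norm lborel G)\<^sup>2))"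
    unfolding FT by (intro Liminf_mono always_eventually allI Plancherel_regularized G1 G2) simp
  also have "\<dots> = ennreal ((L2_norm cube_measure g)\<^sup>2)"
    by (simp add: norm Liminf_const)
  finally have le: "(\<integral>\<^sup>+s. ennreal ((norm (FT g s))\<^sup>2) \<partial>lborel) \<le> ennreal ((L2_norm cube_measure g)\<^sup>2)" .
  have int: "integrable lborel (\<lambda>s. (norm (FT g s))\<^sup>2)"
    using le by (intro integrableI_bounded) (auto intro: le_less_trans)
  with FT_m show "FT g \<in> L2 lborel" by (simp add: L2_def)
  have "(L2_norm lborel (FT g))\<^sup>2 \<le> (L2_norm cube_measure g)\<^sup>2"
    using le by (simp add: L2_norm_power2[of lborel] nn_integral_eq_integral[OF int])
  then show "L2_norm lborel (FT g) \<le> L2_norm cube_measure g"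
    by (rule power2_le_imp_le) simp
qed

text \<open>The exponent of the heat kernel is split in two halves: the first makes the bound small as \<open>e\<close>
  tends to 0, and the second, because \<open>e \<le> 1\<close>, leaves a Gaussian that does not depend on \<open>e\<close>.\<close>

lemma heat_away_bound:
  fixes u :: "real^'d"
  assumes "0 < e" "e \<le> 1" "\<delta> > 0" "norm u \<ge> \<delta>"
  shows "heat e u \<le> exp (- \<delta>\<^sup>2 / (4 * e)) / sqrt (2 * pi * e) ^ CARD('d) * gauss (1/2) u"
proof -
  have "\<delta>\<^sup>2 \<le> (norm u)\<^sup>2" using assms by (intro power_mono) auto
  then have 1: "\<delta>\<^sup>2 / (4 * e) \<le> (norm u)\<^sup>2 / (4 * e)"
    using assms by (intro divide_right_mono) auto
  have 2: "(norm u)\<^sup>2 / 4 \<le> (norm u)\<^sup>2 / (4 * e)"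
    using assms by (intro divide_left_mono) auto
  have "(norm u)\<^sup>2 / (2 * e) = (norm u)\<^sup>2 / (4 * e) + (norm u)\<^sup>2 / (4 * e)"
    using assms by (simp add: field_simps)
  with 1 2 have "- (1 / e) * (norm u)\<^sup>2 / 2 \<le> - \<delta>\<^sup>2 / (4 * e) + (- (1/2) * (norm u)\<^sup>2 / 2)"
    by simp
  then have "gauss (1 / e) u \<le> exp (- \<delta>\<^sup>2 / (4 * e)) * gauss (1/2) u"
    unfolding gauss_def exp_add[symmetric] by simp
  then show ?thesis
    using assms unfolding heat_def by (simp add: divide_right_mono)
qed

text \<open>The constants of \<open>heat_away_bound\<close> for \<open>e = 1 / (n + 1)\<close>: a power is beaten by an exponential.\<close>

lemma heat_constant_LIMSEQ:
  assumes "\<delta> > 0"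
  shows "(\<lambda>n. exp (- \<delta>\<^sup>2 / (4 * (1 / real (Suc n)))) / sqrt (2 * pi * (1 / real (Suc n))) ^ d) \<longlonglongrightarrow> 0"
proof -
  define k where "k = \<delta>\<^sup>2 / 4"
  have k: "k > 0" using assms by (simp add: k_def)
  have lim: "(\<lambda>n. (1 / k) ^ d * ((k * real (Suc n)) ^ d / exp (k * real (Suc n)))) \<longlonglongrightarrow> (1 / k) ^ d * 0"
    by (intro tendsto_mult tendsto_const filterlim_compose[OF tendsto_power_div_exp_0]
      filterlim_tendsto_pos_mult_at_top[OF tendsto_const k] filterlim_compose[OF filterlim_real_sequentially filterlim_Suc])
  show ?thesis
  proof (rule tendsto_sandwich[OF _ _ tendsto_const lim[simplified mult_zero_right]])
    show "\<forall>\<^sub>F n in sequentially. 0 \<le> exp (- \<delta>\<^sup>2 / (4 * (1 / real (Suc n)))) / sqrt (2 * pi * (1 / real (Suc n))) ^ d"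
      by (intro always_eventually allI divide_nonneg_nonneg zero_le_power) auto
    show "\<forall>\<^sub>F n in sequentially. exp (- \<delta>\<^sup>2 / (4 * (1 / real (Suc n)))) / sqrt (2 * pi * (1 / real (Suc n))) ^ d \<le>
        (1 / k) ^ d * ((k * real (Suc n)) ^ d / exp (k * real (Suc n)))"
    proof (intro always_eventually allI)
      fix n
      define N where "N = real (Suc n)"
      have N: "N \<ge> 1" by (simp add: N_def)
      have "sqrt (1 / N\<^sup>2) \<le> sqrt (2 * pi * (1 / N))"
      proof (rule real_sqrt_le_mono)
        have "1 / N\<^sup>2 \<le> 1 / N" using N by (simp add: field_simps power2_eq_square)
        also have "\<dots> \<le> 2 * pi * (1 / N)"
          using N pi_gt3 by (simp add: field_simps)
        finally show "1 / N\<^sup>2 \<le> 2 * pi * (1 / N)" .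
      qed
      then have "1 / N \<le> sqrt (2 * pi * (1 / N))" using N by (simp add: real_sqrt_divide)
      then have "(1 / N) ^ d \<le> sqrt (2 * pi * (1 / N)) ^ d" using N by (intro power_mono) auto
      then have "exp (- k * N) / sqrt (2 * pi * (1 / N)) ^ d \<le> exp (- k * N) / (1 / N) ^ d"
        using N by (intro divide_left_mono) auto
      also have "\<dots> = (1 / k) ^ d * ((k * N) ^ d / exp (k * N))"
        using k N by (simp add: power_divide power_mult_distrib exp_minus field_simps)
      finally show "exp (- \<delta>\<^sup>2 / (4 * (1 / real (Suc n)))) / sqrt (2 * pi * (1 / real (Suc n))) ^ d \<le>
        (1 / k) ^ d * ((k * real (Suc n)) ^ d / exp (k * real (Suc n)))"
        by (simp add: k_def N_def)
    qed
  qed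
qed

lemma integrable_L2_gauss:
  fixes f :: "real^'d \<Rightarrow> complex"
  assumes f: "f \<in> L2 lborel" and e: "e > 0"
  shows "integrable lborel (\<lambda>t. f t * of_real (gauss e (t - s)))"
proof -
  have "(gauss e (t - s))\<^sup>2 = gauss (2 * e) (t - s)" for t
    by (simp add: gauss_def power2_eq_square exp_add[symmetric])
  then have "(\<lambda>t. complex_of_real (gauss e (t - s))) \<in> L2 lborel"
    using integrable_lborel_shift[OF integrable_gauss[of "2 * e"], of s] e by (simp add: L2_def)
  from L2_integrable_mult_cnj[OF f this] show ?thesis by simp
qed

lemma integrable_L2_heat:
  fixes f :: "real^'d \<Rightarrow> complex"
  assumes f: "f \<in> L2 lborel" and e: "e > 0"
  shows "integrable lborel (\<lambda>t. f t * of_real (heat e (t - s)))"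
  using integrable_divide_zero[OF integrable_L2_gauss[OF f, of "1 / e" s],
      of "of_real (sqrt (2 * pi * e) ^ CARD('d))"] e
  by (simp add: heat_def)

text \<open>As \<open>f\<close> may be unbounded, smallness of the mass of the heat kernel away from \<open>s\<close> does not suffice.
  There \<open>heat_away_bound\<close> compares the kernel with a fixed Gaussian, against which a function in L2 is
  integrable.\<close>

lemma heat_approximate_identity:
  fixes f :: "real^'d \<Rightarrow> complex"
  assumes f: "f \<in> L2 lborel" and cont: "isCont f s"
  shows "(\<lambda>n. \<integral>t. f t * of_real (heat (1 / real (Suc n)) (t - s)) \<partial>lborel) \<longlonglongrightarrow> f s"
proof (rule metric_LIMSEQ_I)
  fix \<eta> :: real assume \<eta>: "\<eta> > 0"
  from cont[unfolded continuous_at_eps_delta, rule_format, of "\<eta> / 2"] \<eta>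
  obtain \<delta> where \<delta>: "\<delta> > 0" and close: "\<And>t. norm (t - s) < \<delta> \<Longrightarrow> norm (f t - f s) < \<eta> / 2"
    by (auto simp: dist_norm)
  have [measurable]: "f \<in> borel_measurable borel" using f by (simp add: L2_def)
  define A where "A = (\<integral>t. norm (f t - f s) * gauss (1/2) (t - s) \<partial>lborel)"
  define c where "c n = exp (- \<delta>\<^sup>2 / (4 * (1 / real (Suc n)))) / sqrt (2 * pi * (1 / real (Suc n))) ^ CARD('d)" for n
  have int_s: "integrable lborel (\<lambda>t::real^'d. f s * of_real (F (t - s)))" if "integrable lborel F" for F
    by (intro integrable_mult_right integrable_of_real integrable_lborel_shift that)
  have A_int: "integrable lborel (\<lambda>t. norm (f t - f s) * gauss (1/2) (t - s))"
  proof -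
    have "integrable lborel (\<lambda>t. norm (f t * of_real (gauss (1/2) (t - s)) - f s * of_real (gauss (1/2) (t - s))))"
      by (intro integrable_norm Bochner_Integration.integrable_diff integrable_L2_gauss f int_s integrable_gauss) auto
    then show ?thesis
      by (simp add: left_diff_distrib[symmetric] norm_mult gauss_pos less_imp_le)
  qed
  have est: "norm ((\<integral>t. f t * of_real (heat (1 / real (Suc n)) (t - s)) \<partial>lborel) - f s) \<le> \<eta> / 2 + c n * A" for n
  proof -
    define e where "e = 1 / real (Suc n)"
    have e: "0 < e" "e \<le> 1" by (auto simp: e_def)
    have shift: "integrable lborel (\<lambda>t. heat e (t - s))" "(\<integral>t. heat e (t - s) \<partial>lborel) = 1"
      using integrable_lborel_shift[OF integrable_heat[OF e(1)], of s]
        integral_lborel_shift[of "heat e" s] integral_heat[OF e(1)] by auto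
    have "f s = (\<integral>t. f s * of_real (heat e (t - s)) \<partial>lborel)"
      using shift(2) by simp
    then have "(\<integral>t. f t * of_real (heat e (t - s)) \<partial>lborel) - f s =
        (\<integral>t. f t * of_real (heat e (t - s)) - f s * of_real (heat e (t - s)) \<partial>lborel)"
      by (simp add: Bochner_Integration.integral_diff[OF integrable_L2_heat[OF f e(1)] int_s[OF integrable_heat[OF e(1)]]])
    also have "norm \<dots> \<le> (\<integral>t. \<eta> / 2 * heat e (t - s) + c n * (norm (f t - f s) * gauss (1/2) (t - s)) \<partial>lborel)"
    proof (rule Bochner_Integration.integral_norm_bound_integral)
      show "integrable lborel (\<lambda>t. f t * of_real (heat e (t - s)) - f s * of_real (heat e (t - s)))"
        by (intro Bochner_Integration.integrable_diff integrable_L2_heat[OF f e(1)] int_s[OF integrable_heat[OF e(1)]])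
      show "integrable lborel (\<lambda>t. \<eta> / 2 * heat e (t - s) + c n * (norm (f t - f s) * gauss (1/2) (t - s)))"
        by (intro Bochner_Integration.integrable_add integrable_mult_right shift A_int)
      fix t
      have eq: "norm (f t * of_real (heat e (t - s)) - f s * of_real (heat e (t - s))) = norm (f t - f s) * heat e (t - s)"
        by (simp add: left_diff_distrib[symmetric] norm_mult heat_nonneg[OF e(1)])
      have c: "c n \<ge> 0" by (auto simp: c_def intro!: divide_nonneg_nonneg)
      show "norm (f t * of_real (heat e (t - s)) - f s * of_real (heat e (t - s))) \<le>
          \<eta> / 2 * heat e (t - s) + c n * (norm (f t - f s) * gauss (1/2) (t - s))"
      proof (cases "norm (t - s) < \<delta>")
        case True
        have "norm (f t - f s) * heat e (t - s) \<le> \<eta> / 2 * heat e (t - s)"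
          using close[OF True] by (intro mult_right_mono heat_nonneg e) auto
        moreover have "0 \<le> c n * (norm (f t - f s) * gauss (1/2) (t - s))"
          by (intro mult_nonneg_nonneg c less_imp_le[OF gauss_pos]) simp
        ultimately show ?thesis unfolding eq by linarith
      next
        case False
        have "norm (f t - f s) * heat e (t - s) \<le> norm (f t - f s) * (c n * gauss (1/2) (t - s))"
          unfolding c_def e_def[symmetric] using False e \<delta> by (intro mult_left_mono heat_away_bound) auto
        moreover have "0 \<le> \<eta> / 2 * heat e (t - s)"
          using \<eta> by (simp add: heat_nonneg[OF e(1)])
        ultimately show ?thesis unfolding eq by (simp add: mult_ac)
      qed
    qed
    also have "\<dots> = \<eta> / 2 + c n * A"
      by (subst Bochner_Integration.integral_add) (auto intro!: integrable_mult_right shift A_int simp: shift A_def)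
    finally show ?thesis by (simp add: e_def)
  qed
  have "(\<lambda>n. c n * A) \<longlonglongrightarrow> 0"
    using tendsto_mult_left_zero[OF heat_constant_LIMSEQ[OF \<delta>]] unfolding c_def by simp
  from order_tendstoD(2)[OF this, of "\<eta> / 2"] \<eta>
  obtain N where "\<forall>n\<ge>N. c n * A < \<eta> / 2" by (auto simp: eventually_sequentially)
  then show "\<exists>N. \<forall>n\<ge>N. dist (\<integral>t. f t * of_real (heat (1 / real (Suc n)) (t - s)) \<partial>lborel) (f s) < \<eta>"
    using est by (intro exI[of _ N]) (force simp: dist_norm intro: le_less_trans)
qed

text \<open>Fourier inversion. Pairing the truncated inverse transforms of \<open>f\<close> with the exponential of
  frequency \<open>s\<close> times \<open>gauss e\<close> and exchanging integrals gives \<open>f\<close> integrated against the heat kernel centred at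
  \<open>s\<close>. In the limit of full truncation the pairing of the L2 limit \<open>g\<close> equals that integral. As \<open>e\<close> tends
  to 0 the pairing tends to \<open>FT g s\<close>, since \<open>g\<close> lives on the cube and is integrable there, and the integral tends to
  \<open>f s\<close> by continuity of \<open>f\<close>.\<close>

lemma PW_representation:
  fixes f :: "real^'d \<Rightarrow> complex"
  assumes "f \<in> PW"
  shows "\<exists>g\<in>L2 cube_measure. \<forall>s. f s = FT g s"
proof -
  from assms obtain g where cont: "continuous_on UNIV f" and f: "f \<in> L2 lborel"
    and g_F: "is_inverse_Fourier_L2 f g" and g0: "AE x in lborel. x \<notin> cube \<longrightarrow> g x = 0"
    by (auto simp: PW_def)
  define FR where "FR R x = (LINT t:cball 0 R|lborel. f t * expo t x)" for R x
  from g_F have g: "g \<in> L2 lborel" and FR_L2: "\<forall>\<^sub>F R in at_top. FR R \<in> L2 lborel"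
    and FR_lim: "((\<lambda>R. L2_norm lborel (\<lambda>x. FR R x - g x)) \<longlongrightarrow> 0) at_top"
    by (auto simp: is_inverse_Fourier_L2_def L2_tendsto_def FR_def[abs_def])
  have [measurable]: "f \<in> borel_measurable borel" "g \<in> borel_measurable borel"
    using f g by (simp_all add: L2_def)
  have g_cube: "g \<in> L2 cube_measure"
  proof -
    have "integrable lborel (\<lambda>x. indicator cube x *\<^sub>R (norm (g x))\<^sup>2)"
      by (rule Bochner_Integration.integrable_bound[OF L2_integrable_square[OF g]]) (auto simp: indicator_def)
    then show ?thesis by (simp add: L2_def integrable_cube_measure)
  qed
  have "f s = FT g s" for s
  proof -
    define \<phi> where "\<phi> e x = expo s x * of_real (gauss e x)" for e and x :: "real^'d"
    have \<phi>_m [measurable]: "\<phi> e \<in> borel_measurable borel" for e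
      unfolding \<phi>_def by measurable
    have \<phi>_L2: "\<phi> e \<in> L2 lborel" if e: "e > 0" for e
    proof -
      have "(norm (\<phi> e x))\<^sup>2 = (1 / (2 * pi) powr (real CARD('d) / 2))\<^sup>2 * gauss (2 * e) x" for x
        by (simp add: \<phi>_def norm_mult norm_expo gauss_def power2_eq_square exp_add[symmetric])
      then show ?thesis using e by (simp add: L2_def integrable_gauss)
    qed
    \<comment> \<open>Both sides are limits of the pairings with the truncated inverse transforms.\<close>
    have pairing: "L2_inner lborel g (\<phi> e) = (\<integral>t. f t * of_real (heat e (t - s)) \<partial>lborel)" if e: "e > 0" for e
    proof -
      have FR_inner: "L2_inner lborel (FR R) (\<phi> e) =
          (\<integral>t. indicator (cball 0 R) t *\<^sub>R (f t * of_real (heat e (t - s))) \<partial>lborel)" for R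
      proof -
        have ball_int: "integrable lborel (\<lambda>t. indicator (cball 0 R) t *\<^sub>R f t)"
          by (rule borel_integrable_compact) (auto intro: continuous_on_subset[OF cont])
        have \<phi>_int: "integrable lborel (\<lambda>x. cnj (\<phi> e x))"
          unfolding \<phi>_def complex_cnj_mult complex_cnj_complex_of_real mult.commute[of "cnj _"]
          by (rule integrable_mult_bounded[OF integrable_of_real[OF integrable_gauss[OF e]]]) (auto simp: norm_expo)
        have "L2_inner lborel (FR R) (\<phi> e) =
            (\<integral>x. (\<integral>t. (indicator (cball 0 R) t *\<^sub>R f t) * cnj (\<phi> e x) * expo t x \<partial>lborel) \<partial>lborel)"
          unfolding L2_inner_def
        proof (rule Bochner_Integration.integral_cong[OF refl])
          fix x
          have "FR R x * cnj (\<phi> e x) = (\<integral>t. (indicator (cball 0 R) t *\<^sub>R (f t * expo t x)) * cnj (\<phi> e x) \<partial>lborel)"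
            unfolding FR_def set_lebesgue_integral_def by (rule integral_mult_left_zero[symmetric])
          then show "FR R x * cnj (\<phi> e x) = (\<integral>t. (indicator (cball 0 R) t *\<^sub>R f t) * cnj (\<phi> e x) * expo t x \<partial>lborel)"
            by (simp add: mult_ac)
        qed
        also have "\<dots> = (\<integral>t. (\<integral>x. (indicator (cball 0 R) t *\<^sub>R f t) * cnj (\<phi> e x) * expo t x \<partial>lborel) \<partial>lborel)"
          by (rule Fubini_bounded_kernel[OF ball_int \<phi>_int, where B = "1 / (2 * pi) powr (real CARD('d) / 2)"])
             (auto simp: norm_expo case_prod_beta')
        also have "\<dots> = (\<integral>t. indicator (cball 0 R) t *\<^sub>R (f t * of_real (heat e (t - s))) \<partial>lborel)"
        proof (rule Bochner_Integration.integral_cong[OF refl])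
          fix t
          have "(\<integral>x. (indicator (cball 0 R) t *\<^sub>R f t) * cnj (\<phi> e x) * expo t x \<partial>lborel) =
              (\<integral>x. (indicator (cball 0 R) t *\<^sub>R f t) * (expo t x * cnj (expo s x) * of_real (gauss e x)) \<partial>lborel)"
            by (simp add: \<phi>_def mult_ac)
          then show "(\<integral>x. (indicator (cball 0 R) t *\<^sub>R f t) * cnj (\<phi> e x) * expo t x \<partial>lborel) =
              indicator (cball 0 R) t *\<^sub>R (f t * of_real (heat e (t - s)))"
            by (simp only: integral_mult_right_zero integral_expo_gauss[OF e]) simp
        qed
        finally show ?thesis .
      qed
      have "((\<lambda>R. L2_inner lborel (FR R) (\<phi> e)) \<longlongrightarrow> L2_inner lborel g (\<phi> e)) at_top"
      proof (rule LIM_zero_cancel)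
        have "((\<lambda>R. L2_norm lborel (\<lambda>x. FR R x - g x) * L2_norm lborel (\<phi> e)) \<longlongrightarrow> 0) at_top"
          by (rule tendsto_mult_left_zero[OF FR_lim])
        moreover have "\<forall>\<^sub>F R in at_top. norm (L2_inner lborel (FR R) (\<phi> e) - L2_inner lborel g (\<phi> e)) \<le>
            L2_norm lborel (\<lambda>x. FR R x - g x) * L2_norm lborel (\<phi> e)"
          using FR_L2
        proof eventually_elim
          case (elim R)
          show ?case
            using L2_Cauchy_Schwarz[OF L2_diff[OF elim g] \<phi>_L2[OF e]]
            by (simp add: L2_inner_diff_left[OF elim g \<phi>_L2[OF e]])
        qed
        ultimately show "((\<lambda>R. L2_inner lborel (FR R) (\<phi> e) - L2_inner lborel g (\<phi> e)) \<longlongrightarrow> 0) at_top"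
          by (rule Lim_null_comparison[rotated])
      qed
      then have lim1: "(\<lambda>n. L2_inner lborel (FR (real n)) (\<phi> e)) \<longlonglongrightarrow> L2_inner lborel g (\<phi> e)"
        by (rule filterlim_compose[OF _ filterlim_real_sequentially])
      have lim2: "(\<lambda>n. \<integral>t. indicator (cball 0 (real n)) t *\<^sub>R (f t * of_real (heat e (t - s))) \<partial>lborel)
          \<longlonglongrightarrow> (\<integral>t. f t * of_real (heat e (t - s)) \<partial>lborel)"
      proof (rule integral_dominated_convergence[where w = "\<lambda>t. norm (f t * of_real (heat e (t - s)))"])
        show "AE t in lborel. (\<lambda>n. indicator (cball 0 (real n)) t *\<^sub>R (f t * of_real (heat e (t - s))))
            \<longlonglongrightarrow> f t * of_real (heat e (t - s))"
        proof (rule AE_I2)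
          fix t :: "real^'d"
          obtain N :: nat where N: "norm t \<le> real N" using real_arch_simple by blast
          show "(\<lambda>n. indicator (cball 0 (real n)) t *\<^sub>R (f t * of_real (heat e (t - s))))
            \<longlonglongrightarrow> f t * of_real (heat e (t - s))"
            by (rule tendsto_eventually) (use N in \<open>auto simp: eventually_sequentially indicator_def intro!: exI[of _ N]\<close>)
        qed
        show "integrable lborel (\<lambda>t. norm (f t * of_real (heat e (t - s))))"
          by (intro integrable_norm integrable_L2_heat f e)
      qed (auto simp: indicator_def)
      show ?thesis
        using LIMSEQ_unique[OF lim1[unfolded FR_inner] lim2] .
    qed
    have "(\<lambda>n. L2_inner lborel g (\<phi> (1 / real (Suc n)))) \<longlonglongrightarrow> f s"
      using heat_approximate_identity[OF f, of s] cont by (simp add: pairing continuous_on_eq_continuous_at)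
    moreover have "(\<lambda>n. L2_inner lborel g (\<phi> (1 / real (Suc n)))) \<longlonglongrightarrow> FT g s"
    proof -
      have eq: "L2_inner lborel g (\<phi> e) = (\<integral>x. g x * cnj (expo s x) * of_real (gauss e x) \<partial>cube_measure)" for e
        unfolding L2_inner_def integral_cube_measure
        by (rule integral_cong_AE) (use g0 in \<open>auto simp: \<phi>_def indicator_def mult_ac elim!: eventually_mono\<close>)
      show ?thesis
        unfolding eq unfolding FT_def L2_inner_def
      proof (rule integral_dominated_convergence[where w = "\<lambda>x. norm (g x * cnj (expo s x))"])
        show "AE x in cube_measure. (\<lambda>n. g x * cnj (expo s x) * of_real (gauss (1 / real (Suc n)) x))
            \<longlonglongrightarrow> g x * cnj (expo s x)"
          using tendsto_mult[OF tendsto_const tendsto_of_real[OF gauss_LIMSEQ]] by fastforce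
        show "integrable cube_measure (\<lambda>x. norm (g x * cnj (expo s x)))"
          by (intro integrable_norm L2_integrable_mult_cnj g_cube expo_L2)
        show "AE x in cube_measure. norm (g x * cnj (expo s x) * of_real (gauss (1 / real (Suc n)) x))
            \<le> norm (g x * cnj (expo s x))" for n
          by (intro AE_I2) (auto simp: norm_mult abs_of_pos[OF gauss_pos] intro!: mult_right_le_one_le less_imp_le[OF gauss_pos] gauss_le_1)
      qed auto
    qed
    ultimately show ?thesis by (rule LIMSEQ_unique)
  qed
  with g_cube show ?thesis by blast
qed

section \<open>Trigonometric polynomials\<close>

lemma trig_spaceI: "p = (\<lambda>x. \<Sum>n\<in>index_cube l. c n * basis_expo n x) \<Longrightarrow> p \<in> trig_space l"
  by (auto simp: trig_space_def)

lemma trig_spaceE: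
  assumes "p \<in> trig_space l"
  obtains c where "p = (\<lambda>x. \<Sum>n\<in>index_cube l. c n * basis_expo n x)"
  using assms by (auto simp: trig_space_def)

lemma trig_space_L2: "p \<in> trig_space l \<Longrightarrow> p \<in> L2 cube_measure"
  by (erule trig_spaceE) (auto intro!: L2_sum L2_cmult basis_expo_L2)

lemma index_cube_mono: "l \<le> m \<Longrightarrow> index_cube l \<subseteq> index_cube m"
  unfolding index_cube_def by (intro Collect_mono impI allI) (auto dest!: spec elim: order_trans[rotated])

lemma trig_space_mono:
  assumes "l \<le> m"
  shows "trig_space l \<subseteq> (trig_space m :: (real^'d \<Rightarrow> complex) set)"
proof
  fix p :: "real^'d \<Rightarrow> complex" assume "p \<in> trig_space l"
  then obtain c where p: "p = (\<lambda>x. \<Sum>n\<in>index_cube l. c n * basis_expo n x)" by (rule trig_spaceE)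
  have sub: "index_cube l \<subseteq> (index_cube m :: (int^'d) set)"
    by (rule index_cube_mono[OF assms])
  have "p = (\<lambda>x. \<Sum>n\<in>index_cube m. (if n \<in> index_cube l then c n else 0) * basis_expo n x)"
    unfolding p by (intro ext sum.mono_neutral_cong_left finite_index_cube sub) auto
  then show "p \<in> trig_space m" by (rule trig_spaceI)
qed

lemma trig_space_add: "p \<in> trig_space l \<Longrightarrow> q \<in> trig_space l \<Longrightarrow> (\<lambda>x. p x + q x) \<in> trig_space l"
proof (elim trig_spaceE)
  fix c d assume "p = (\<lambda>x. \<Sum>n\<in>index_cube l. c n * basis_expo n x)"
    "q = (\<lambda>x. \<Sum>n\<in>index_cube l. d n * basis_expo n x)"
  then have "(\<lambda>x. p x + q x) = (\<lambda>x. \<Sum>n\<in>index_cube l. (c n + d n) * basis_expo n x)"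
    by (simp add: sum.distrib distrib_right)
  then show ?thesis by (rule trig_spaceI)
qed

lemma trig_space_cmult: "p \<in> trig_space l \<Longrightarrow> (\<lambda>x. a * p x) \<in> trig_space l"
proof (elim trig_spaceE)
  fix c assume "p = (\<lambda>x. \<Sum>n\<in>index_cube l. c n * basis_expo n x)"
  then have "(\<lambda>x. a * p x) = (\<lambda>x. \<Sum>n\<in>index_cube l. (a * c n) * basis_expo n x)"
    by (simp add: sum_distrib_left mult.assoc)
  then show ?thesis by (rule trig_spaceI)
qed

lemma trig_space_zero: "(\<lambda>x. 0) \<in> trig_space l"
  by (rule trig_spaceI[of _ "\<lambda>_. 0"]) simp

lemma basis_expo_in_trig_space: "n \<in> index_cube l \<Longrightarrow> basis_expo n \<in> trig_space l"
proof -
  assume n: "n \<in> index_cube l"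
  have "basis_expo n = (\<lambda>x. \<Sum>m\<in>index_cube l. (if m = n then 1 else 0) * basis_expo m x)"
  proof
    fix x
    have "(\<Sum>m\<in>index_cube l. (if m = n then 1 else 0) * basis_expo m x) =
        (\<Sum>m\<in>index_cube l. if m = n then basis_expo m x else 0)"
      by (intro sum.cong) auto
    also have "\<dots> = basis_expo n x" using n by (simp add: finite_index_cube)
    finally show "basis_expo n x = (\<Sum>m\<in>index_cube l. (if m = n then 1 else 0) * basis_expo m x)" ..
  qed
  then show ?thesis by (rule trig_spaceI)
qed

definition trig_polys :: "(real^'d \<Rightarrow> complex) set" where
  "trig_polys = (\<Union>l. trig_space l)"

lemma trig_polys_common:
  assumes "p \<in> trig_polys" "q \<in> trig_polys"
  obtains l where "p \<in> trig_space l" "q \<in> trig_space l"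
proof -
  from assms obtain k m where "p \<in> trig_space k" "q \<in> trig_space m" by (auto simp: trig_polys_def)
  then show thesis
    using that[of "max k m"] trig_space_mono[of k "max k m"] trig_space_mono[of m "max k m"] by auto
qed

lemma trig_polys_add: "p \<in> trig_polys \<Longrightarrow> q \<in> trig_polys \<Longrightarrow> (\<lambda>x. p x + q x) \<in> trig_polys"
  by (erule (1) trig_polys_common) (auto simp: trig_polys_def intro: trig_space_add)

lemma trig_polys_cmult: "p \<in> trig_polys \<Longrightarrow> (\<lambda>x. a * p x) \<in> trig_polys"
  by (auto simp: trig_polys_def intro: trig_space_cmult)

lemma trig_polys_zero: "(\<lambda>x. 0) \<in> trig_polys"
  by (auto simp: trig_polys_def intro: trig_space_zero)

lemma trig_polys_sum: "(\<And>i. i \<in> I \<Longrightarrow> f i \<in> trig_polys) \<Longrightarrow> (\<lambda>x. \<Sum>i\<in>I. f i x) \<in> trig_polys"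
  by (induction I rule: infinite_finite_induct) (auto intro: trig_polys_add trig_polys_zero)

lemma basis_expo_in_trig_polys: "basis_expo (n :: int^'d) \<in> trig_polys"
proof -
  define l where "l = nat (\<Sum>i\<in>UNIV. \<bar>n $ i\<bar>)"
  have "\<bar>n $ i\<bar> \<le> (\<Sum>i\<in>UNIV. \<bar>n $ i\<bar>)" for i
    by (rule member_le_sum) auto
  moreover have "int l = (\<Sum>i\<in>UNIV. \<bar>n $ i\<bar>)" by (simp add: l_def sum_nonneg)
  ultimately have "\<bar>n $ i\<bar> \<le> int l" for i by metis
  then have "n \<in> index_cube l" by (simp add: index_cube_def abs_le_iff) (metis minus_le_iff)
  then show ?thesis using basis_expo_in_trig_space by (auto simp: trig_polys_def)
qed

lemma trig_polys_exp: "(\<lambda>x::real^'d. exp (\<i> * of_real (x \<bullet> (\<chi> i. of_int (n $ i))))) \<in> trig_polys"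
  using trig_polys_cmult[OF basis_expo_in_trig_polys[of n], of "of_real ((2 * pi) powr (real CARD('d) / 2))"]
  by (simp add: basis_expo_def expo_def)

lemma basis_expo_mult:
  "basis_expo n x * basis_expo m (x::real^'d) =
    1 / of_real ((2 * pi) powr (real CARD('d) / 2)) * basis_expo (n + m) x"
proof -
  have "(\<chi> i. real_of_int ((n + m) $ i)) = (\<chi> i. real_of_int (n $ i)) + (\<chi> i. real_of_int (m $ i))"
    by (simp add: vec_eq_iff)
  then show ?thesis
    by (simp add: basis_expo_def expo_def inner_add_right distrib_left exp_add)
qed

lemma trig_polys_mult:
  fixes p q :: "real^'d \<Rightarrow> complex"
  assumes "p \<in> trig_polys" "q \<in> trig_polys"
  shows "(\<lambda>x. p x * q x) \<in> trig_polys"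
proof -
  from trig_polys_common[OF assms] obtain l where "p \<in> trig_space l" "q \<in> trig_space l" .
  then obtain c d where p: "p = (\<lambda>x. \<Sum>n\<in>index_cube l. c n * basis_expo n x)"
    and q: "q = (\<lambda>x. \<Sum>n\<in>index_cube l. d n * basis_expo n x)" by (auto elim!: trig_spaceE)
  have "(\<lambda>x. p x * q x) = (\<lambda>x. \<Sum>n\<in>index_cube l. \<Sum>m\<in>index_cube l.
      (c n * d m / of_real ((2 * pi) powr (real CARD('d) / 2))) * basis_expo (n + m) x)"
  proof
    fix x
    have eq: "c n * basis_expo n x * (d m * basis_expo m x) =
        (c n * d m / of_real ((2 * pi) powr (real CARD('d) / 2))) * basis_expo (n + m) x" for n m
      using basis_expo_mult[of n x m] by (simp add: field_simps)
    show "p x * q x = (\<Sum>n\<in>index_cube l. \<Sum>m\<in>index_cube l.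
      (c n * d m / of_real ((2 * pi) powr (real CARD('d) / 2))) * basis_expo (n + m) x)"
      by (simp only: p q sum_product eq)
  qed
  then show ?thesis
    by (simp only:) (intro trig_polys_sum trig_polys_cmult basis_expo_in_trig_polys)
qed

lemma trig_polys_const: "(\<lambda>x::real^'d. a) \<in> trig_polys"
proof -
  have "(\<chi> i. real_of_int ((0::int^'d) $ i)) = 0" by (simp add: vec_eq_iff)
  with trig_polys_cmult[OF trig_polys_exp[of "0::int^'d"], of a] show ?thesis by simp
qed

lemma trig_polys_prod: "(\<And>i. i \<in> I \<Longrightarrow> f i \<in> trig_polys) \<Longrightarrow> (\<lambda>x. \<Prod>i\<in>I. f i x) \<in> trig_polys"
  by (induction I rule: infinite_finite_induct) (auto intro: trig_polys_mult trig_polys_const)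

lemma trig_polys_power: "p \<in> trig_polys \<Longrightarrow> (\<lambda>x. p x ^ k) \<in> trig_polys"
  by (induction k) (auto intro: trig_polys_mult trig_polys_const)

lemma trig_polys_cos_sin:
  "(\<lambda>x::real^'d. of_real (a + b * cos (x $ j) + c * sin (x $ j))) \<in> trig_polys"
proof -
  have "(\<chi> i. real_of_int ((axis j k) $ i)) = (axis j (real_of_int k) :: real^'d)" for k
    by (simp add: vec_eq_iff axis_def)
  then have E: "(\<lambda>x::real^'d. exp (\<i> * of_real (x $ j * of_int k))) \<in> trig_polys" for k
    using trig_polys_exp[of "axis j k :: int^'d"] by (simp add: inner_axis)
  have "(\<lambda>x::real^'d. complex_of_real (a + b * cos (x $ j) + c * sin (x $ j))) = (\<lambda>x. of_real a +
      (of_real b / 2 - \<i> * of_real c / 2) * exp (\<i> * of_real (x $ j * of_int 1)) +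
      (of_real b / 2 + \<i> * of_real c / 2) * exp (\<i> * of_real (x $ j * of_int (- 1))))"
    by (intro ext) (simp add: complex_eq_iff Re_exp Im_exp algebra_simps)
  then show ?thesis
    by (simp only:) (intro trig_polys_add trig_polys_cmult trig_polys_const E)
qed

text \<open>Trigonometric polynomials form an algebra, so polynomials in real ones are again trigonometric
  polynomials.\<close>

lemma trig_polys_compose_polynomial:
  assumes p: "(\<lambda>x. of_real (p x)) \<in> trig_polys" and q: "real_polynomial_function (q :: real \<Rightarrow> real)"
  shows "(\<lambda>x. of_real (q (p x))) \<in> trig_polys"
proof -
  from real_polynomial_function_imp_sum[OF q] obtain a n where "q = (\<lambda>x. \<Sum>i\<le>(n::nat). a i * x ^ i)"
    by blast
  then have "(\<lambda>x. complex_of_real (q (p x))) = (\<lambda>x. \<Sum>i\<le>n. of_real (a i) * of_real (p x) ^ i)"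
    by simp
  then show ?thesis
    using trig_polys_sum[of "{..n}" "\<lambda>i x. of_real (a i) * of_real (p x) ^ i"]
      trig_polys_cmult[OF trig_polys_power[OF p]] by simp
qed

section \<open>Density of the trigonometric polynomials in L2 of the cube\<close>

lemma L2_dominated:
  fixes u :: "nat \<Rightarrow> 'a \<Rightarrow> complex"
  assumes w: "integrable M (\<lambda>x. (w x)\<^sup>2)"
    and u: "\<And>k. u k \<in> borel_measurable M" and v: "v \<in> borel_measurable M"
    and bound: "\<And>k. AE x in M. norm (u k x) \<le> w x"
    and lim: "AE x in M. (\<lambda>k. u k x) \<longlonglongrightarrow> v x"
  shows L2_dominated_mem: "v \<in> L2 M"
    and L2_dominated_LIMSEQ: "(\<lambda>k. L2_norm M (\<lambda>x. v x - u k x)) \<longlonglongrightarrow> 0"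
proof -
  have bound_all: "AE x in M. \<forall>k. norm (u k x) \<le> w x"
    using bound by (subst AE_all_countable) blast
  have v_bound: "AE x in M. norm (v x) \<le> w x"
    using bound_all lim
  proof eventually_elim
    case (elim x)
    then show ?case
      by (intro tendsto_upperbound[OF tendsto_norm[OF elim(2)]] always_eventually) auto
  qed
  have sq: "norm a \<le> b \<Longrightarrow> (norm a)\<^sup>2 \<le> b\<^sup>2" for a :: complex and b by (rule power_mono) auto
  have "integrable M (\<lambda>x. (norm (v x))\<^sup>2)"
  proof (rule Bochner_Integration.integrable_bound[OF w])
    show "AE x in M. norm ((norm (v x))\<^sup>2) \<le> norm ((w x)\<^sup>2)"
      using v_bound by eventually_elim (use sq in auto)
  qed (use v in measurable)
  with v show "v \<in> L2 M" by (simp add: L2_def)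
  have "(\<lambda>k. \<integral>x. (norm (v x - u k x))\<^sup>2 \<partial>M) \<longlonglongrightarrow> (\<integral>x. 0 \<partial>M)"
  proof (rule integral_dominated_convergence[where w = "\<lambda>x. 4 * (w x)\<^sup>2"])
    show "AE x in M. (\<lambda>k. (norm (v x - u k x))\<^sup>2) \<longlonglongrightarrow> 0"
      using lim
    proof eventually_elim
      case (elim x)
      have "(\<lambda>k. (norm (v x - u k x))\<^sup>2) \<longlonglongrightarrow> (norm (v x - v x))\<^sup>2"
        by (intro tendsto_intros elim)
      then show ?case by simp
    qed
    show "AE x in M. norm ((norm (v x - u k x))\<^sup>2) \<le> 4 * (w x)\<^sup>2" for k
      using v_bound bound[of k]
    proof eventually_elim
      case (elim x)
      have "norm (v x - u k x) \<le> 2 * w x" using norm_triangle_ineq4[of "v x" "u k x"] elim by linarith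
      from sq[OF this] show ?case by (simp add: power_mult_distrib)
    qed
  qed (use w u v in \<open>auto intro!: borel_measurable_power borel_measurable_norm borel_measurable_diff\<close>)
  then have "(\<lambda>k. sqrt (\<integral>x. (norm (v x - u k x))\<^sup>2 \<partial>M)) \<longlonglongrightarrow> sqrt 0"
    by (intro tendsto_real_sqrt) simp
  then show "(\<lambda>k. L2_norm M (\<lambda>x. v x - u k x)) \<longlonglongrightarrow> 0"
    by (simp add: L2_norm_def)
qed

definition trig_closure :: "(real^'d \<Rightarrow> complex) set" where
  "trig_closure = {f \<in> L2 cube_measure. \<forall>\<epsilon>>0. \<exists>p\<in>trig_polys. L2_norm cube_measure (\<lambda>x. f x - p x) < \<epsilon>}"

lemma trig_polys_L2: "p \<in> trig_polys \<Longrightarrow> p \<in> L2 cube_measure"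
  by (auto simp: trig_polys_def intro: trig_space_L2)

lemma trig_closure_L2: "f \<in> trig_closure \<Longrightarrow> f \<in> L2 cube_measure"
  by (simp add: trig_closure_def)

lemma trig_polys_closure: "p \<in> trig_polys \<Longrightarrow> p \<in> trig_closure"
  by (auto simp: trig_closure_def L2_norm_def intro: trig_polys_L2 intro!: bexI[of _ p])

lemma trig_closure_closed:
  assumes f: "f \<in> L2 cube_measure"
    and approx: "\<And>\<epsilon>. \<epsilon> > 0 \<Longrightarrow> \<exists>h\<in>trig_closure. L2_norm cube_measure (\<lambda>x. f x - h x) < \<epsilon>"
  shows "f \<in> trig_closure"
  unfolding trig_closure_def
proof (intro CollectI conjI f allI impI)
  fix \<epsilon> :: real assume "\<epsilon> > 0"
  then obtain h where h: "h \<in> trig_closure" "L2_norm cube_measure (\<lambda>x. f x - h x) < \<epsilon> / 2"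
    using approx[of "\<epsilon> / 2"] by auto
  with \<open>\<epsilon> > 0\<close> obtain p where p: "p \<in> trig_polys" "L2_norm cube_measure (\<lambda>x. h x - p x) < \<epsilon> / 2"
    by (auto simp: trig_closure_def dest: spec[of _ "\<epsilon> / 2"])
  have "L2_norm cube_measure (\<lambda>x. f x - p x) < \<epsilon>"
    using L2_norm_diff_triangle[OF f trig_closure_L2[OF h(1)] trig_polys_L2[OF p(1)]] h(2) p(2) by linarith
  with p(1) show "\<exists>p\<in>trig_polys. L2_norm cube_measure (\<lambda>x. f x - p x) < \<epsilon>" by blast
qed

lemma trig_closure_dominated:
  assumes w: "integrable cube_measure (\<lambda>x. (w x)\<^sup>2)"
    and u: "\<And>k::nat. u k \<in> trig_closure" and v: "v \<in> borel_measurable cube_measure"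
    and bound: "\<And>k. AE x in cube_measure. norm (u k x) \<le> w x"
    and lim: "AE x in cube_measure. (\<lambda>k. u k x) \<longlonglongrightarrow> v x"
  shows "v \<in> trig_closure"
proof (rule trig_closure_closed)
  have um: "u k \<in> borel_measurable cube_measure" for k
    using trig_closure_L2[OF u] by (simp add: L2_def)
  show "v \<in> L2 cube_measure" by (rule L2_dominated_mem[OF w um v bound lim])
  fix \<epsilon> :: real assume "\<epsilon> > 0"
  with order_tendstoD(2)[OF L2_dominated_LIMSEQ[OF w um v bound lim]]
  obtain k where "L2_norm cube_measure (\<lambda>x. v x - u k x) < \<epsilon>" by (auto simp: eventually_sequentially)
  with u show "\<exists>h\<in>trig_closure. L2_norm cube_measure (\<lambda>x. v x - h x) < \<epsilon>" by blast
qed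

lemma trig_closure_add:
  assumes "f \<in> trig_closure" "g \<in> trig_closure"
  shows "(\<lambda>x. f x + g x) \<in> trig_closure"
  unfolding trig_closure_def
proof (intro CollectI conjI allI impI L2_add trig_closure_L2 assms)
  fix \<epsilon> :: real assume "\<epsilon> > 0"
  then obtain p q where p: "p \<in> trig_polys" "L2_norm cube_measure (\<lambda>x. f x - p x) < \<epsilon> / 2"
    and q: "q \<in> trig_polys" "L2_norm cube_measure (\<lambda>x. g x - q x) < \<epsilon> / 2"
    using assms by (auto simp: trig_closure_def dest!: spec[of _ "\<epsilon> / 2"])
  have "L2_norm cube_measure (\<lambda>x. (f x - p x) + (g x - q x)) < \<epsilon>"
    using L2_norm_triangle[OF L2_diff[OF trig_closure_L2[OF assms(1)] trig_polys_L2[OF p(1)]]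
        L2_diff[OF trig_closure_L2[OF assms(2)] trig_polys_L2[OF q(1)]]] p(2) q(2) by linarith
  then show "\<exists>p\<in>trig_polys. L2_norm cube_measure (\<lambda>x. f x + g x - p x) < \<epsilon>"
    by (intro bexI[OF _ trig_polys_add[OF p(1) q(1)]]) (simp add: algebra_simps)
qed

lemma trig_closure_cmult:
  assumes "f \<in> trig_closure"
  shows "(\<lambda>x. a * f x) \<in> trig_closure"
  unfolding trig_closure_def
proof (intro CollectI conjI allI impI L2_cmult trig_closure_L2 assms)
  fix \<epsilon> :: real assume e: "\<epsilon> > 0"
  have "\<epsilon> / (norm a + 1) > 0" using e by (intro divide_pos_pos) (auto simp: add_nonneg_pos)
  then obtain p where p: "p \<in> trig_polys" "L2_norm cube_measure (\<lambda>x. f x - p x) < \<epsilon> / (norm a + 1)"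
    using assms by (auto simp: trig_closure_def)
  have "L2_norm cube_measure (\<lambda>x. a * (f x - p x)) \<le> (norm a + 1) * L2_norm cube_measure (\<lambda>x. f x - p x)"
    unfolding L2_norm_cmult by (intro mult_right_mono) auto
  also have "\<dots> < \<epsilon>"
    using p(2) by (simp add: pos_less_divide_eq add_nonneg_pos mult.commute)
  finally show "\<exists>p\<in>trig_polys. L2_norm cube_measure (\<lambda>x. a * f x - p x) < \<epsilon>"
    by (intro bexI[OF _ trig_polys_cmult[OF p(1)]]) (simp add: algebra_simps)
qed

lemma trig_closure_sum: "(\<And>i. i \<in> I \<Longrightarrow> f i \<in> trig_closure) \<Longrightarrow> (\<lambda>x. \<Sum>i\<in>I. f i x) \<in> trig_closure"
  by (induction I rule: infinite_finite_induct)
     (auto intro: trig_closure_add trig_polys_closure[OF trig_polys_zero])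

text \<open>For \<open>a\<close> inside the interval the expression is \<open>2 cos (x / 2) sin ((x - a) / 2)\<close>, whose first factor is
  positive. Half-lines are thus cut out by the sign of a trigonometric polynomial, and the identification of the
  endpoints of the interval never has to be discussed.\<close>

lemma interval_trig_sign:
  fixes a :: real
  shows "\<exists>A B C. \<forall>x. - pi < x \<longrightarrow> x < pi \<longrightarrow> (a < x \<longleftrightarrow> 0 < A + B * cos x + C * sin x)"
proof -
  consider "a \<le> - pi" | "pi \<le> a" | "- pi < a" "a < pi" by linarith
  then show ?thesis
  proof cases
    case 1
    then show ?thesis by (intro exI[of _ 1] exI[of _ 0]) auto
  next
    case 2
    then show ?thesis by (intro exI[of _ 0]) auto
  next
    case 3
    show ?thesis
    proof (intro exI allI impI)
      fix x :: real assume x: "- pi < x" "x < pi"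
      define y where "y = x / 2"
      have "- sin (a / 2) + - sin (a / 2) * cos x + cos (a / 2) * sin x = 2 * cos y * sin (y - a / 2)"
      proof -
        have double: "cos x = 2 * (cos y)\<^sup>2 - 1" "sin x = 2 * sin y * cos y"
          using cos_double_cos[of y] sin_double[of y] by (auto simp: y_def)
        show ?thesis unfolding double by (simp add: sin_diff power2_eq_square algebra_simps)
      qed
      moreover have "cos y > 0" using x by (intro cos_gt_zero_pi) (auto simp: y_def)
      moreover have "a < x \<longleftrightarrow> 0 < sin (y - a / 2)"
      proof
        assume "a < x"
        then show "0 < sin (y - a / 2)" using x 3 by (intro sin_gt_zero) (auto simp: y_def)
      next
        assume pos: "0 < sin (y - a / 2)"
        show "a < x"
        proof (rule ccontr)
          assume "\<not> a < x"
          then have "0 \<le> sin (a / 2 - y)" using x 3 by (intro sin_ge_zero) (auto simp: y_def)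
          with pos show False using sin_minus[of "a / 2 - y"] by simp
        qed
      qed
      ultimately show "a < x \<longleftrightarrow> 0 < - sin (a / 2) + - sin (a / 2) * cos x + cos (a / 2) * sin x"
        by (simp add: zero_less_mult_iff)
    qed
  qed
qed

text \<open>Weierstrass approximation of the continuous functions \<open>min 1 (max 0 ((k + 1) y))\<close>, which increase to
  the indicator of the positive half-line.\<close>

lemma polynomials_approach_step:
  fixes M :: real
  obtains q :: "nat \<Rightarrow> real \<Rightarrow> real" where "\<And>k. real_polynomial_function (q k)"
    "\<And>k y. \<bar>y\<bar> \<le> M \<Longrightarrow> \<bar>q k y\<bar> \<le> 2"
    "\<And>y. \<bar>y\<bar> \<le> M \<Longrightarrow> (\<lambda>k. q k y) \<longlonglongrightarrow> indicator {0<..} y"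
proof -
  define \<phi> where "\<phi> k y = min 1 (max 0 (real (Suc k) * y))" for k y
  have "\<exists>q. real_polynomial_function q \<and> (\<forall>y\<in>{-M..M}. \<bar>\<phi> k y - q y\<bar> < 1 / real (Suc k))" for k
    by (rule Stone_Weierstrass_real_polynomial_function[of "{-M..M}" "\<phi> k" "1 / real (Suc k)"])
       (auto simp: \<phi>_def intro!: continuous_intros)
  then obtain q where q: "\<And>k. real_polynomial_function (q k)"
    and approx: "\<And>k y. y \<in> {-M..M} \<Longrightarrow> \<bar>\<phi> k y - q k y\<bar> < 1 / real (Suc k)" by metis
  show thesis
  proof (rule that[of q])
    fix k y assume y: "\<bar>y\<bar> \<le> M"
    have "1 / real (Suc k) \<le> 1" "\<bar>\<phi> k y\<bar> \<le> 1" by (auto simp: \<phi>_def)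
    moreover have "\<bar>\<phi> k y - q k y\<bar> < 1 / real (Suc k)" using y by (intro approx) auto
    ultimately show "\<bar>q k y\<bar> \<le> 2" by linarith
  next
    fix y assume y: "\<bar>y\<bar> \<le> M"
    have "(\<lambda>k. \<phi> k y - q k y) \<longlonglongrightarrow> 0"
    proof (rule Lim_null_comparison)
      show "\<forall>\<^sub>F k in sequentially. norm (\<phi> k y - q k y) \<le> 1 / real (Suc k)"
        unfolding real_norm_def using y by (intro always_eventually allI less_imp_le approx) auto
    qed (rule LIMSEQ_Suc[OF lim_1_over_n])
    moreover have "(\<lambda>k. \<phi> k y) \<longlonglongrightarrow> indicator {0<..} y"
    proof (rule tendsto_eventually)
      show "\<forall>\<^sub>F k in sequentially. \<phi> k y = indicator {0<..} y"
      proof (cases "y > 0")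
        case True
        then obtain N where N: "1 / y \<le> real N" using real_arch_simple by blast
        have "1 \<le> real (Suc k) * y" if "k \<ge> N" for k
        proof -
          have "1 \<le> real N * y" using N True by (simp add: field_simps)
          also have "\<dots> \<le> real (Suc k) * y" using that True by (intro mult_right_mono) auto
          finally show ?thesis .
        qed
        with True show ?thesis by (auto simp: eventually_sequentially \<phi>_def indicator_def intro!: exI[of _ N])
      next
        case False
        then have "real (Suc k) * y \<le> 0" for k by (simp add: mult_nonneg_nonpos)
        with False show ?thesis by (auto simp: \<phi>_def indicator_def)
      qed
    qed
    ultimately have "(\<lambda>k. \<phi> k y - (\<phi> k y - q k y)) \<longlonglongrightarrow> indicator {0<..} y - 0"
      by (intro tendsto_diff)
    then show "(\<lambda>k. q k y) \<longlonglongrightarrow> indicator {0<..} y" by simp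
  qed (rule q)
qed

lemma AE_cube_interior: "AE x in (cube_measure :: (real^'d) measure). \<forall>i. - pi < x $ i \<and> x $ i < pi"
proof -
  let ?N = "cbox (\<chi> i. - pi) (\<chi> i. pi) - box (\<chi> i. - pi) (\<chi> i. pi) :: (real^'d) set"
  have "?N \<in> null_sets lebesgue"
    using negligible_frontier_interval negligible_iff_null_sets by blast
  then have "?N \<in> null_sets lborel"
    by (subst (asm) null_sets_completion_iff) auto
  then have "AE x in lborel. x \<notin> ?N" by (rule AE_not_in)
  then show ?thesis
    by (subst AE_restrict_space_iff) (auto simp: cube_eq_cbox mem_box_cart elim!: eventually_mono)
qed

text \<open>Each coordinate condition \<open>a $ i < x $ i\<close> is the positivity of a trigonometric polynomial, and polynomials
  approaching the step function turn positivity into a bounded limit of trigonometric polynomials.\<close>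

lemma quadrant_in_trig_closure:
  "(indicator {x. \<forall>i. a $ i < x $ i} :: real^'d \<Rightarrow> complex) \<in> trig_closure"
proof -
  from interval_trig_sign have "\<forall>i. \<exists>A B C. \<forall>x. - pi < x \<longrightarrow> x < pi \<longrightarrow> (a $ i < x \<longleftrightarrow> 0 < A + B * cos x + C * sin x)"
    by blast
  then obtain A B C where sgn: "\<And>i x. - pi < x \<Longrightarrow> x < pi \<Longrightarrow> (a $ i < x \<longleftrightarrow> 0 < A i + B i * cos x + C i * sin x)"
    by metis
  define p where "p i x = A i + B i * cos (x $ i) + C i * sin (x $ i)" for i and x :: "real^'d"
  define M where "M = (\<Sum>i\<in>UNIV. \<bar>A i\<bar> + \<bar>B i\<bar> + \<bar>C i\<bar>)"
  have pM: "\<bar>p i x\<bar> \<le> M" for i x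
  proof -
    have "\<bar>B i * cos (x $ i)\<bar> \<le> \<bar>B i\<bar>" "\<bar>C i * sin (x $ i)\<bar> \<le> \<bar>C i\<bar>"
      by (auto simp: abs_mult intro!: mult_left_le)
    then have "\<bar>p i x\<bar> \<le> \<bar>A i\<bar> + \<bar>B i\<bar> + \<bar>C i\<bar>" unfolding p_def by linarith
    also have "\<dots> \<le> M" unfolding M_def by (rule member_le_sum) auto
    finally show ?thesis .
  qed
  obtain q where q: "\<And>k. real_polynomial_function (q k)" "\<And>k y. \<bar>y\<bar> \<le> M \<Longrightarrow> \<bar>q k y\<bar> \<le> 2"
    "\<And>y. \<bar>y\<bar> \<le> M \<Longrightarrow> (\<lambda>k::nat. q k y) \<longlonglongrightarrow> indicator {0<..} y"
    by (rule polynomials_approach_step[of M], rule that)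
  define u where "u k x = (\<Prod>i\<in>UNIV. complex_of_real (q k (p i x)))" for k x
  have u_trig: "u k \<in> trig_closure" for k
  proof -
    have "(\<lambda>x. complex_of_real (p i x)) \<in> trig_polys" for i
      unfolding p_def by (rule trig_polys_cos_sin)
    then have "(\<lambda>x. complex_of_real (q k (p i x))) \<in> trig_polys" for i
      by (rule trig_polys_compose_polynomial[OF _ q(1)])
    then show ?thesis
      unfolding u_def[abs_def] by (intro trig_polys_closure trig_polys_prod)
  qed
  show ?thesis
  proof (rule trig_closure_dominated[where w = "\<lambda>_. 2 ^ CARD('d)" and u = u, OF _ u_trig])
    show "integrable cube_measure (\<lambda>x::real^'d. (2 ^ CARD('d))\<^sup>2 :: real)"
      by (rule finite_measure.integrable_const[OF finite_measure_cube])
    show "indicator {x. \<forall>i. a $ i < x $ i} \<in> borel_measurable cube_measure" by measurable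
    show "AE x in cube_measure. norm (u k x) \<le> 2 ^ CARD('d)" for k
    proof (rule AE_I2)
      fix x
      have "norm (u k x) \<le> (\<Prod>i\<in>(UNIV::'d set). 2)"
        unfolding u_def prod_norm[symmetric] by (intro prod_mono) (auto intro!: q(2) pM)
      then show "norm (u k x) \<le> 2 ^ CARD('d)" by simp
    qed
    show "AE x in cube_measure. (\<lambda>k. u k x) \<longlonglongrightarrow> indicator {x. \<forall>i. a $ i < x $ i} x"
      using AE_cube_interior
    proof eventually_elim
      case (elim x)
      have "(\<lambda>k. u k x) \<longlonglongrightarrow> (\<Prod>i\<in>UNIV. complex_of_real (indicator {0<..} (p i x)))"
        unfolding u_def by (intro tendsto_prod tendsto_of_real q(3) pM)
      also have "(\<Prod>i\<in>UNIV. complex_of_real (indicator {0<..} (p i x))) = (\<Prod>i\<in>UNIV. indicator {x. a $ i < x $ i} x)"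
        using elim by (intro prod.cong refl) (auto simp: indicator_def sgn p_def)
      also have "\<dots> = indicator {x. \<forall>i. a $ i < x $ i} x"
        by (auto simp: indicator_def)
      finally show ?case .
    qed
  qed
qed

text \<open>The sets whose indicator is a limit of trigonometric polynomials form a Dynkin system, and the
  quadrants are a generator of the Borel sets that is stable under intersection.\<close>

lemma indicator_in_trig_closure:
  assumes "S \<in> sets (borel :: (real^'d) measure)"
  shows "(indicator S :: real^'d \<Rightarrow> complex) \<in> trig_closure"
proof -
  let ?G = "range (\<lambda>a::real^'d. {x. \<forall>i. a $ i < x $ i})"
  have "Int_stable ?G"
  proof (rule Int_stableI_image)
    fix a b :: "real^'d"
    show "\<exists>c\<in>UNIV. {x. \<forall>i. a $ i < x $ i} \<inter> {x. \<forall>i. b $ i < x $ i} = {x. \<forall>i. c $ i < x $ i}"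
      by (rule bexI[of _ "\<chi> i. max (a $ i) (b $ i)"]) auto
  qed
  moreover have "?G \<subseteq> Pow UNIV" by simp
  moreover have sets_eq: "sets (borel :: (real^'d) measure) = sigma_sets UNIV ?G"
  proof -
    have "(borel :: (real^'d) measure) = sigma UNIV ?G"
      using borel_eq_greaterThan[where ?'a = "real^'d"]
      by (simp add: eucl_less_def Basis_vec_def cart_eq_inner_axis)
    then show ?thesis
      by (rule ssubst) (simp add: sets_measure_of)
  qed
  then have "S \<in> sigma_sets UNIV ?G" using assms by blast
  ultimately show ?thesis
  proof (induction rule: sigma_sets_induct_disjoint)
    case (basic A)
    then show ?case using quadrant_in_trig_closure by auto
  next
    case empty
    have "indicator {} = (\<lambda>x::real^'d. 0 :: complex)" by auto
    then show ?case by (simp only: trig_polys_closure[OF trig_polys_zero])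
  next
    case (compl A)
    have eq: "indicator (UNIV - A) = (\<lambda>x. 1 + (- 1) * (indicator A x :: complex))"
      by (auto simp: indicator_def)
    show ?case
      unfolding eq by (intro trig_closure_add trig_closure_cmult trig_polys_closure[OF trig_polys_const] compl.IH)
  next
    case (union A)
    have meas: "A i \<in> sets borel" for i
      using union.hyps(2) unfolding sets_eq by auto
    have partial: "(\<Sum>i<k. indicator (A i) x :: complex) = indicator (\<Union>i<k. A i) x" for k x
      using union.hyps(1) by (subst indicator_UN_disjoint) (auto simp: disjoint_family_on_def)
    show ?case
    proof (rule trig_closure_dominated[where w = "\<lambda>_. 1" and u = "\<lambda>k x. \<Sum>i<k. indicator (A i) x"])
      show "integrable cube_measure (\<lambda>x::real^'d. 1\<^sup>2 :: real)"
        by (rule finite_measure.integrable_const[OF finite_measure_cube])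
      show "(\<lambda>x. \<Sum>i<k. indicator (A i) x) \<in> trig_closure" for k
        by (intro trig_closure_sum union.IH)
      show "indicator (\<Union>i. A i) \<in> borel_measurable cube_measure"
        using meas by measurable
      show "AE x in cube_measure. norm (\<Sum>i<k. indicator (A i) x :: complex) \<le> 1" for k
        unfolding partial by (rule AE_I2) (simp add: indicator_def)
      show "AE x in cube_measure. (\<lambda>k. \<Sum>i<k. indicator (A i) x :: complex) \<longlonglongrightarrow> indicator (\<Union>i. A i) x"
        unfolding partial by (intro AE_I2 LIMSEQ_indicator_UN)
    qed
  qed
qed

text \<open>Approximation by simple functions reduces the claim to indicators.\<close>

lemma trig_polys_dense:
  fixes g :: "real^'d \<Rightarrow> complex"
  assumes g: "g \<in> L2 cube_measure"
  shows "g \<in> trig_closure"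
proof -
  have g_m: "g \<in> borel_measurable cube_measure" using g by (simp add: L2_def)
  from borel_measurable_implies_sequence_metric[OF g_m, of 0] obtain F where
    F: "\<And>k::nat. simple_function cube_measure (F k)"
    and lim: "\<And>x. x \<in> cube \<Longrightarrow> (\<lambda>k. F k x) \<longlonglongrightarrow> g x"
    and bound: "\<And>k x. x \<in> cube \<Longrightarrow> norm (F k x) \<le> 2 * norm (g x)"
    by (auto simp: Ball_def)
  define u where "u k x = (\<Sum>y\<in>F k ` cube. y * indicator (F k -` {y} \<inter> cube) x)" for k x
  have u_eq: "u k x = F k x" if x: "x \<in> cube" for k x
  proof -
    have fin: "finite (F k ` cube)" using simple_functionD(1)[OF F[of k]] by simp
    have "u k x = (\<Sum>y\<in>F k ` cube. if y = F k x then y else 0)"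
      unfolding u_def using x by (intro sum.cong) (auto simp: indicator_def)
    also have "\<dots> = F k x" using x fin by simp
    finally show ?thesis .
  qed
  have u_closure: "u k \<in> trig_closure" for k
    unfolding u_def
  proof (intro trig_closure_sum trig_closure_cmult indicator_in_trig_closure)
    fix y
    have "F k -` {y} \<inter> cube \<in> sets cube_measure"
      using simple_functionD(2)[OF F[of k], of "{y}"] by simp
    then show "F k -` {y} \<inter> cube \<in> sets borel"
      by (simp add: sets_restrict_space_iff)
  qed
  show ?thesis
  proof (rule trig_closure_dominated[where w = "\<lambda>x. 2 * norm (g x)" and u = u, OF _ u_closure g_m])
    show "integrable cube_measure (\<lambda>x. (2 * norm (g x))\<^sup>2)"
      using L2_integrable_square[OF g] by (simp add: power_mult_distrib)
    show "AE x in cube_measure. norm (u k x) \<le> 2 * norm (g x)" for k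
      by (rule AE_I2) (simp add: u_eq bound)
    show "AE x in cube_measure. (\<lambda>k. u k x) \<longlonglongrightarrow> g x"
      by (rule AE_I2) (simp add: u_eq lim)
  qed
qed

section \<open>Polynomials times the interpolation kernel\<close>

lemma prod_sum_vec:
  fixes g :: "'d::finite \<Rightarrow> 'a \<Rightarrow> 'b::comm_semiring_1"
  assumes "finite S"
  shows "(\<Prod>i\<in>UNIV. \<Sum>a\<in>S. g i a) = (\<Sum>n\<in>{n::'a^'d. \<forall>i. n $ i \<in> S}. \<Prod>i\<in>UNIV. g i (n $ i))"
proof -
  have "(\<Prod>i\<in>UNIV. \<Sum>a\<in>S. g i a) = (\<Sum>f\<in>UNIV \<rightarrow>\<^sub>E S. \<Prod>i\<in>UNIV. g i (f i))"
    using assms by (subst prod_sum_PiE) auto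
  also have "\<dots> = (\<Sum>n\<in>{n::'a^'d. \<forall>i. n $ i \<in> S}. \<Prod>i\<in>UNIV. g i (n $ i))"
    by (rule sum.reindex_bij_witness[of _ vec_nth vec_lambda]) auto
  finally show ?thesis .
qed

lemma finite_vec_set:
  assumes "finite S"
  shows "finite {n::'a^'d. \<forall>i. n $ i \<in> S}"
proof (rule finite_imageD)
  show "finite (vec_nth ` {n::'a^'d. \<forall>i. n $ i \<in> S})"
    by (rule finite_subset[of _ "UNIV \<rightarrow>\<^sub>E S"]) (auto intro!: finite_PiE assms)
qed (auto simp: inj_on_def vec_eq_iff)

definition monomial :: "nat^'d \<Rightarrow> real^'d \<Rightarrow> complex" where
  "monomial k t = (\<Prod>i\<in>UNIV. of_real (t $ i) ^ (k $ i))"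

lemma poly_coord_degree_le_iff:
  "poly_coord_degree_le m p \<longleftrightarrow> (\<exists>c. p = (\<lambda>t. \<Sum>k\<in>{k. \<forall>i. k $ i \<in> {..m}}. c k * monomial k t))"
  (is "_ \<longleftrightarrow> (\<exists>c. p = (\<lambda>t. \<Sum>k\<in>?K. c k * monomial k t))")
proof
  assume "poly_coord_degree_le m p"
  then obtain c where c: "finite {k. c k \<noteq> 0}" "\<And>k. c k \<noteq> 0 \<Longrightarrow> \<forall>i. k $ i \<le> m"
    "p = (\<lambda>t. \<Sum>k | c k \<noteq> 0. c k * monomial k t)"
    by (auto simp: poly_coord_degree_le_def monomial_def)
  have "p = (\<lambda>t. \<Sum>k\<in>?K. c k * monomial k t)"
    unfolding c(3) using c(2) by (intro ext sum.mono_neutral_left finite_vec_set) auto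
  then show "\<exists>c. p = (\<lambda>t. \<Sum>k\<in>?K. c k * monomial k t)" by (intro exI[of _ c])
next
  assume "\<exists>c. p = (\<lambda>t. \<Sum>k\<in>?K. c k * monomial k t)"
  then obtain c where p: "p = (\<lambda>t. \<Sum>k\<in>?K. c k * monomial k t)" ..
  \<comment> \<open>Coefficients outside the degree range may be arbitrary and have to be cut off.\<close>
  define c' where "c' k = (if k \<in> ?K then c k else 0)" for k
  have sub: "{k. c' k \<noteq> 0} \<subseteq> ?K" by (auto simp: c'_def split: if_splits)
  have "p = (\<lambda>t. \<Sum>k | c' k \<noteq> 0. c' k * monomial k t)"
    unfolding p by (intro ext sum.mono_neutral_cong_right finite_vec_set sub) (auto simp: c'_def split: if_splits)
  moreover have "finite {k. c' k \<noteq> 0}" by (rule finite_subset[OF sub finite_vec_set[OF finite_atMost]])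
  ultimately show "poly_coord_degree_le m p"
    unfolding poly_coord_degree_le_def monomial_def[symmetric] using sub by (intro exI[of _ c']) auto
qed

lemma poly_coord_degree_le_add:
  assumes "poly_coord_degree_le m p" "poly_coord_degree_le m q"
  shows "poly_coord_degree_le m (\<lambda>t. p t + q t)"
proof -
  from assms obtain c d where "p = (\<lambda>t. \<Sum>k\<in>{k. \<forall>i. k $ i \<in> {..m}}. c k * monomial k t)"
    "q = (\<lambda>t. \<Sum>k\<in>{k. \<forall>i. k $ i \<in> {..m}}. d k * monomial k t)"
    unfolding poly_coord_degree_le_iff by blast
  then have "(\<lambda>t. p t + q t) = (\<lambda>t. \<Sum>k\<in>{k. \<forall>i. k $ i \<in> {..m}}. (c k + d k) * monomial k t)"
    by (simp add: sum.distrib distrib_right)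
  then show ?thesis unfolding poly_coord_degree_le_iff by (rule exI[of _ "\<lambda>k. c k + d k"])
qed

lemma poly_coord_degree_le_cmult:
  assumes "poly_coord_degree_le m p"
  shows "poly_coord_degree_le m (\<lambda>t. a * p t)"
proof -
  from assms obtain c where "p = (\<lambda>t. \<Sum>k\<in>{k. \<forall>i. k $ i \<in> {..m}}. c k * monomial k t)"
    unfolding poly_coord_degree_le_iff by blast
  then have "(\<lambda>t. a * p t) = (\<lambda>t. \<Sum>k\<in>{k. \<forall>i. k $ i \<in> {..m}}. (a * c k) * monomial k t)"
    by (simp add: sum_distrib_left mult.assoc)
  then show ?thesis unfolding poly_coord_degree_le_iff by (rule exI[of _ "\<lambda>k. a * c k"])
qed

lemma poly_coord_degree_le_sum:
  "(\<And>i. i \<in> I \<Longrightarrow> poly_coord_degree_le m (f i)) \<Longrightarrow> poly_coord_degree_le m (\<lambda>t. \<Sum>i\<in>I. f i t)"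
proof (induction I rule: infinite_finite_induct)
  case (insert x F)
  then show ?case by (auto intro: poly_coord_degree_le_add)
qed (auto simp: poly_coord_degree_le_iff intro!: exI[of _ "\<lambda>_. 0"])

lemma poly_coord_degree_le_prod:
  fixes q :: "'d::finite \<Rightarrow> real poly"
  assumes "\<And>i. degree (q i) \<le> m"
  shows "poly_coord_degree_le m (\<lambda>t::real^'d. of_real (\<Prod>i\<in>UNIV. poly (q i) (t $ i)))"
proof -
  have "complex_of_real (\<Prod>i\<in>UNIV. poly (q i) (t $ i)) =
      (\<Sum>k\<in>{k::nat^'d. \<forall>i. k $ i \<in> {..m}}. of_real (\<Prod>i\<in>UNIV. coeff (q i) (k $ i)) * monomial k t)" for t :: "real^'d"
  proof -
    have "poly (q i) (t $ i) = (\<Sum>e\<in>{..m}. coeff (q i) e * (t $ i) ^ e)" for i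
      unfolding poly_altdef using assms[of i]
      by (intro sum.mono_neutral_left) (auto simp: coeff_eq_0)
    then have "(\<Prod>i\<in>UNIV. poly (q i) (t $ i)) =
        (\<Sum>k\<in>{k::nat^'d. \<forall>i. k $ i \<in> {..m}}. \<Prod>i\<in>UNIV. coeff (q i) (k $ i) * (t $ i) ^ (k $ i))"
      by (simp only: prod_sum_vec[OF finite_atMost])
    then show ?thesis
      by (simp add: prod.distrib monomial_def)
  qed
  then show ?thesis unfolding poly_coord_degree_le_iff
    by (intro exI[of _ "\<lambda>k. of_real (\<Prod>i\<in>UNIV. coeff (q i) (k $ i))"] ext)
qed

definition nodes :: "nat \<Rightarrow> int set" where
  "nodes l = {- int l..int l}"

text \<open>Up to normalisation, the Lagrange basis polynomial of the node \<open>a\<close>.\<close>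

definition node_poly :: "nat \<Rightarrow> int \<Rightarrow> real poly" where
  "node_poly l a = (\<Prod>j\<in>nodes l - {a}. [:- of_int j, 1:])"

lemma finite_nodes [simp]: "finite (nodes l)"
  by (simp add: nodes_def)

lemma card_nodes: "card (nodes l) = Suc (2 * l)"
  by (simp add: nodes_def)

lemma poly_node_poly: "poly (node_poly l a) s = (\<Prod>j\<in>nodes l - {a}. s - of_int j)"
  by (simp add: node_poly_def poly_prod)

lemma degree_node_poly: "a \<in> nodes l \<Longrightarrow> degree (node_poly l a) \<le> 2 * l"
  using degree_prod_sum_le[of "nodes l - {a}" "\<lambda>j. [:- real_of_int j, 1:]"]
  by (simp add: node_poly_def card_nodes)

lemma node_poly_other: "b \<in> nodes l \<Longrightarrow> b \<noteq> a \<Longrightarrow> poly (node_poly l a) (of_int b) = 0"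
  by (auto simp: poly_node_poly)

lemma node_poly_self: "poly (node_poly l a) (of_int a) \<noteq> 0"
  by (auto simp: poly_node_poly)

text \<open>Both sides are polynomials of degree at most \<open>2 l\<close> that agree at the \<open>2 l + 1\<close> nodes.\<close>

lemma Lagrange_power:
  assumes "k \<le> 2 * l"
  shows "s ^ k = (\<Sum>a\<in>nodes l. of_int a ^ k / poly (node_poly l a) (of_int a) * poly (node_poly l a) s)"
proof -
  define p where "p = monom 1 k - (\<Sum>a\<in>nodes l. smult (of_int a ^ k / poly (node_poly l a) (of_int a)) (node_poly l a))"
  have "degree p \<le> 2 * l"
    unfolding p_def using assms
    by (intro degree_diff_le degree_sum_le) (auto intro: order_trans[OF degree_monom_le] order_trans[OF degree_smult_le] degree_node_poly)
  have roots: "poly p (of_int b) = 0" if b: "b \<in> nodes l" for b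
  proof -
    have "(\<Sum>a\<in>nodes l. of_int a ^ k / poly (node_poly l a) (of_int a) * poly (node_poly l a) (of_int b)) =
        (\<Sum>a\<in>nodes l. if a = b then of_int b ^ k else 0)"
      using b by (intro sum.cong refl) (auto simp: node_poly_other node_poly_self)
    also have "\<dots> = of_int b ^ k" using b by simp
    finally show ?thesis by (simp add: p_def poly_monom poly_sum)
  qed
  have "p = 0"
  proof (rule ccontr)
    assume "p \<noteq> 0"
    have "card (real_of_int ` nodes l) \<le> card {x. poly p x = 0}"
      using roots by (intro card_mono poly_roots_finite \<open>p \<noteq> 0\<close>) auto
    also have "\<dots> \<le> degree p" by (rule card_poly_roots_bound[OF \<open>p \<noteq> 0\<close>])
    finally show False
      using \<open>degree p \<le> 2 * l\<close> by (simp add: card_image inj_on_def card_nodes)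
  qed
  then have "poly p s = 0" by simp
  then show ?thesis by (simp add: p_def poly_monom poly_sum)
qed

lemma sine_product_nodes:
  "s * (\<Prod>k=1..l. 1 - s\<^sup>2 / (real k)\<^sup>2) = (\<Prod>k=1..l. - 1 / (real k)\<^sup>2) * (\<Prod>j\<in>nodes l. s - of_int j)"
proof (induction l)
  case 0
  then show ?case by (simp add: nodes_def)
next
  case (Suc l)
  have "nodes (Suc l) = insert (int (Suc l)) (insert (- int (Suc l)) (nodes l))"
    by (auto simp: nodes_def)
  then have "(\<Prod>j\<in>nodes (Suc l). s - of_int j) = (s - real (Suc l)) * ((s + real (Suc l)) * (\<Prod>j\<in>nodes l. s - of_int j))"
    by (simp add: nodes_def)
  moreover have "1 - s\<^sup>2 / r\<^sup>2 = - 1 / r\<^sup>2 * ((s - r) * (s + r))" if "r \<noteq> 0" for r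
    using that by (simp add: field_simps power2_eq_square)
  from this[of "real (Suc l)"] have "1 - s\<^sup>2 / (real (Suc l))\<^sup>2 = - 1 / (real (Suc l))\<^sup>2 * ((s - real (Suc l)) * (s + real (Suc l)))"
    by simp
  moreover have "s * (\<Prod>k=1..Suc l. 1 - s\<^sup>2 / (real k)\<^sup>2) =
      (s * (\<Prod>k=1..l. 1 - s\<^sup>2 / (real k)\<^sup>2)) * (1 - s\<^sup>2 / (real (Suc l))\<^sup>2)"
    by simp
  moreover have "(\<Prod>k=1..Suc l. - 1 / (real k)\<^sup>2) = (\<Prod>k=1..l. - 1 / (real k)\<^sup>2) * (- 1 / (real (Suc l))\<^sup>2)"
    by simp
  ultimately show ?case using Suc by (simp only: mult_ac)
qed

text \<open>By periodicity of the sine, \<open>sinc (pi (s - a))\<close> is up to sign \<open>s sinc (pi s) / (s - a)\<close>. The product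
  formula writes \<open>s sinc (pi s)\<close> as a multiple of the product of all \<open>s - j\<close> over the nodes \<open>j\<close> times \<open>tail_prod l s\<close>,
  and the division removes the factor of the node \<open>a\<close>. The value at \<open>s = a\<close> follows by continuity.\<close>

lemma sinc_shift_eq_node_poly:
  assumes a: "a \<in> nodes l"
  obtains \<gamma> where "\<gamma> \<noteq> 0" "\<And>s. sinc (pi * (s - of_int a)) = \<gamma> * poly (node_poly l a) s * tail_prod l s"
proof
  define C where "C = (\<Prod>k=1..l. - 1 / (real k)\<^sup>2)"
  have sin0: "sin (pi * of_int a) = 0"
    using sin_zero_iff_int2 by (metis mult.commute)
  then have "cos (pi * of_int a) \<noteq> 0" using sin_cos_squared_add[of "pi * of_int a"] by auto
  moreover have "C \<noteq> 0" by (simp add: C_def)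
  ultimately show "cos (pi * of_int a) * C \<noteq> 0" by simp
  have off: "sinc (pi * (s - of_int a)) = cos (pi * of_int a) * C * poly (node_poly l a) s * tail_prod l s"
    if s: "s \<noteq> of_int a" for s
  proof -
    have "sin (pi * s) = pi * s * sinc (pi * s)" by simp
    also have "\<dots> = pi * (s * (\<Prod>k=1..l. 1 - s\<^sup>2 / (real k)\<^sup>2)) * tail_prod l s"
      by (simp only: sinc_eq_tail_prod[of s l] mult.assoc)
    also have "s * (\<Prod>k=1..l. 1 - s\<^sup>2 / (real k)\<^sup>2) = C * ((s - of_int a) * poly (node_poly l a) s)"
      unfolding sine_product_nodes C_def poly_node_poly using a by (subst prod.remove[of "nodes l" a]) auto
    finally have "sin (pi * s) = pi * (C * ((s - of_int a) * poly (node_poly l a) s)) * tail_prod l s" .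
    moreover have "sin (pi * (s - of_int a)) = sin (pi * s) * cos (pi * of_int a)"
      by (simp add: right_diff_distrib sin_diff sin0)
    ultimately show ?thesis using s by (simp add: field_simps)
  qed
  show "sinc (pi * (s - of_int a)) = cos (pi * of_int a) * C * poly (node_poly l a) s * tail_prod l s" for s
  proof (cases "s = of_int a")
    case True
    have "isCont (\<lambda>s. sinc (pi * (s - of_int a))) s"
      by (rule isCont_o2[OF _ isCont_sinc]) (intro continuous_intros)
    then have "((\<lambda>s. sinc (pi * (s - of_int a))) \<longlongrightarrow> sinc (pi * (s - of_int a))) (at s)"
      by (simp add: isCont_def)
    moreover have "\<forall>\<^sub>F x in at s. sinc (pi * (x - of_int a)) = cos (pi * of_int a) * C * poly (node_poly l a) x * tail_prod l x"
      using off True by (auto simp: eventually_at_filter)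
    ultimately have "((\<lambda>x. cos (pi * of_int a) * C * poly (node_poly l a) x * tail_prod l x) \<longlongrightarrow> sinc (pi * (s - of_int a))) (at s)"
      by (rule Lim_transform_eventually)
    moreover have "isCont (tail_prod l) s"
      using continuous_on_tail_prod by (simp add: continuous_on_eq_continuous_at)
    then have "((\<lambda>x. cos (pi * of_int a) * C * poly (node_poly l a) x * tail_prod l x) \<longlongrightarrow>
        cos (pi * of_int a) * C * poly (node_poly l a) s * tail_prod l s) (at s)"
      unfolding isCont_def by (intro tendsto_intros) auto
    ultimately show ?thesis by (rule LIM_unique)
  qed (rule off)
qed

definition Lagrange :: "nat \<Rightarrow> int^'d \<Rightarrow> real^'d \<Rightarrow> real" where
  "Lagrange l n t = (\<Prod>i\<in>UNIV. poly (node_poly l (n $ i)) (t $ i))"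

abbreviation int_vec :: "int^'d \<Rightarrow> real^'d" where
  "int_vec n \<equiv> \<chi> i. of_int (n $ i)"

lemma index_cube_nodes: "index_cube l = {n. \<forall>i. n $ i \<in> nodes l}"
  by (simp add: index_cube_def nodes_def)

lemma poly_coord_degree_Lagrange:
  "n \<in> index_cube l \<Longrightarrow> poly_coord_degree_le (2 * l) (\<lambda>t. of_real (Lagrange l n t))"
  unfolding Lagrange_def by (rule poly_coord_degree_le_prod) (auto simp: index_cube_nodes intro: degree_node_poly)

text \<open>A monomial is a product of powers of the coordinates; expanding the product of their
  one-dimensional interpolation formulas gives the formula on the grid.\<close>

lemma Lagrange_interpolation:
  fixes p :: "real^'d \<Rightarrow> complex"
  assumes "poly_coord_degree_le (2 * l) p"
  shows "p t = (\<Sum>n\<in>index_cube l. p (int_vec n) / of_real (Lagrange l n (int_vec n)) * of_real (Lagrange l n t))"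
proof -
  let ?\<Lambda> = "\<lambda>n. of_real (Lagrange l n t) / of_real (Lagrange l n (int_vec n)) :: complex"
  from assms obtain c where p: "p = (\<lambda>t. \<Sum>k\<in>{k. \<forall>i. k $ i \<in> {..2 * l}}. c k * monomial k t)"
    unfolding poly_coord_degree_le_iff by blast
  have mono: "monomial k t = (\<Sum>n\<in>index_cube l. monomial k (int_vec n) * ?\<Lambda> n)"
    if k: "k \<in> {k. \<forall>i. k $ i \<in> {..2 * l}}" for k
  proof -
    have "(t $ i) ^ (k $ i) = (\<Sum>a\<in>nodes l. of_int a ^ (k $ i) / poly (node_poly l a) (of_int a) * poly (node_poly l a) (t $ i))" for i
      using k by (intro Lagrange_power) auto
    then have "(\<Prod>i\<in>UNIV. (t $ i) ^ (k $ i)) = (\<Sum>n\<in>index_cube l. \<Prod>i\<in>UNIV.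
        of_int (n $ i) ^ (k $ i) / poly (node_poly l (n $ i)) (of_int (n $ i)) * poly (node_poly l (n $ i)) (t $ i))"
      by (simp only: prod_sum_vec[OF finite_nodes] index_cube_nodes)
    also have "\<dots> = (\<Sum>n\<in>index_cube l. (\<Prod>i\<in>UNIV. of_int (n $ i) ^ (k $ i)) *
        (Lagrange l n t / Lagrange l n (int_vec n)))"
      by (simp add: prod.distrib prod_dividef Lagrange_def)
    finally have "complex_of_real (\<Prod>i\<in>UNIV. (t $ i) ^ (k $ i)) = of_real (\<Sum>n\<in>index_cube l. (\<Prod>i\<in>UNIV. of_int (n $ i) ^ (k $ i)) *
        (Lagrange l n t / Lagrange l n (int_vec n)))" by simp
    then show ?thesis by (simp add: monomial_def)
  qed
  have "p t = (\<Sum>k\<in>{k. \<forall>i. k $ i \<in> {..2 * l}}. \<Sum>n\<in>index_cube l. c k * monomial k (int_vec n) * ?\<Lambda> n)"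
    unfolding p by (intro sum.cong refl) (simp only: mono sum_distrib_left mult.assoc)
  also have "\<dots> = (\<Sum>n\<in>index_cube l. p (int_vec n) * ?\<Lambda> n)"
    unfolding p by (subst sum.swap) (simp only: sum_distrib_right)
  finally show ?thesis by simp
qed

lemma FT_basis_expo: "FT (basis_expo n) s = of_real (SINC (pi *\<^sub>R (s - int_vec n)))"
proof -
  have "SINC (pi *\<^sub>R (int_vec n - s)) = SINC (pi *\<^sub>R (s - int_vec n))"
    unfolding SINC_def
  proof (rule prod.cong[OF refl])
    fix i
    have even: "sinc (- x) = sinc x" for x by simp
    have "(pi *\<^sub>R (int_vec n - s)) $ i = - ((pi *\<^sub>R (s - int_vec n)) $ i)"
      by (simp add: algebra_simps)
    then show "sinc ((pi *\<^sub>R (int_vec n - s)) $ i) = sinc ((pi *\<^sub>R (s - int_vec n)) $ i)"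
      by (simp only: even)
  qed
  then show ?thesis by (simp add: FT_def basis_expo_def expo_inner)
qed

lemma FT_basis_expo_eq_Lagrange:
  fixes n :: "int^'d"
  assumes "n \<in> index_cube l"
  shows "\<exists>\<gamma>. \<gamma> \<noteq> 0 \<and> (\<forall>s. FT (basis_expo n) s = \<gamma> * of_real (Lagrange l n s) * of_real (SINC_over_Q l s))"
proof -
  have "\<forall>i. \<exists>\<gamma>. \<gamma> \<noteq> 0 \<and> (\<forall>s. sinc (pi * (s - of_int (n $ i))) = \<gamma> * poly (node_poly l (n $ i)) s * tail_prod l s)"
  proof
    fix i
    have "n $ i \<in> nodes l" using assms by (simp add: index_cube_nodes)
    from sinc_shift_eq_node_poly[OF this]
    show "\<exists>\<gamma>. \<gamma> \<noteq> 0 \<and> (\<forall>s. sinc (pi * (s - of_int (n $ i))) = \<gamma> * poly (node_poly l (n $ i)) s * tail_prod l s)"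
      by metis
  qed
  then obtain \<gamma> where \<gamma>: "\<And>i. \<gamma> i \<noteq> 0"
    "\<And>i s. sinc (pi * (s - of_int (n $ i))) = \<gamma> i * poly (node_poly l (n $ i)) s * tail_prod l s"
    by metis
  have "FT (basis_expo n) s = of_real (\<Prod>i\<in>UNIV. \<gamma> i) * of_real (Lagrange l n s) * of_real (SINC_over_Q l s)" for s
  proof -
    have "SINC (pi *\<^sub>R (s - int_vec n)) = (\<Prod>i\<in>UNIV. sinc (pi * (s $ i - of_int (n $ i))))"
      unfolding SINC_def by (intro prod.cong refl) (simp only: vector_scaleR_component real_scaleR_def vector_minus_component vec_lambda_beta)
    also have "\<dots> = (\<Prod>i\<in>UNIV. \<gamma> i) * Lagrange l n s * SINC_over_Q l s"
      by (simp only: \<gamma>(2) prod.distrib Lagrange_def SINC_over_Q_eq)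
    finally show ?thesis by (simp only: FT_basis_expo of_real_mult)
  qed
  moreover have "complex_of_real (\<Prod>i\<in>UNIV. \<gamma> i) \<noteq> 0" using \<gamma>(1) by simp
  ultimately show ?thesis by blast
qed

lemma FT_sum_basis: "FT (\<lambda>x. \<Sum>n\<in>I. c n * basis_expo n x) s = (\<Sum>n\<in>I. c n * FT (basis_expo n) s)"
  unfolding FT_def by (rule L2_inner_sum_left) (auto intro: basis_expo_L2 expo_L2)

lemma coefficient_eq_inner:
  assumes "p = (\<lambda>x. \<Sum>n\<in>index_cube l. c n * basis_expo n x)" "m \<in> index_cube l"
  shows "c m = L2_inner cube_measure p (basis_expo m)"
proof -
  have "L2_inner cube_measure p (basis_expo m) = (\<Sum>n\<in>index_cube l. if n = m then c n else 0)"
    unfolding assms(1) by (subst L2_inner_sum_left) (auto simp: basis_expo_L2 basis_expo_orthonormal intro!: sum.cong)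
  also have "\<dots> = c m" using assms(2) by (simp add: finite_index_cube)
  finally show ?thesis ..
qed

text \<open>By linearity from \<open>FT_basis_expo_eq_Lagrange\<close>.\<close>

lemma FT_trig_space:
  fixes h :: "real^'d \<Rightarrow> complex"
  assumes "h \<in> trig_space l"
  shows "\<exists>p. poly_coord_degree_le (2 * l) p \<and> (\<forall>s. FT h s = p s * of_real (SINC_over_Q l s))"
proof -
  from assms obtain c where h: "h = (\<lambda>x. \<Sum>n\<in>index_cube l. c n * basis_expo n x)" by (rule trig_spaceE)
  from FT_basis_expo_eq_Lagrange[of _ l] obtain \<gamma> :: "int^'d \<Rightarrow> complex" where
    \<gamma>: "\<And>n s. n \<in> index_cube l \<Longrightarrow> FT (basis_expo n) s = \<gamma> n * of_real (Lagrange l n s) * of_real (SINC_over_Q l s)"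
    by metis
  have "FT h s = (\<Sum>n\<in>index_cube l. (c n * \<gamma> n) * of_real (Lagrange l n s)) * of_real (SINC_over_Q l s)" for s
    unfolding h FT_sum_basis sum_distrib_right by (intro sum.cong refl) (simp add: \<gamma>)
  moreover have "poly_coord_degree_le (2 * l) (\<lambda>s. \<Sum>n\<in>index_cube l. (c n * \<gamma> n) * of_real (Lagrange l n s))"
    by (intro poly_coord_degree_le_sum poly_coord_degree_le_cmult poly_coord_degree_Lagrange)
  ultimately show ?thesis by blast
qed

text \<open>The converse of \<open>FT_trig_space\<close>, by Lagrange interpolation at the integer points of the cube.
  The coefficients of \<open>h\<close> are nonzero multiples of the values of \<open>p\<close> at these points, so that \<open>h\<close> determines \<open>p\<close>
  even at the zeros of the kernel.\<close>

lemma polynomial_kernel_eq_FT: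
  fixes p :: "real^'d \<Rightarrow> complex"
  assumes "poly_coord_degree_le (2 * l) p"
  shows "\<exists>h\<in>trig_space l. (\<forall>s. FT h s = p s * of_real (SINC_over_Q l s)) \<and> (h = (\<lambda>x. 0) \<longrightarrow> p = (\<lambda>s. 0))"
proof -
  from FT_basis_expo_eq_Lagrange[of _ l] obtain \<gamma> :: "int^'d \<Rightarrow> complex" where \<gamma>0: "\<And>n. n \<in> index_cube l \<Longrightarrow> \<gamma> n \<noteq> 0"
    and \<gamma>: "\<And>n s. n \<in> index_cube l \<Longrightarrow> FT (basis_expo n) s = \<gamma> n * of_real (Lagrange l n s) * of_real (SINC_over_Q l s)"
    by metis
  define d where "d n = p (int_vec n) / of_real (Lagrange l n (int_vec n))" for n
  have p: "p s = (\<Sum>n\<in>index_cube l. d n * of_real (Lagrange l n s))" for s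
    unfolding d_def by (rule Lagrange_interpolation[OF assms])
  define h where "h = (\<lambda>x. \<Sum>n\<in>index_cube l. (d n / \<gamma> n) * basis_expo n x)"
  have "FT h s = p s * of_real (SINC_over_Q l s)" for s
    unfolding h_def FT_sum_basis p sum_distrib_right by (intro sum.cong refl) (simp add: \<gamma> \<gamma>0)
  moreover have "p = (\<lambda>s. 0)" if h0: "h = (\<lambda>x. 0)"
  proof -
    have "d n = 0" if n: "n \<in> index_cube l" for n
      using coefficient_eq_inner[OF h_def n] \<gamma>0[OF n] by (simp add: h0 L2_inner_def)
    then show ?thesis by (auto simp: p)
  qed
  moreover have "h \<in> trig_space l" unfolding h_def by (rule trig_spaceI[OF refl])
  ultimately show ?thesis by blast
qed

section \<open>The kernel is bounded by one and tends to one\<close>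

lemma tail_factor_bounds:
  assumes "\<bar>x\<bar> \<le> real (l + 1)"
  shows "0 \<le> x\<^sup>2 / (real (k + l + 1))\<^sup>2" "x\<^sup>2 / (real (k + l + 1))\<^sup>2 \<le> 1"
proof -
  have "x\<^sup>2 \<le> (real (k + l + 1))\<^sup>2"
    using assms by (intro abs_le_square_iff[THEN iffD1]) auto
  then show "x\<^sup>2 / (real (k + l + 1))\<^sup>2 \<le> 1" by (simp add: divide_le_eq_1)
qed simp

lemma tail_prod_between:
  assumes "\<bar>x\<bar> \<le> real (l + 1)"
  shows "0 \<le> tail_prod l x" "tail_prod l x \<le> 1"
proof -
  note b = tail_factor_bounds[OF assms]
  show "0 \<le> tail_prod l x"
    by (rule tendsto_lowerbound[OF tail_prod_LIMSEQ]) (use b in \<open>auto intro!: always_eventually prod_nonneg\<close>)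
  show "tail_prod l x \<le> 1"
    by (rule tendsto_upperbound[OF tail_prod_LIMSEQ]) (use b in \<open>auto intro!: always_eventually prod_le_1\<close>)
qed

text \<open>For \<open>|x| \<le> l + 1\<close> all factors lie between 0 and 1. For larger \<open>|x|\<close> the value is \<open>sinc (pi x)\<close> divided
  by a product whose modulus is at least its value at \<open>l + 1\<close>, the binomial coefficient of \<open>2 l + 1\<close> over \<open>l\<close>.\<close>

lemma abs_tail_prod_le_1: "\<bar>tail_prod l x\<bar> \<le> 1"
proof (cases "\<bar>x\<bar> \<le> real (l + 1)")
  case True
  then show ?thesis using tail_prod_between[OF True] by simp
next
  case False
  have "\<bar>sinc y\<bar> \<le> 1" for y
    using abs_sin_x_le_abs_x[of y] by (simp add: divide_le_eq_1)
  from this[of "pi * x"] have "\<bar>\<Prod>k=1..l. 1 - x\<^sup>2 / (real k)\<^sup>2\<bar> * \<bar>tail_prod l x\<bar> \<le> 1"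
    unfolding sinc_eq_tail_prod[of x l] abs_mult .
  moreover have "1 \<le> \<bar>\<Prod>k=1..l. 1 - x\<^sup>2 / (real k)\<^sup>2\<bar>"
  proof -
    have "(\<Prod>k=1..l. real (l + 1 - k)) = (\<Prod>k=1..l. real k)"
      by (rule prod.reindex_bij_witness[of _ "\<lambda>k. l + 1 - k" "\<lambda>k. l + 1 - k"]) auto
    then have "(\<Prod>k=1..l. real (l + 1 - k) / real k) = 1"
      by (simp add: prod_dividef)
    moreover have "1 \<le> (\<Prod>k=1..l. real (l + 1 + k) / real k)"
      by (rule prod_ge_1) (auto simp: divide_simps)
    ultimately have "1 \<le> (\<Prod>k=1..l. real (l + 1 - k) / real k) * (\<Prod>k=1..l. real (l + 1 + k) / real k)"
      by simp
    also have "\<dots> = (\<Prod>k=1..l. (real (l + 1))\<^sup>2 / (real k)\<^sup>2 - 1)"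
      unfolding prod.distrib[symmetric]
    proof (rule prod.cong[OF refl])
      fix k assume k: "k \<in> {1..l}"
      then have "real (l + 1 - k) = real (l + 1) - real k" by (subst of_nat_diff) auto
      with k show "real (l + 1 - k) / real k * (real (l + 1 + k) / real k) = (real (l + 1))\<^sup>2 / (real k)\<^sup>2 - 1"
        by (simp add: field_simps power2_eq_square)
    qed
    also have "\<dots> \<le> (\<Prod>k=1..l. \<bar>1 - x\<^sup>2 / (real k)\<^sup>2\<bar>)"
    proof (rule prod_mono, safe)
      fix k assume k: "k \<in> {1..l}"
      have "(real k)\<^sup>2 \<le> (real (l + 1))\<^sup>2" using k by (intro power_mono) auto
      then show "0 \<le> (real (l + 1))\<^sup>2 / (real k)\<^sup>2 - 1" using k by (simp add: divide_simps)
      have "(real (l + 1))\<^sup>2 \<le> x\<^sup>2" using False by (intro abs_le_square_iff[THEN iffD1]) auto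
      then have "(real (l + 1))\<^sup>2 / (real k)\<^sup>2 \<le> x\<^sup>2 / (real k)\<^sup>2" by (rule divide_right_mono) simp
      then show "(real (l + 1))\<^sup>2 / (real k)\<^sup>2 - 1 \<le> \<bar>1 - x\<^sup>2 / (real k)\<^sup>2\<bar>" by linarith
    qed
    finally show ?thesis by (simp only: abs_prod)
  qed
  ultimately show ?thesis
    using mult_right_mono[of 1 "\<bar>\<Prod>k=1..l. 1 - x\<^sup>2 / (real k)\<^sup>2\<bar>" "\<bar>tail_prod l x\<bar>"] by linarith
qed

text \<open>For large \<open>l\<close> the product of the factors \<open>1 - a k\<close> is at least \<open>1 - \<Sum>k. a k\<close>, and the sum is a tail of a
  convergent series.\<close>

lemma tail_prod_tendsto_1: "(\<lambda>l. tail_prod l x) \<longlonglongrightarrow> 1"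
proof -
  define f where "f k = x\<^sup>2 / (real (k + 1))\<^sup>2" for k
  have f: "summable f" using summable_tail[of x 0] by (simp add: f_def[abs_def])
  obtain N where N: "\<bar>x\<bar> \<le> real N" using real_arch_simple by blast
  have lower: "1 - (\<Sum>k. f (k + l)) \<le> tail_prod l x" if l: "l \<ge> N" for l
  proof (rule tendsto_lowerbound[OF tail_prod_LIMSEQ])
    have x: "\<bar>x\<bar> \<le> real (l + 1)" using N l by simp
    have "1 - (\<Sum>k. f (k + l)) \<le> (\<Prod>k<n. 1 - x\<^sup>2 / (real (k + l + 1))\<^sup>2)" for n
    proof -
      have "1 - (\<Sum>k. f (k + l)) \<le> 1 - (\<Sum>k<n. f (k + l))"
        using sum_le_suminf[OF summable_ignore_initial_segment[OF f, of l], of "{..<n}"] by (simp add: f_def)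
      also have "\<dots> = 1 - (\<Sum>k<n. x\<^sup>2 / (real (k + l + 1))\<^sup>2)" by (simp add: f_def)
      also have "\<dots> \<le> (\<Prod>k<n. 1 - x\<^sup>2 / (real (k + l + 1))\<^sup>2)"
        using tail_factor_bounds[OF x] by (intro Weierstrass_prod_ineq) auto
      finally show ?thesis .
    qed
    then show "\<forall>\<^sub>F n in sequentially. 1 - (\<Sum>k. f (k + l)) \<le> (\<Prod>k<n. 1 - x\<^sup>2 / (real (k + l + 1))\<^sup>2)" by simp
  qed simp
  have "(\<lambda>l. \<Sum>k. f (k + l)) \<longlonglongrightarrow> 0"
    by (rule LIMSEQ_I) (use suminf_exist_split[OF _ f] in auto)
  then have "(\<lambda>l. 1 - (\<Sum>k. f (k + l))) \<longlonglongrightarrow> 1 - 0" by (intro tendsto_intros)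
  then have lim: "(\<lambda>l. 1 - (\<Sum>k. f (k + l))) \<longlonglongrightarrow> 1" by simp
  show ?thesis
  proof (rule tendsto_sandwich[OF _ _ lim tendsto_const])
    show "\<forall>\<^sub>F l in sequentially. 1 - (\<Sum>k. f (k + l)) \<le> tail_prod l x"
      using lower by (auto simp: eventually_sequentially)
    show "\<forall>\<^sub>F l in sequentially. tail_prod l x \<le> 1"
      using abs_tail_prod_le_1[of _ x] by (intro always_eventually) (auto simp: abs_le_iff)
  qed
qed

lemma abs_SINC_over_Q_le_1: "\<bar>SINC_over_Q l s\<bar> \<le> 1"
  unfolding SINC_over_Q_eq abs_prod by (intro prod_le_1) (auto simp: abs_tail_prod_le_1)

lemma SINC_over_Q_tendsto_1: "(\<lambda>l. SINC_over_Q l s) \<longlonglongrightarrow> 1"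
  using tendsto_prod[of UNIV "\<lambda>i l. tail_prod l (s $ i)" "\<lambda>_. 1" sequentially] tail_prod_tendsto_1
  by (simp add: SINC_over_Q_eq)

text \<open>Dominated convergence for sums over growing finite sets: the total weight \<open>a\<close> outside a fixed set
  \<open>C m\<close> is small, and on \<open>C m\<close> the finitely many \<open>w l n\<close> tend to 0.\<close>

lemma weighted_sums_tendsto_0:
  fixes a :: "'a \<Rightarrow> real" and w :: "nat \<Rightarrow> 'a \<Rightarrow> real"
  assumes fin: "\<And>l. finite (C l)" and mono: "\<And>l m. l \<le> m \<Longrightarrow> C l \<subseteq> C m"
    and a: "\<And>n. 0 \<le> a n" and bdd: "\<And>l. (\<Sum>n\<in>C l. a n) \<le> S"
    and w0: "\<And>l n. 0 \<le> w l n" and w: "\<And>l n. w l n \<le> B" and lim: "\<And>n. (\<lambda>l. w l n) \<longlonglongrightarrow> 0"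
  shows "(\<lambda>l. \<Sum>n\<in>C l. a n * w l n) \<longlonglongrightarrow> 0"
proof -
  define s where "s l = (\<Sum>n\<in>C l. a n)" for l
  have B: "B \<ge> 0" using w0 w order_trans by blast
  have "incseq s"
    unfolding s_def by (intro monoI sum_mono2 fin mono a)
  then obtain T where T: "s \<longlonglongrightarrow> T" and sT: "\<And>l. s l \<le> T"
    using incseq_convergent[of s S] bdd by (auto simp: s_def)
  show ?thesis
  proof (rule LIMSEQ_I)
    fix \<epsilon> :: real assume e: "\<epsilon> > 0"
    have "(\<lambda>l. (T - s l) * B) \<longlonglongrightarrow> (T - T) * B" by (intro tendsto_intros T)
    from order_tendstoD(2)[OF this, of "\<epsilon> / 2"] e obtain m where m: "(T - s m) * B < \<epsilon> / 2"
      by (auto simp: eventually_sequentially)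
    have "(\<lambda>l. \<Sum>n\<in>C m. a n * w l n) \<longlonglongrightarrow> (\<Sum>n\<in>C m. a n * 0)"
      by (intro tendsto_intros lim)
    from order_tendstoD(2)[OF this, of "\<epsilon> / 2"] e obtain L where L: "\<And>l. l \<ge> L \<Longrightarrow> (\<Sum>n\<in>C m. a n * w l n) < \<epsilon> / 2"
      by (auto simp: eventually_sequentially)
    have "norm ((\<Sum>n\<in>C l. a n * w l n) - 0) < \<epsilon>" if l: "l \<ge> max L m" for l
    proof -
      have sub: "C m \<subseteq> C l" using l by (intro mono) auto
      have "(\<Sum>n\<in>C l. a n * w l n) = (\<Sum>n\<in>C l - C m. a n * w l n) + (\<Sum>n\<in>C m. a n * w l n)"
        by (rule sum.subset_diff[OF sub fin])
      also have "(\<Sum>n\<in>C l - C m. a n * w l n) \<le> (\<Sum>n\<in>C l - C m. a n * B)"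
        by (intro sum_mono mult_left_mono w a)
      also have "\<dots> = (s l - s m) * B"
        by (simp add: s_def sum_diff[OF fin sub] sum_distrib_right[symmetric])
      also have "\<dots> \<le> (T - s m) * B" by (intro mult_right_mono diff_right_mono sT B)
      finally have "(\<Sum>n\<in>C l. a n * w l n) < \<epsilon>" using L[of l] l m by simp
      moreover have "0 \<le> (\<Sum>n\<in>C l. a n * w l n)" by (intro sum_nonneg mult_nonneg_nonneg a w0)
      ultimately show ?thesis by simp
    qed
    then show "\<exists>N. \<forall>l\<ge>N. norm ((\<Sum>n\<in>C l. a n * w l n) - 0) < \<epsilon>" by blast
  qed
qed

section \<open>Bounded operators, projections and compressions\<close>

lemma L2_opnorm_bound:
  assumes "L2_opnorm M V T \<le> ennreal K" "0 \<le> K" "f \<in> V" "L2_norm M f \<le> 1"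
  shows "L2_norm M (T f) \<le> K"
proof -
  have "ennreal (L2_norm M (T f)) \<le> L2_opnorm M V T"
    unfolding L2_opnorm_def using assms(3,4) by (intro SUP_upper) auto
  with assms(1) have "ennreal (L2_norm M (T f)) \<le> ennreal K" by (rule order_trans[rotated])
  then show ?thesis using assms(2) by simp
qed

text \<open>When \<open>f\<close> has norm 0 all its multiples lie in the unit ball, so homogeneity forces the norm
  of \<open>T f\<close> to vanish.\<close>

lemma L2_bounded_linear_bound:
  assumes "L2_bounded_linear M T"
  obtains K where "0 \<le> K" "\<And>f. f \<in> L2 M \<Longrightarrow> L2_norm M (T f) \<le> K * L2_norm M f"
proof -
  from assms have mem: "\<And>f. f \<in> L2 M \<Longrightarrow> T f \<in> L2 M"
    and hom: "\<And>c f. f \<in> L2 M \<Longrightarrow> AE x in M. T (\<lambda>y. c * f y) x = c * T f x"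
    and fin: "L2_opnorm M (L2 M) T < \<infinity>"
    by (auto simp: L2_bounded_linear_def)
  from fin obtain K where K: "L2_opnorm M (L2 M) T = ennreal K" "K \<ge> 0"
    by (cases "L2_opnorm M (L2 M) T") auto
  have scaled: "c * L2_norm M (T f) \<le> K" if f: "f \<in> L2 M" and c: "c \<ge> 0" "c * L2_norm M f \<le> 1" for c f
  proof -
    have "L2_norm M (T (\<lambda>y. of_real c * f y)) \<le> K"
      using c by (intro L2_opnorm_bound[OF eq_refl[OF K(1)] K(2)] L2_cmult f) (simp add: L2_norm_cmult)
    also have "L2_norm M (T (\<lambda>y. of_real c * f y)) = L2_norm M (\<lambda>x. of_real c * T f x)"
      by (intro L2_norm_cong_AE hom f L2_measurable mem L2_cmult)
    finally show ?thesis using c by (simp add: L2_norm_cmult)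
  qed
  show thesis
  proof (rule that[OF K(2)])
    fix f assume f: "f \<in> L2 M"
    show "L2_norm M (T f) \<le> K * L2_norm M f"
    proof (cases "L2_norm M f = 0")
      case True
      have "L2_norm M (T f) = 0"
      proof (rule ccontr)
        assume "L2_norm M (T f) \<noteq> 0"
        then show False
          using scaled[OF f, of "(K + 1) / L2_norm M (T f)"] True K(2) by (simp add: divide_nonneg_nonneg)
      qed
      with True show ?thesis by simp
    next
      case False
      then have pos: "L2_norm M f > 0" by (simp add: order_less_le)
      with scaled[OF f, of "1 / L2_norm M f"] show ?thesis by (simp add: field_simps)
    qed
  qed
qed

lemma L2_bounded_linear_sum:
  assumes T: "L2_bounded_linear M T" and fin: "finite I" and f: "\<And>i. i \<in> I \<Longrightarrow> f i \<in> L2 M"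
  shows "AE x in M. T (\<lambda>y. \<Sum>i\<in>I. c i * f i y) x = (\<Sum>i\<in>I. c i * T (f i) x)"
proof -
  from T have add: "\<And>f g. f \<in> L2 M \<Longrightarrow> g \<in> L2 M \<Longrightarrow> AE x in M. T (\<lambda>y. f y + g y) x = T f x + T g x"
    and hom: "\<And>c f. f \<in> L2 M \<Longrightarrow> AE x in M. T (\<lambda>y. c * f y) x = c * T f x"
    by (auto simp: L2_bounded_linear_def)
  from fin f show ?thesis
  proof (induction I rule: finite_induct)
    case empty
    show ?case using hom[OF L2_zero, of 0] by simp
  next
    case (insert j I)
    have "AE x in M. T (\<lambda>y. c j * f j y + (\<Sum>i\<in>I. c i * f i y)) x =
        T (\<lambda>y. c j * f j y) x + T (\<lambda>y. \<Sum>i\<in>I. c i * f i y) x"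
      by (rule add) (auto intro!: L2_cmult L2_sum insert.prems)
    moreover have "AE x in M. T (\<lambda>y. c j * f j y) x = c j * T (f j) x"
      by (rule hom) (simp add: insert.prems)
    moreover have "AE x in M. T (\<lambda>y. \<Sum>i\<in>I. c i * f i y) x = (\<Sum>i\<in>I. c i * T (f i) x)"
      by (rule insert.IH) (simp add: insert.prems)
    ultimately have "AE x in M. T (\<lambda>y. c j * f j y + (\<Sum>i\<in>I. c i * f i y)) x = c j * T (f j) x + (\<Sum>i\<in>I. c i * T (f i) x)"
      by eventually_elim simp
    then show ?case by (simp add: insert.hyps)
  qed
qed

definition trig_proj :: "nat \<Rightarrow> (real^'d \<Rightarrow> complex) \<Rightarrow> real^'d \<Rightarrow> complex" where
  "trig_proj l f = (\<lambda>x. \<Sum>n\<in>index_cube l. L2_inner cube_measure f (basis_expo n) * basis_expo n x)"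

lemma trig_proj_in: "trig_proj l f \<in> trig_space l"
  unfolding trig_proj_def by (rule trig_spaceI[OF refl])

lemma trig_proj_id: "p \<in> trig_space l \<Longrightarrow> trig_proj l p = p"
proof (erule trig_spaceE)
  fix c assume p: "p = (\<lambda>x. \<Sum>n\<in>index_cube l. c n * basis_expo n x)"
  show "trig_proj l p = p"
    unfolding trig_proj_def by (subst p) (auto simp: coefficient_eq_inner[OF p] intro!: sum.cong)
qed

lemma inner_trig_proj:
  assumes f: "f \<in> L2 cube_measure" and p: "p \<in> trig_space l"
  shows "L2_inner cube_measure (trig_proj l f) p = L2_inner cube_measure f p"
proof -
  from p obtain c where p: "p = (\<lambda>x. \<Sum>n\<in>index_cube l. c n * basis_expo n x)" by (rule trig_spaceE)
  have "L2_inner cube_measure (trig_proj l f) (basis_expo n) = L2_inner cube_measure f (basis_expo n)"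
    if "n \<in> index_cube l" for n
    using coefficient_eq_inner[OF trig_proj_def that, of f] by simp
  then show ?thesis
    unfolding p by (subst (1 2) L2_inner_sum_right)
      (auto intro!: sum.cong basis_expo_L2 f trig_space_L2[OF trig_proj_in])
qed

text \<open>Within \<open>trig_space l\<close> the coefficients determine the function at every point, so the choice in the definition of
  the projection has only one candidate.\<close>

lemma L2_proj_trig_space:
  assumes f: "f \<in> L2 cube_measure"
  shows "L2_proj cube_measure (trig_space l) f = trig_proj l f"
  unfolding L2_proj_def
proof (rule some_equality)
  show "trig_proj l f \<in> trig_space l \<and> (\<forall>v\<in>trig_space l. L2_inner cube_measure (\<lambda>x. f x - trig_proj l f x) v = 0)"
    by (auto simp: trig_proj_in L2_inner_diff_left f trig_space_L2[OF trig_proj_in] trig_space_L2 inner_trig_proj)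
next
  fix g assume g: "g \<in> trig_space l \<and> (\<forall>v\<in>trig_space l. L2_inner cube_measure (\<lambda>x. f x - g x) v = 0)"
  have "L2_inner cube_measure f (basis_expo n) = L2_inner cube_measure g (basis_expo n)" if "n \<in> index_cube l" for n
  proof -
    have "L2_inner cube_measure (\<lambda>x. f x - g x) (basis_expo n) = 0"
      using g basis_expo_in_trig_space[OF that] by blast
    then show ?thesis
      using L2_inner_diff_left[OF f trig_space_L2[OF conjunct1[OF g]] basis_expo_L2[of n]] by simp
  qed
  then have "trig_proj l g = trig_proj l f"
    unfolding trig_proj_def by (intro ext sum.cong) auto
  then show "g = trig_proj l f" by (simp add: trig_proj_id[OF conjunct1[OF g]])
qed

lemma compression_trig_space:
  assumes L: "L2_bounded_linear cube_measure L" and v: "v \<in> trig_space l"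
  shows "compression l L v = trig_proj l (L v)"
proof -
  have "L v \<in> L2 cube_measure" using L trig_space_L2[OF v] by (simp add: L2_bounded_linear_def)
  then show ?thesis
    by (simp add: compression_def L2_proj_trig_space trig_space_L2[OF v] trig_proj_id[OF v])
qed

section \<open>Interpolation in spaces of trigonometric polynomials\<close>

definition riesz_operator :: "(int^'d \<Rightarrow> real^'d) \<Rightarrow> ((real^'d \<Rightarrow> complex) \<Rightarrow> real^'d \<Rightarrow> complex) \<Rightarrow> bool" where
  "riesz_operator t L \<longleftrightarrow> L2_bounded_linear cube_measure L \<and>
     (\<forall>n. AE x in cube_measure. L (basis_expo n) x = expo (t n) x)"

lemma riesz_operator_mem: "riesz_operator t L \<Longrightarrow> f \<in> L2 cube_measure \<Longrightarrow> L f \<in> L2 cube_measure"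
  by (simp add: riesz_operator_def L2_bounded_linear_def)

text \<open>Sampling \<open>FT g\<close> at the points \<open>t n\<close> is pairing \<open>g\<close> with the images of the orthonormal basis.\<close>

lemma inner_riesz_operator:
  assumes L: "riesz_operator t L" and g: "g \<in> L2 cube_measure" and v: "v = (\<lambda>x. \<Sum>n\<in>I. c n * basis_expo n x)"
    and I: "finite I"
  shows "L2_inner cube_measure g (L v) = (\<Sum>n\<in>I. cnj (c n) * FT g (t n))"
proof -
  have "AE x in cube_measure. L v x = (\<Sum>n\<in>I. c n * L (basis_expo n) x)"
    unfolding v using L by (intro L2_bounded_linear_sum I basis_expo_L2) (simp add: riesz_operator_def)
  moreover have "AE x in cube_measure. \<forall>n\<in>I. L (basis_expo n) x = expo (t n) x"
    using L I by (subst AE_finite_all) (auto simp: riesz_operator_def)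
  ultimately have AE: "AE x in cube_measure. L v x = (\<Sum>n\<in>I. c n * expo (t n) x)"
    by eventually_elim (auto intro: sum.cong)
  have vL2: "v \<in> L2 cube_measure" unfolding v by (intro L2_sum L2_cmult basis_expo_L2)
  have "L2_inner cube_measure g (L v) = L2_inner cube_measure g (\<lambda>x. \<Sum>n\<in>I. c n * expo (t n) x)"
    by (rule L2_inner_cong_AE)
       (use AE in \<open>auto intro!: L2_measurable g riesz_operator_mem[OF L vL2] L2_sum L2_cmult expo_L2\<close>)
  also have "\<dots> = (\<Sum>n\<in>I. cnj (c n) * FT g (t n))"
    unfolding FT_def by (rule L2_inner_sum_right) (auto intro: expo_L2 g)
  finally show ?thesis .
qed

lemma norm_trig_sum:
  assumes "finite I"
  shows "(L2_norm cube_measure (\<lambda>x. \<Sum>n\<in>I. c n * basis_expo n x))\<^sup>2 = (\<Sum>n\<in>I. (norm (c n))\<^sup>2)"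
proof -
  let ?v = "\<lambda>x. \<Sum>n\<in>I. c n * basis_expo n x"
  have v: "?v \<in> L2 cube_measure" by (intro L2_sum L2_cmult basis_expo_L2)
  have "complex_of_real ((L2_norm cube_measure ?v)\<^sup>2) = (\<Sum>n\<in>I. c n * L2_inner cube_measure (basis_expo n) ?v)"
    unfolding L2_inner_self[symmetric] by (rule L2_inner_sum_left) (auto intro: basis_expo_L2 v)
  also have "\<dots> = (\<Sum>n\<in>I. c n * cnj (c n))"
  proof (rule sum.cong[OF refl])
    fix n assume n: "n \<in> I"
    have "L2_inner cube_measure (basis_expo n) ?v = (\<Sum>m\<in>I. if m = n then cnj (c m) else 0)"
      by (subst L2_inner_sum_right) (auto simp: basis_expo_L2 basis_expo_orthonormal intro!: sum.cong)
    then show "c n * L2_inner cube_measure (basis_expo n) ?v = c n * cnj (c n)"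
      using n assms by simp
  qed
  also have "\<dots> = complex_of_real (\<Sum>n\<in>I. (norm (c n))\<^sup>2)"
    unfolding of_real_sum by (intro sum.cong refl complex_norm_square[symmetric])
  finally show ?thesis by (simp only: of_real_eq_iff)
qed

text \<open>Test \<open>g\<close> against \<open>L v\<close>, where the coefficients of \<open>v\<close> are the samples themselves; the sum of their squares
  is then both \<open>\<langle>g, L v\<rangle>\<close> and the square of the norm of \<open>v\<close>.\<close>

lemma Bessel_bound:
  assumes L: "riesz_operator t L" and K: "\<And>f. f \<in> L2 cube_measure \<Longrightarrow> L2_norm cube_measure (L f) \<le> K * L2_norm cube_measure f"
    and K0: "0 \<le> K" and g: "g \<in> L2 cube_measure" and I: "finite I"
  shows "(\<Sum>n\<in>I. (norm (FT g (t n)))\<^sup>2) \<le> (K * L2_norm cube_measure g)\<^sup>2"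
proof -
  define S where "S = (\<Sum>n\<in>I. (norm (FT g (t n)))\<^sup>2)"
  define v where "v = (\<lambda>x. \<Sum>n\<in>I. FT g (t n) * basis_expo n x)"
  have v: "v \<in> L2 cube_measure" unfolding v_def by (intro L2_sum L2_cmult basis_expo_L2)
  have S: "(L2_norm cube_measure v)\<^sup>2 = S" unfolding v_def S_def by (rule norm_trig_sum[OF I])
  have "L2_inner cube_measure g (L v) = (\<Sum>n\<in>I. cnj (FT g (t n)) * FT g (t n))"
    by (rule inner_riesz_operator[OF L g v_def I])
  also have "\<dots> = complex_of_real S"
    unfolding S_def of_real_sum by (intro sum.cong refl) (simp only: complex_norm_square mult.commute)
  finally have "S \<le> norm (L2_inner cube_measure g (L v))" by simp
  also have "\<dots> \<le> L2_norm cube_measure g * L2_norm cube_measure (L v)"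
    by (rule L2_Cauchy_Schwarz[OF g riesz_operator_mem[OF L v]])
  also have "\<dots> \<le> L2_norm cube_measure g * (K * L2_norm cube_measure v)"
    by (intro mult_left_mono K v) simp
  finally have le: "(L2_norm cube_measure v)\<^sup>2 \<le> K * L2_norm cube_measure g * L2_norm cube_measure v"
    by (simp add: S mult_ac)
  have "L2_norm cube_measure v \<le> K * L2_norm cube_measure g"
  proof (cases "L2_norm cube_measure v = 0")
    case True
    then show ?thesis using K0 by simp
  next
    case False
    then have "L2_norm cube_measure v > 0" by (simp add: order_less_le)
    with le show ?thesis by (simp add: power2_eq_square)
  qed
  then show ?thesis unfolding S_def[symmetric] S[symmetric] by (intro power_mono) auto
qed

text \<open>The sampling equations say that the compressed adjoint of \<open>L\<close> maps \<open>k\<close> to known data, and its inverse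
  has the same norm as the inverse of the compression. The adjoint is avoided by duality: writing \<open>k\<close>, divided by its norm, as the
  compression of some \<open>v\<close> of norm at most \<open>M\<close>, the norm of \<open>k\<close> is \<open>\<langle>k, L v\<rangle>\<close>, which involves only samples of \<open>FT k\<close>.
  If \<open>k\<close> has norm 0, then \<open>1 / \<kappa>\<close> is 0 and the argument still applies.\<close>

lemma compression_stability:
  assumes L: "riesz_operator t L"
    and K: "\<And>f. f \<in> L2 cube_measure \<Longrightarrow> L2_norm cube_measure (L f) \<le> K * L2_norm cube_measure f" and K0: "0 \<le> K"
    and inv: "\<And>u. u \<in> trig_space l \<Longrightarrow> L2_norm cube_measure u \<le> 1 \<Longrightarrow>
      \<exists>v\<in>trig_space l. compression l L v = u \<and> L2_norm cube_measure v \<le> M"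
    and k: "k \<in> trig_space l" and g: "g \<in> L2 cube_measure"
    and eq: "\<And>n. n \<in> index_cube l \<Longrightarrow> FT k (t n) = FT g (t n) + d n"
  shows "L2_norm cube_measure k \<le> M * (K * L2_norm cube_measure g + sqrt (\<Sum>n\<in>index_cube l. (norm (d n))\<^sup>2))"
proof -
  define D where "D = (\<lambda>x. \<Sum>n\<in>index_cube l. d n * basis_expo n x)"
  have D: "D \<in> trig_space l" unfolding D_def by (rule trig_spaceI[OF refl])
  have D_norm: "L2_norm cube_measure D = sqrt (\<Sum>n\<in>index_cube l. (norm (d n))\<^sup>2)"
    using norm_trig_sum[OF finite_index_cube, of d l] unfolding D_def[symmetric]
    by (intro real_sqrt_unique[symmetric]) simp_all
  define \<kappa> where "\<kappa> = L2_norm cube_measure k"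
  define u where "u = (\<lambda>x. of_real (1 / \<kappa>) * k x)"
  have u: "u \<in> trig_space l" unfolding u_def by (rule trig_space_cmult[OF k])
  have kL2: "k \<in> L2 cube_measure" by (rule trig_space_L2[OF k])
  have "L2_norm cube_measure u \<le> 1"
    unfolding u_def L2_norm_cmult \<kappa>_def[symmetric] by (cases "\<kappa> = 0") (auto simp: \<kappa>_def norm_divide)
  with inv[OF u] obtain v where v: "v \<in> trig_space l" "compression l L v = u" "L2_norm cube_measure v \<le> M" by blast
  have vL2: "v \<in> L2 cube_measure" by (rule trig_space_L2[OF v(1)])
  from v(1) obtain c where c: "v = (\<lambda>x. \<Sum>n\<in>index_cube l. c n * basis_expo n x)" by (rule trig_spaceE)
  have "L2_inner cube_measure k u = of_real \<kappa>"
  proof -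
    have "L2_inner cube_measure u k = of_real (1 / \<kappa>) * of_real (\<kappa>\<^sup>2)"
      unfolding u_def L2_inner_cmult_left L2_inner_self \<kappa>_def ..
    also have "\<dots> = of_real \<kappa>" by (cases "\<kappa> = 0") (auto simp: power2_eq_square)
    finally show ?thesis by (subst L2_inner_commute) simp
  qed
  moreover have "L2_inner cube_measure k u = L2_inner cube_measure k (L v)"
  proof -
    have "u = trig_proj l (L v)"
      using v(2) compression_trig_space[OF _ v(1), of L] L by (simp add: riesz_operator_def)
    then have "L2_inner cube_measure u k = L2_inner cube_measure (L v) k"
      using inner_trig_proj[OF riesz_operator_mem[OF L vL2] k] by simp
    then show ?thesis by (subst (1 2) L2_inner_commute) simp
  qed
  moreover have "L2_inner cube_measure k (L v) = L2_inner cube_measure g (L v) + L2_inner cube_measure D v"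
  proof -
    have "L2_inner cube_measure D v = (\<Sum>n\<in>index_cube l. cnj (c n) * d n)"
      unfolding c by (subst L2_inner_sum_right)
        (auto intro!: sum.cong basis_expo_L2 trig_space_L2[OF D] simp: coefficient_eq_inner[OF D_def])
    then show ?thesis
      by (simp add: inner_riesz_operator[OF L _ c finite_index_cube] kL2 g eq sum.distrib[symmetric] distrib_left)
  qed
  ultimately have "complex_of_real \<kappa> = L2_inner cube_measure g (L v) + L2_inner cube_measure D v"
    by simp
  then have "norm (complex_of_real \<kappa>) = norm (L2_inner cube_measure g (L v) + L2_inner cube_measure D v)"
    by simp
  then have "\<kappa> = norm (L2_inner cube_measure g (L v) + L2_inner cube_measure D v)"
    by (simp add: \<kappa>_def)
  also have "\<dots> \<le> L2_norm cube_measure g * L2_norm cube_measure (L v) + L2_norm cube_measure D * L2_norm cube_measure v"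
    by (intro norm_triangle_mono L2_Cauchy_Schwarz g riesz_operator_mem[OF L vL2] trig_space_L2[OF D] vL2)
  also have "\<dots> \<le> L2_norm cube_measure g * (K * L2_norm cube_measure v) + L2_norm cube_measure D * L2_norm cube_measure v"
    by (intro add_mono mult_left_mono K vL2) auto
  also have "\<dots> = (K * L2_norm cube_measure g + L2_norm cube_measure D) * L2_norm cube_measure v"
    by (simp add: algebra_simps)
  also have "\<dots> \<le> (K * L2_norm cube_measure g + L2_norm cube_measure D) * M"
    by (intro mult_left_mono v(3) add_nonneg_nonneg mult_nonneg_nonneg K0) auto
  finally show ?thesis by (simp add: \<kappa>_def D_norm mult.commute)
qed

text \<open>In the basis of exponentials the compression has the matrix \<open>A\<close>, and the interpolation problem has its conjugate
  transpose. Surjectivity of the compression provides a matrix \<open>B\<close> with \<open>B A = 1\<close>, injectivity gives \<open>A B = 1\<close>, and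
  the coefficients of the solution are read off from the conjugate of \<open>B\<close>.\<close>

lemma trig_interpolation_exists:
  assumes L: "riesz_operator t L" and bij: "bij_betw (compression l L) (trig_space l) (trig_space l)"
  shows "\<exists>h\<in>trig_space l. \<forall>n\<in>index_cube l. FT h (t n) = b n"
proof -
  let ?I = "index_cube l :: (int^'a) set"
  define A where "A n m = L2_inner cube_measure (L (basis_expo n)) (basis_expo m)" for n m
  have A: "FT (basis_expo m) (t n) = cnj (A n m)" for n m
  proof -
    have "L2_inner cube_measure (basis_expo m) (L (basis_expo n)) = (\<Sum>k\<in>{n}. cnj 1 * FT (basis_expo m) (t k))"
      by (rule inner_riesz_operator[OF L basis_expo_L2, where c = "\<lambda>_. 1"]) auto
    then show ?thesis unfolding A_def by (subst L2_inner_commute[symmetric]) simp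
  qed
  have compr: "compression l L (\<lambda>x. \<Sum>n\<in>?I. c n * basis_expo n x) = (\<lambda>x. \<Sum>m\<in>?I. (\<Sum>n\<in>?I. c n * A n m) * basis_expo m x)" for c
  proof -
    let ?v = "\<lambda>x. \<Sum>n\<in>?I. c n * basis_expo n x"
    have v: "?v \<in> trig_space l" by (rule trig_spaceI[OF refl])
    have "L2_inner cube_measure (L ?v) (basis_expo m) = (\<Sum>n\<in>?I. c n * A n m)" for m
    proof -
      have "L2_inner cube_measure (basis_expo m) (L ?v) = (\<Sum>n\<in>?I. cnj (c n) * cnj (A n m))"
        using inner_riesz_operator[OF L basis_expo_L2 refl finite_index_cube] by (simp add: A)
      then show ?thesis by (subst L2_inner_commute) simp
    qed
    moreover have "compression l L ?v = trig_proj l (L ?v)"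
      using L v by (intro compression_trig_space) (auto simp: riesz_operator_def)
    ultimately show ?thesis by (simp add: trig_proj_def)
  qed
  have "\<forall>j\<in>?I. \<exists>c. compression l L (\<lambda>x. \<Sum>n\<in>?I. c n * basis_expo n x) = basis_expo j"
  proof
    fix j assume "j \<in> ?I"
    then have "basis_expo j \<in> compression l L ` trig_space l"
      using bij basis_expo_in_trig_space by (auto simp: bij_betw_def)
    then show "\<exists>c. compression l L (\<lambda>x. \<Sum>n\<in>?I. c n * basis_expo n x) = basis_expo j"
      by (auto elim!: trig_spaceE)
  qed
  then obtain B where B: "\<And>j. j \<in> ?I \<Longrightarrow> compression l L (\<lambda>x. \<Sum>n\<in>?I. B j n * basis_expo n x) = basis_expo j"
    by metis
  have AB: "(\<Sum>m\<in>?I. A n m * B m n') = (if n' = n then 1 else 0)" if n: "n \<in> ?I" "n' \<in> ?I" for n n'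
  proof -
    define w where "w = (\<lambda>x. \<Sum>k\<in>?I. (\<Sum>m\<in>?I. A n m * B m k) * basis_expo k x)"
    have BA: "(\<Sum>k\<in>?I. B m k * A k m') = (if m' = m then 1 else 0)" if m: "m \<in> ?I" "m' \<in> ?I" for m m'
      using coefficient_eq_inner[OF B[OF m(1), unfolded compr, symmetric] m(2)]
      by (auto simp: basis_expo_orthonormal)
    have "compression l L w = (\<lambda>x. \<Sum>m'\<in>?I. (\<Sum>k\<in>?I. (\<Sum>m\<in>?I. A n m * B m k) * A k m') * basis_expo m' x)"
      unfolding w_def compr ..
    also have "\<dots> = (\<lambda>x. \<Sum>m'\<in>?I. A n m' * basis_expo m' x)"
    proof (intro ext sum.cong refl)
      fix x m' assume m': "m' \<in> ?I"
      have "(\<Sum>k\<in>?I. (\<Sum>m\<in>?I. A n m * B m k) * A k m') = (\<Sum>m\<in>?I. A n m * (\<Sum>k\<in>?I. B m k * A k m'))"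
        unfolding sum_distrib_right sum_distrib_left by (subst sum.swap) (simp add: mult.assoc)
      also have "\<dots> = (\<Sum>m\<in>?I. if m' = m then A n m else 0)"
        using m' by (intro sum.cong refl) (simp add: BA)
      also have "\<dots> = A n m'" using m' by (simp add: finite_index_cube)
      finally show "(\<Sum>k\<in>?I. (\<Sum>m\<in>?I. A n m * B m k) * A k m') * basis_expo m' x = A n m' * basis_expo m' x" by simp
    qed
    also have "\<dots> = compression l L (basis_expo n)"
      using L basis_expo_in_trig_space[OF n(1)]
      by (subst compression_trig_space) (auto simp: riesz_operator_def trig_proj_def A_def)
    finally have "w = basis_expo n"
      using bij basis_expo_in_trig_space[OF n(1)] trig_spaceI[OF w_def]
      by (auto simp: bij_betw_def dest: inj_onD)
    then have "(\<Sum>m\<in>?I. A n m * B m n') = L2_inner cube_measure (basis_expo n) (basis_expo n')"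
      using coefficient_eq_inner[OF w_def n(2)] by simp
    then show ?thesis by (auto simp: basis_expo_orthonormal)
  qed
  define h where "h = (\<lambda>x. \<Sum>m\<in>?I. (\<Sum>n'\<in>?I. b n' * cnj (B m n')) * basis_expo m x)"
  have "FT h (t n) = b n" if n: "n \<in> ?I" for n
  proof -
    have "FT h (t n) = (\<Sum>m\<in>?I. (\<Sum>n'\<in>?I. b n' * cnj (B m n')) * cnj (A n m))"
      unfolding h_def FT_sum_basis A ..
    also have "\<dots> = (\<Sum>n'\<in>?I. b n' * cnj (\<Sum>m\<in>?I. A n m * B m n'))"
      unfolding sum_distrib_right cnj_sum sum_distrib_left by (subst sum.swap) (simp add: mult_ac)
    also have "\<dots> = (\<Sum>n'\<in>?I. if n' = n then b n' else 0)"
      using n by (intro sum.cong refl) (simp add: AB)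
    also have "\<dots> = b n" using n by (simp add: finite_index_cube)
    finally show ?thesis .
  qed
  moreover have "h \<in> trig_space l" by (rule trig_spaceI[OF h_def])
  ultimately show ?thesis by blast
qed

section \<open>Existence, uniqueness and convergence of the interpolating polynomials\<close>

lemma trig_space_norm_0:
  assumes "k \<in> trig_space l" "L2_norm cube_measure k \<le> 0"
  shows "k = (\<lambda>x. 0)"
proof -
  from assms(1) obtain c where k: "k = (\<lambda>x. \<Sum>n\<in>index_cube l. c n * basis_expo n x)" by (rule trig_spaceE)
  have "c n = 0" if n: "n \<in> index_cube l" for n
  proof -
    have "norm (c n) \<le> L2_norm cube_measure k * L2_norm cube_measure (basis_expo n)"
      unfolding coefficient_eq_inner[OF k n] by (rule L2_Cauchy_Schwarz[OF trig_space_L2[OF assms(1)] basis_expo_L2])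
    also have "\<dots> \<le> 0" using assms(2) by (simp add: mult_nonpos_nonneg)
    finally show ?thesis by simp
  qed
  then show ?thesis by (simp add: k)
qed

lemma FT_diff: "g \<in> L2 cube_measure \<Longrightarrow> h \<in> L2 cube_measure \<Longrightarrow> FT (\<lambda>x. g x - h x) s = FT g s - FT h s"
  unfolding FT_def by (rule L2_inner_diff_left) (auto intro: expo_L2)

lemma norm_FT_le: "g \<in> L2 cube_measure \<Longrightarrow> norm (FT g s) \<le> L2_norm cube_measure g"
  unfolding FT_def using L2_Cauchy_Schwarz[OF _ expo_L2, of g s] by (simp add: L2_norm_expo)

text \<open>The supremum over \<open>l\<close> becomes one constant \<open>M\<close> that serves all compressions.\<close>

lemma uniformly_invertible_data:
  fixes t :: "int^'d \<Rightarrow> real^'d"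
  assumes "uniformly_invertible_Riesz_basis (\<lambda>n. expo (t n))"
  obtains L K M where "riesz_operator t L" "0 \<le> K"
    "\<And>f. f \<in> L2 cube_measure \<Longrightarrow> L2_norm cube_measure (L f) \<le> K * L2_norm cube_measure f"
    "\<And>l. 1 \<le> l \<Longrightarrow> bij_betw (compression l L) (trig_space l) (trig_space l)"
    "0 \<le> M" "\<And>l u. 1 \<le> l \<Longrightarrow> u \<in> trig_space l \<Longrightarrow> L2_norm cube_measure u \<le> 1 \<Longrightarrow>
      \<exists>v\<in>trig_space l. compression l L v = u \<and> L2_norm cube_measure v \<le> M"
proof -
  from assms obtain L where iso: "L2_isomorphism cube_measure L"
    and Ln: "\<forall>n. expo (t n) \<in> L2 cube_measure \<and> (AE x in cube_measure. L (basis_expo n) x = expo (t n) x)"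
    and bij: "\<forall>l\<ge>1. bij_betw (compression l L) (trig_space l) (trig_space l)"
    and sup: "(SUP l\<in>{1..}. L2_opnorm cube_measure (trig_space l)
        (the_inv_into (trig_space l) (compression l L))) < \<infinity>"
    unfolding uniformly_invertible_Riesz_basis_def by blast
  have lin: "L2_bounded_linear cube_measure L" using iso by (simp add: L2_isomorphism_def)
  obtain K where K: "0 \<le> K" "\<And>f. f \<in> L2 cube_measure \<Longrightarrow> L2_norm cube_measure (L f) \<le> K * L2_norm cube_measure f"
    using L2_bounded_linear_bound[OF lin] by blast
  from sup obtain M where M: "(SUP l\<in>{1..}. L2_opnorm cube_measure (trig_space l)
        (the_inv_into (trig_space l) (compression l L))) = ennreal M" "M \<ge> 0"
    unfolding infinity_ennreal_def less_top_ennreal by blast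
  have inv: "\<exists>v\<in>trig_space l. compression l L v = u \<and> L2_norm cube_measure v \<le> M"
    if l: "1 \<le> l" and u: "u \<in> trig_space l" "L2_norm cube_measure u \<le> 1" for l u
  proof -
    let ?v = "the_inv_into (trig_space l) (compression l L) u"
    have inj: "inj_on (compression l L) (trig_space l)" and im: "compression l L ` trig_space l = trig_space l"
      using bij l by (auto simp: bij_betw_def)
    have "L2_opnorm cube_measure (trig_space l) (the_inv_into (trig_space l) (compression l L)) \<le> ennreal M"
      unfolding M(1)[symmetric] using l by (intro SUP_upper) auto
    from L2_opnorm_bound[OF this M(2) u] have "L2_norm cube_measure ?v \<le> M" .
    moreover have "?v \<in> trig_space l" using u im by (intro the_inv_into_into[OF inj]) auto
    moreover have "compression l L ?v = u" using u im by (intro f_the_inv_into_f[OF inj]) auto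
    ultimately show ?thesis by blast
  qed
  show thesis
    by (rule that[of L K M]) (use lin Ln K bij M(2) inv in \<open>auto simp: riesz_operator_def\<close>)
qed

theorem theorem4p2:
  fixes t :: "int^'d \<Rightarrow> real^'d" and f :: "real^'d \<Rightarrow> complex"
  assumes "uniformly_invertible_Riesz_basis (\<lambda>n. expo (t n))"
    and "f \<in> PW"
  shows "\<exists>!\<Psi> :: nat \<Rightarrow> real^'d \<Rightarrow> complex.
           \<Psi> \<in> extensional {1..} \<and>
           (\<forall>l\<ge>1. poly_coord_degree_le (2 * l) (\<Psi> l)) \<and>
           (\<forall>l\<ge>1. \<forall>n\<in>index_cube l. \<Psi> l (t n) = f (t n)) \<and>
           L2_tendsto lborel (\<lambda>l s. \<Psi> l s * of_real (SINC_over_Q l s)) f sequentially \<and>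
           uniform_limit UNIV (\<lambda>l s. \<Psi> l s * of_real (SINC_over_Q l s)) f sequentially"
proof -
  obtain L K M where L: "riesz_operator t L" and K0: "0 \<le> K"
    and K: "\<And>f. f \<in> L2 cube_measure \<Longrightarrow> L2_norm cube_measure (L f) \<le> K * L2_norm cube_measure f"
    and bij: "\<And>l. 1 \<le> l \<Longrightarrow> bij_betw (compression l L) (trig_space l) (trig_space l)"
    and M0: "0 \<le> M"
    and inv: "\<And>l u. 1 \<le> l \<Longrightarrow> u \<in> trig_space l \<Longrightarrow> L2_norm cube_measure u \<le> 1 \<Longrightarrow>
      \<exists>v\<in>trig_space l. compression l L v = u \<and> L2_norm cube_measure v \<le> M"
    using uniformly_invertible_data[OF assms(1)] by metis
  obtain g where g: "g \<in> L2 cube_measure" and fg: "f = FT g"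
    using PW_representation[OF assms(2)] by blast
  have stability: "L2_norm cube_measure k \<le> M * (K * L2_norm cube_measure u + sqrt (\<Sum>n\<in>index_cube l. (norm (d n))\<^sup>2))"
    if l: "1 \<le> l" and k: "k \<in> trig_space l" and u: "u \<in> L2 cube_measure"
      and eq: "\<And>n. n \<in> index_cube l \<Longrightarrow> FT k (t n) = FT u (t n) + d n" for l k u d
    by (rule compression_stability[OF L _ K0 _ k u eq]) (auto intro: K inv[OF l])
  \<comment> \<open>Transforms of \<open>trig_space l\<close> vanish wherever the kernel does, yet the constant data 1 can be interpolated.\<close>
  have SOQ_nz: "SINC_over_Q l (t n) \<noteq> 0" if l: "1 \<le> l" and n: "n \<in> index_cube l" for l n
  proof
    assume 0: "SINC_over_Q l (t n) = 0"
    obtain h where h: "h \<in> trig_space l" "FT h (t n) = 1"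
      using trig_interpolation_exists[OF L bij[OF l], of "\<lambda>_. 1"] n by blast
    with FT_trig_space[OF h(1)] 0 show False by auto
  qed
  have unique: "p = q" if l: "1 \<le> l" and p: "poly_coord_degree_le (2 * l) p" and q: "poly_coord_degree_le (2 * l) q"
    and eq: "\<And>n. n \<in> index_cube l \<Longrightarrow> p (t n) = q (t n)" for l and p q :: "real^'d \<Rightarrow> complex"
  proof -
    have "poly_coord_degree_le (2 * l) (\<lambda>s. p s + (- 1) * q s)"
      by (intro poly_coord_degree_le_add poly_coord_degree_le_cmult p q)
    from polynomial_kernel_eq_FT[OF this] obtain k where k: "k \<in> trig_space l"
      and Fk: "\<And>s. FT k s = (p s + (- 1) * q s) * of_real (SINC_over_Q l s)"
      and k0: "k = (\<lambda>x. 0) \<Longrightarrow> (\<lambda>s. p s + (- 1) * q s) = (\<lambda>s. 0)" by blast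
    have "FT k (t n) = FT (\<lambda>_. 0) (t n) + 0" if "n \<in> index_cube l" for n
      unfolding Fk eq[OF that] by (simp add: FT_def L2_inner_def)
    from stability[OF l k L2_zero this] have "L2_norm cube_measure k \<le> 0"
      by (simp add: L2_norm_def)
    from fun_cong[OF k0[OF trig_space_norm_0[OF k this]]] show ?thesis by (intro ext) simp
  qed
  have "\<forall>l. \<exists>h p. 1 \<le> l \<longrightarrow> h \<in> trig_space l \<and> (\<forall>n\<in>index_cube l. FT h (t n) = f (t n) * of_real (SINC_over_Q l (t n))) \<and>
      poly_coord_degree_le (2 * l) p \<and> (\<forall>s. FT h s = p s * of_real (SINC_over_Q l s))"
  proof
    fix l
    show "\<exists>h p. 1 \<le> l \<longrightarrow> h \<in> trig_space l \<and> (\<forall>n\<in>index_cube l. FT h (t n) = f (t n) * of_real (SINC_over_Q l (t n))) \<and>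
      poly_coord_degree_le (2 * l) p \<and> (\<forall>s. FT h s = p s * of_real (SINC_over_Q l s))"
    proof (cases "1 \<le> l")
      case True
      obtain h where h: "h \<in> trig_space l" "\<forall>n\<in>index_cube l. FT h (t n) = f (t n) * of_real (SINC_over_Q l (t n))"
        using trig_interpolation_exists[OF L bij[OF True], of "\<lambda>n. f (t n) * of_real (SINC_over_Q l (t n))"] by blast
      with FT_trig_space[OF h(1)] show ?thesis by blast
    qed simp
  qed
  then obtain h p where h: "\<And>l. 1 \<le> l \<Longrightarrow> h l \<in> trig_space l"
    and h_int: "\<And>l n. 1 \<le> l \<Longrightarrow> n \<in> index_cube l \<Longrightarrow> FT (h l) (t n) = f (t n) * of_real (SINC_over_Q l (t n))"
    and p: "\<And>l. 1 \<le> l \<Longrightarrow> poly_coord_degree_le (2 * l) (p l)"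
    and hp: "\<And>l s. 1 \<le> l \<Longrightarrow> FT (h l) s = p l s * of_real (SINC_over_Q l s)"
    by metis
  have p_int: "p l (t n) = f (t n)" if "1 \<le> l" "n \<in> index_cube l" for l n
    using h_int[OF that] hp[OF that(1), of "t n"] SOQ_nz[OF that] by simp
  \<comment> \<open>The data of \<open>h l\<close> differ from the samples of \<open>FT g\<close> by the factor \<open>SINC_over_Q l\<close>; \<open>E l\<close> measures the error.\<close>
  define E where "E l = (\<Sum>n\<in>index_cube l. (norm (FT g (t n)))\<^sup>2 * (SINC_over_Q l (t n) - 1)\<^sup>2)" for l
  have "E \<longlonglongrightarrow> 0"
    unfolding E_def
  proof (rule weighted_sums_tendsto_0[where S = "(K * L2_norm cube_measure g)\<^sup>2" and B = 4])
    show "index_cube l \<subseteq> index_cube m" if "l \<le> m" for l m using that by (rule index_cube_mono)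
    show "(\<Sum>n\<in>index_cube l. (norm (FT g (t n)))\<^sup>2) \<le> (K * L2_norm cube_measure g)\<^sup>2" for l
      by (rule Bessel_bound[OF L K K0 g finite_index_cube])
    show "(SINC_over_Q l (t n) - 1)\<^sup>2 \<le> 4" for l n
    proof -
      have "\<bar>SINC_over_Q l (t n) - 1\<bar> \<le> 2" using abs_SINC_over_Q_le_1[of l "t n"] by linarith
      from power_mono[OF this, of 2] show ?thesis unfolding power2_abs by simp
    qed
    show "(\<lambda>l. (SINC_over_Q l (t n) - 1)\<^sup>2) \<longlonglongrightarrow> 0" for n
      using tendsto_power[OF tendsto_diff[OF SINC_over_Q_tendsto_1 tendsto_const], of "t n" 1 2] by simp
  qed (auto simp: finite_index_cube)
  then have sqrtE: "(\<lambda>l. M * sqrt (E l)) \<longlonglongrightarrow> 0"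
    using tendsto_mult_right_zero tendsto_real_sqrt real_sqrt_zero by metis
  have h_lim: "(\<lambda>l. L2_norm cube_measure (\<lambda>x. h l x - g x)) \<longlonglongrightarrow> 0"
  proof (rule LIMSEQ_I)
    fix \<epsilon> :: real assume \<epsilon>: "\<epsilon> > 0"
    \<comment> \<open>The distance of \<open>q\<close> to \<open>g\<close> enters once directly and once through the stability estimate.\<close>
    define \<eta> where "\<eta> = \<epsilon> / (2 * (M * K + 1))"
    have MK: "M * K + 1 > 0" using M0 K0 by (simp add: add_nonneg_pos)
    have "c * (\<epsilon> / (2 * c)) = \<epsilon> / 2" if "c > 0" for c :: real using that by simp
    from this[OF MK] have \<eta>: "\<eta> > 0" "(M * K + 1) * \<eta> = \<epsilon> / 2" using \<epsilon> MK by (auto simp: \<eta>_def)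
    from trig_polys_dense[OF g] \<eta>(1) obtain q m where q: "q \<in> trig_space m" and gq: "L2_norm cube_measure (\<lambda>x. g x - q x) < \<eta>"
      by (auto simp: trig_closure_def trig_polys_def)
    have qL2: "q \<in> L2 cube_measure" by (rule trig_space_L2[OF q])
    from order_tendstoD(2)[OF sqrtE, of "\<epsilon> / 2"] \<epsilon> obtain N where N: "\<And>l. l \<ge> N \<Longrightarrow> M * sqrt (E l) < \<epsilon> / 2"
      by (auto simp: eventually_sequentially)
    have "norm (L2_norm cube_measure (\<lambda>x. h l x - g x) - 0) < \<epsilon>" if l: "l \<ge> max 1 (max m N)" for l
    proof -
      have l1: "1 \<le> l" using l by simp
      have hl: "h l \<in> L2 cube_measure" by (rule trig_space_L2[OF h[OF l1]])
      have ql: "q \<in> trig_space l" using q trig_space_mono[of m l] l by auto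
      have k: "(\<lambda>x. h l x - q x) \<in> trig_space l"
        using trig_space_add[OF h[OF l1] trig_space_cmult[OF ql, of "- 1"]] by simp
      define d where "d n = f (t n) * of_real (SINC_over_Q l (t n) - 1)" for n
      have "L2_norm cube_measure (\<lambda>x. h l x - q x) \<le>
          M * (K * L2_norm cube_measure (\<lambda>x. g x - q x) + sqrt (\<Sum>n\<in>index_cube l. (norm (d n))\<^sup>2))"
      proof (rule stability[OF l1 k L2_diff[OF g qL2]])
        show "FT (\<lambda>x. h l x - q x) (t n) = FT (\<lambda>x. g x - q x) (t n) + d n" if "n \<in> index_cube l" for n
          by (simp add: FT_diff hl g qL2 h_int[OF l1 that] d_def fg algebra_simps)
      qed
      also have "(\<Sum>n\<in>index_cube l. (norm (d n))\<^sup>2) = E l"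
        unfolding E_def d_def by (intro sum.cong refl) (simp only: norm_mult power_mult_distrib norm_of_real power2_abs fg)
      finally have "L2_norm cube_measure (\<lambda>x. h l x - q x) \<le> M * (K * L2_norm cube_measure (\<lambda>x. g x - q x)) + M * sqrt (E l)"
        by (simp add: distrib_left)
      moreover have "L2_norm cube_measure (\<lambda>x. h l x - g x) \<le> L2_norm cube_measure (\<lambda>x. h l x - q x) + L2_norm cube_measure (\<lambda>x. q x - g x)"
        by (rule L2_norm_diff_triangle[OF hl qL2 g])
      moreover have "M * (K * L2_norm cube_measure (\<lambda>x. g x - q x)) + L2_norm cube_measure (\<lambda>x. q x - g x) \<le> \<epsilon> / 2"
      proof -
        have "M * (K * L2_norm cube_measure (\<lambda>x. g x - q x)) + L2_norm cube_measure (\<lambda>x. q x - g x) =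
            (M * K + 1) * L2_norm cube_measure (\<lambda>x. g x - q x)"
          by (simp add: L2_norm_commute[of _ q g] algebra_simps)
        also have "\<dots> \<le> (M * K + 1) * \<eta>" using gq MK by (intro mult_left_mono) auto
        finally show ?thesis by (simp only: \<eta>(2))
      qed
      moreover have "M * sqrt (E l) < \<epsilon> / 2" using N l by simp
      ultimately have "L2_norm cube_measure (\<lambda>x. h l x - g x) < \<epsilon>" by linarith
      then show ?thesis by simp
    qed
    then show "\<exists>N. \<forall>l\<ge>N. norm (L2_norm cube_measure (\<lambda>x. h l x - g x) - 0) < \<epsilon>" by blast
  qed
  define \<Psi> where "\<Psi> = restrict p {1..}"
  have \<Psi>: "\<Psi> l = p l" if "1 \<le> l" for l using that by (simp add: \<Psi>_def)
  have \<Psi>_FT: "\<Psi> l s * of_real (SINC_over_Q l s) = FT (h l) s" if "1 \<le> l" for l s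
    using hp[OF that] \<Psi>[OF that] by simp
  have diff: "FT (h l) s - f s = FT (\<lambda>x. h l x - g x) s" if "1 \<le> l" for l s
    by (simp add: FT_diff trig_space_L2[OF h[OF that]] g fg)
  have ev: "\<forall>\<^sub>F l in sequentially. 1 \<le> (l::nat)" by (rule eventually_ge_at_top)
  show ?thesis
  proof (rule ex1I[of _ \<Psi>], intro conjI allI impI ballI)
    show "\<Psi> \<in> extensional {1..}" by (simp add: \<Psi>_def)
    show "poly_coord_degree_le (2 * l) (\<Psi> l)" if "1 \<le> l" for l using p[OF that] \<Psi>[OF that] by simp
    show "\<Psi> l (t n) = f (t n)" if "1 \<le> l" "n \<in> index_cube l" for l n using p_int[OF that] \<Psi>[OF that(1)] by simp
    show "L2_tendsto lborel (\<lambda>l s. \<Psi> l s * of_real (SINC_over_Q l s)) f sequentially"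
      unfolding L2_tendsto_def
    proof (intro conjI)
      show "f \<in> L2 lborel" unfolding fg by (rule FT_L2[OF g])
      show "\<forall>\<^sub>F l in sequentially. (\<lambda>s. \<Psi> l s * of_real (SINC_over_Q l s)) \<in> L2 lborel"
        using ev by eventually_elim (simp add: \<Psi>_FT FT_L2 trig_space_L2[OF h])
      show "(\<lambda>l. L2_norm lborel (\<lambda>s. \<Psi> l s * of_real (SINC_over_Q l s) - f s)) \<longlonglongrightarrow> 0"
      proof (rule tendsto_sandwich[OF _ _ tendsto_const h_lim])
        show "\<forall>\<^sub>F l in sequentially. L2_norm lborel (\<lambda>s. \<Psi> l s * of_real (SINC_over_Q l s) - f s)
            \<le> L2_norm cube_measure (\<lambda>x. h l x - g x)"
          using ev by eventually_elim (simp add: \<Psi>_FT diff L2_norm_FT L2_diff g trig_space_L2[OF h])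
      qed simp
    qed
    show "uniform_limit UNIV (\<lambda>l s. \<Psi> l s * of_real (SINC_over_Q l s)) f sequentially"
    proof (rule uniform_limitI)
      fix \<epsilon> :: real assume "\<epsilon> > 0"
      with order_tendstoD(2)[OF h_lim] have "\<forall>\<^sub>F l in sequentially. L2_norm cube_measure (\<lambda>x. h l x - g x) < \<epsilon>" .
      with ev show "\<forall>\<^sub>F l in sequentially. \<forall>s\<in>UNIV. dist (\<Psi> l s * of_real (SINC_over_Q l s)) (f s) < \<epsilon>"
      proof eventually_elim
        case (elim l)
        have "dist (\<Psi> l s * of_real (SINC_over_Q l s)) (f s) \<le> L2_norm cube_measure (\<lambda>x. h l x - g x)" for s
          unfolding \<Psi>_FT[OF elim(1)] dist_norm diff[OF elim(1)]
          by (intro norm_FT_le L2_diff g trig_space_L2[OF h[OF elim(1)]])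
        with elim(2) show ?case by (blast intro: le_less_trans)
      qed
    qed
  next
    fix \<Phi> :: "nat \<Rightarrow> real^'d \<Rightarrow> complex"
    assume \<Phi>: "\<Phi> \<in> extensional {1..} \<and>
           (\<forall>l\<ge>1. poly_coord_degree_le (2 * l) (\<Phi> l)) \<and>
           (\<forall>l\<ge>1. \<forall>n\<in>index_cube l. \<Phi> l (t n) = f (t n)) \<and>
           L2_tendsto lborel (\<lambda>l s. \<Phi> l s * of_real (SINC_over_Q l s)) f sequentially \<and>
           uniform_limit UNIV (\<lambda>l s. \<Phi> l s * of_real (SINC_over_Q l s)) f sequentially"
    show "\<Phi> = \<Psi>"
    proof (rule extensionalityI[of _ "{1..}"])
      fix l :: nat assume "l \<in> {1..}"
      then have l: "1 \<le> l" by simp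
      show "\<Phi> l = \<Psi> l"
        unfolding \<Psi>[OF l] by (rule unique[OF l _ p[OF l]]) (use \<Phi> l p_int in auto)
    qed (use \<Phi> in \<open>auto simp: \<Psi>_def\<close>)
  qed
qed

end
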